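(* Let $n\geq1$ and $k\geq1$ be integers. There is a homotopy equivalence $${\mathcal B}_n(S^k)\simeq\Sigma^{k+1}Q_{n,k},$$ where $Q_{n,k}$ is the quotient of $S^{(k+1)(n-1)-1}$, the unit sphere in the linear subspace $\{(v_1,\ldots,v_n)\in(\mathbb R^{k+1})^n\mid\sum v_i=0\}$, under the $\mathfrak S_n$-action given by permuting the $v_i$.
   Context: $\Sigma^{k+1}Z=S^k*Z$ is the $(k+1)$-fold unreduced suspension ($*$ is the join; for $n=1$, $Q_{1,k}$ is empty and $S^k*\emptyset=S^k$). Let $\Delta_{m-1}=\{(t_1,\ldots,t_m):t_i\in[0,1],\sum t_i=1\}$, with $\mathfrak S_m$ acting on $\Delta_{m-1}$ and on $X^m$ by permuting coordinates. The $n$-th space of barycenters of a space $X$ is the quotient space ${\mathcal B}_n(X)=\coprod_{m=1}^n\Delta_{m-1}\times_{\mathfrak S_m}X^m/\approx$ (diagonal $\mathfrak S_m$-quotients). Writing points as formal abelian (unordered) sums $\sum t_ix_i$ with $\sum t_i=1$, $\approx$ is generated by (i) deletion of entries with $t_i=0$, and (ii) $t_1x_1+t_2x_1+t_3x_3+\cdots+t_mx_m\approx(t_1+t_2)x_1+t_3x_3+\cdots+t_mx_m$. *)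

theory Defs
  imports "HOL-Analysis.Analysis" "HOL-Homology.Homology"
begin

text \<open>Quotient of a space by the equivalence relation \<^emph>\<open>generated\<close> by \<open>r\<close> on its points.  The points
of the quotient are the equivalence classes.\<close>

definition quot_class :: "'a topology \<Rightarrow> ('a \<Rightarrow> 'a \<Rightarrow> bool) \<Rightarrow> 'a \<Rightarrow> 'a set" where
  "quot_class X r x = {y. equivclp (\<lambda>a b. a \<in> topspace X \<and> b \<in> topspace X \<and> r a b) x y}"

definition quotient_space :: "'a topology \<Rightarrow> ('a \<Rightarrow> 'a \<Rightarrow> bool) \<Rightarrow> 'a set topology" where
  "quotient_space X r =
     topology (\<lambda>U. U \<subseteq> quot_class X r ` topspace X \<and>
                   openin X {x \<in> topspace X. quot_class X r x \<in> U})"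

lemma istopology_quotient_space:
  "istopology (\<lambda>U. U \<subseteq> quot_class X r ` topspace X \<and>
                   openin X {x \<in> topspace X. quot_class X r x \<in> U})"
proof -
  have 1: "{x \<in> topspace X. quot_class X r x \<in> S \<inter> T} =
     {x \<in> topspace X. quot_class X r x \<in> S} \<inter> {x \<in> topspace X. quot_class X r x \<in> T}" for S T
    by auto
  have 2: "{x \<in> topspace X. quot_class X r x \<in> \<Union>K} =
     (\<Union>S\<in>K. {x \<in> topspace X. quot_class X r x \<in> S})" for K
    by auto
  show ?thesis
    unfolding istopology_def 1 2 by blast
qed

lemma openin_quotient_space:
  "openin (quotient_space X r) U \<longleftrightarrow>
     U \<subseteq> quot_class X r ` topspace X \<and> openin X {x \<in> topspace X. quot_class X r x \<in> U}"
  by (simp add: quotient_space_def topology_inverse'[OF istopology_quotient_space])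

lemma topspace_quotient_space [simp]:
  "topspace (quotient_space X r) = quot_class X r ` topspace X"
proof -
  have "{x \<in> topspace X. quot_class X r x \<in> quot_class X r ` topspace X} = topspace X"
    by auto
  then have "openin (quotient_space X r) (quot_class X r ` topspace X)"
    by (simp add: openin_quotient_space)
  then show ?thesis
    by (meson openin_quotient_space openin_subset openin_topspace subset_antisym)
qed

lemma quotient_map_quot_class: "quotient_map X (quotient_space X r) (quot_class X r)"
  by (auto simp: quotient_map_def openin_quotient_space)

lemma quot_class_eq_iff:
  "quot_class X r x = quot_class X r y \<longleftrightarrow>
     equivclp (\<lambda>a b. a \<in> topspace X \<and> b \<in> topspace X \<and> r a b) x y"
  unfolding quot_class_def
  by (metis (mono_tags, lifting) Collect_cong equivclp_refl equivclp_sym equivclp_trans mem_Collect_eq)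


text \<open>The library's \<^const>\<open>sum_topology\<close> needs summands of one type; this is the coproduct of two
spaces over different types.\<close>

definition coprod_topology :: "'a topology \<Rightarrow> 'b topology \<Rightarrow> ('a + 'b) topology" where
  "coprod_topology X Y = topology (\<lambda>U. openin X (Inl -` U) \<and> openin Y (Inr -` U))"

lemma openin_coprod_topology:
  "openin (coprod_topology X Y) U \<longleftrightarrow> openin X (Inl -` U) \<and> openin Y (Inr -` U)"
proof -
  have "istopology (\<lambda>U. openin X (Inl -` U) \<and> openin Y (Inr -` U))"
    by (auto simp: istopology_def vimage_Union)
  then show ?thesis
    by (simp add: coprod_topology_def topology_inverse')
qed

lemma topspace_coprod_topology [simp]:
  "topspace (coprod_topology X Y) = topspace X <+> topspace Y"
proof
  have l: "Inl -` topspace (coprod_topology X Y) \<subseteq> topspace X"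
    and r: "Inr -` topspace (coprod_topology X Y) \<subseteq> topspace Y"
    using openin_topspace[of "coprod_topology X Y"]
    unfolding openin_coprod_topology by (blast dest: openin_subset)+
  show "topspace (coprod_topology X Y) \<subseteq> topspace X <+> topspace Y"
  proof
    fix z assume "z \<in> topspace (coprod_topology X Y)"
    with l r show "z \<in> topspace X <+> topspace Y"
      by (cases z) auto
  qed
  have "Inl -` (topspace X <+> topspace Y) = topspace X"
    "Inr -` (topspace X <+> topspace Y) = topspace Y"
    by auto
  then have "openin (coprod_topology X Y) (topspace X <+> topspace Y)"
    by (simp add: openin_coprod_topology)
  then show "topspace X <+> topspace Y \<subseteq> topspace (coprod_topology X Y)"
    by (rule openin_subset)
qed


text \<open>The join as the double mapping cylinder of the projections \<open>X \<leftarrow> X \<times> Y \<rightarrow> Y\<close>: the ends of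
\<open>X \<times> Y \<times> [0,1]\<close> are glued to copies of \<open>X\<close> and \<open>Y\<close>.  For nonempty \<open>X\<close> and \<open>Y\<close> this is the usual
quotient of \<open>X \<times> Y \<times> [0,1]\<close>; the copies of \<open>X\<close> and \<open>Y\<close> ensure that the join with the empty space
is \<open>X\<close>, respectively \<open>Y\<close>.\<close>

inductive join_rel :: "'a + (('a \<times> 'b) \<times> real) + 'b \<Rightarrow> 'a + (('a \<times> 'b) \<times> real) + 'b \<Rightarrow> bool" where
  "join_rel (Inr (Inl ((x, y), 0))) (Inl x)"
| "join_rel (Inr (Inl ((x, y), 1))) (Inr (Inr y))"

definition join_space ::
    "'a topology \<Rightarrow> 'b topology \<Rightarrow> ('a + (('a \<times> 'b) \<times> real) + 'b) set topology" where
  "join_space X Y =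
     quotient_space
       (coprod_topology X
         (coprod_topology (prod_topology (prod_topology X Y) (top_of_set {0..1})) Y))
       join_rel"

text \<open>\<open>iterated_suspension k Z\<close> is the \<open>(k+1)\<close>-fold unreduced suspension
\<open>\<Sigma>\<^bsup>k+1\<^esup>Z = S\<^bsup>k\<^esup> * Z\<close>.\<close>

definition iterated_suspension ::
    "nat \<Rightarrow> 'a topology \<Rightarrow> ((nat \<Rightarrow> real) + (((nat \<Rightarrow> real) \<times> 'a) \<times> real) + 'a) set topology" where
  "iterated_suspension k Z = join_space (nsphere k) Z"


text \<open>\<open>weighted_tuples X m\<close> is \<open>\<Delta>\<^bsub>m-1\<^esub> \<times> X\<^bsup>m\<^esup>\<close> for \<open>m \<ge> 1\<close>, both kinds of coordinates being
indexed by \<open>{..<m}\<close>; \<open>sym_weighted_tuples\<close> is its orbit space under the diagonal action of the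
symmetric group.\<close>

definition weighted_tuples :: "'a topology \<Rightarrow> nat \<Rightarrow> ((nat \<Rightarrow> real) \<times> (nat \<Rightarrow> 'a)) topology" where
  "weighted_tuples X m =
     prod_topology (subtopology (powertop_real UNIV) (standard_simplex (m - 1)))
                   (product_topology (\<lambda>_. X) {..<m})"

definition perm_pair_rel ::
    "nat \<Rightarrow> (nat \<Rightarrow> real) \<times> (nat \<Rightarrow> 'a) \<Rightarrow> (nat \<Rightarrow> real) \<times> (nat \<Rightarrow> 'a) \<Rightarrow> bool" where
  "perm_pair_rel m z w \<longleftrightarrow> (\<exists>p. p permutes {..<m} \<and> w = (fst z \<circ> p, snd z \<circ> p))"

definition sym_weighted_tuples ::
    "'a topology \<Rightarrow> nat \<Rightarrow> ((nat \<Rightarrow> real) \<times> (nat \<Rightarrow> 'a)) set topology" where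
  "sym_weighted_tuples X m = quotient_space (weighted_tuples X m) (perm_pair_rel m)"

text \<open>The unordered formal sum \<open>\<Sum>i<m. t i \<cdot> x i\<close>, as a point of the \<open>m\<close>-th summand of the
coproduct.\<close>

definition formal_sum ::
    "'a topology \<Rightarrow> nat \<Rightarrow> (nat \<Rightarrow> real) \<Rightarrow> (nat \<Rightarrow> 'a) \<Rightarrow> nat \<times> ((nat \<Rightarrow> real) \<times> (nat \<Rightarrow> 'a)) set" where
  "formal_sum X m t x = (m, quot_class (weighted_tuples X m) (perm_pair_rel m) (t, x))"

text \<open>Omission of the \<open>i\<close>-th entry.  Weights are extended by \<open>0\<close> and points by \<open>undefined\<close> beyond the
index range; both conventions are preserved by the shift.\<close>

definition omit :: "nat \<Rightarrow> (nat \<Rightarrow> 'b) \<Rightarrow> nat \<Rightarrow> 'b" where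
  "omit i f = (\<lambda>j. if j < i then f j else f (Suc j))"

inductive barycenter_rel ::
    "'a topology \<Rightarrow> nat \<times> ((nat \<Rightarrow> real) \<times> (nat \<Rightarrow> 'a)) set
       \<Rightarrow> nat \<times> ((nat \<Rightarrow> real) \<times> (nat \<Rightarrow> 'a)) set \<Rightarrow> bool" for X where
  delete: "\<lbrakk>(t, x) \<in> topspace (weighted_tuples X (Suc m)); m \<ge> 1; i \<le> m; t i = 0\<rbrakk>
     \<Longrightarrow> barycenter_rel X (formal_sum X (Suc m) t x) (formal_sum X m (omit i t) (omit i x))"
| merge: "\<lbrakk>(t, x) \<in> topspace (weighted_tuples X (Suc m)); m \<ge> 1; x 0 = x 1\<rbrakk>
     \<Longrightarrow> barycenter_rel X (formal_sum X (Suc m) t x)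
                          (formal_sum X m ((omit 0 t)(0 := t 0 + t 1)) (omit 0 x))"

definition barycenter_space ::
    "nat \<Rightarrow> 'a topology \<Rightarrow> (nat \<times> ((nat \<Rightarrow> real) \<times> (nat \<Rightarrow> 'a)) set) set topology" where
  "barycenter_space n X =
     quotient_space (sum_topology (sym_weighted_tuples X) {1..n}) (barycenter_rel X)"


text \<open>The unit sphere of \<open>{v \<in> (\<real>\<^bsup>k+1\<^esup>)\<^bsup>n\<^esup>. \<Sum>i<n. v i = 0}\<close>, where \<open>v i j\<close> is the \<open>j\<close>-th
coordinate of \<open>v i\<close>; it is empty for \<open>n = 1\<close>.\<close>

definition sum_zero_sphere :: "nat \<Rightarrow> nat \<Rightarrow> (nat \<Rightarrow> nat \<Rightarrow> real) topology" where
  "sum_zero_sphere n k =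
     subtopology (product_topology (\<lambda>_. Euclidean_space (Suc k)) {..<n})
       {v. (\<forall>j\<le>k. (\<Sum>i<n. v i j) = 0) \<and> (\<Sum>i<n. \<Sum>j\<le>k. (v i j)\<^sup>2) = 1}"

definition perm_rel :: "nat \<Rightarrow> (nat \<Rightarrow> 'b) \<Rightarrow> (nat \<Rightarrow> 'b) \<Rightarrow> bool" where
  "perm_rel n v w \<longleftrightarrow> (\<exists>p. p permutes {..<n} \<and> w = v \<circ> p)"

definition Q_space :: "nat \<Rightarrow> nat \<Rightarrow> (nat \<Rightarrow> nat \<Rightarrow> real) set topology" where
  "Q_space n k = quotient_space (sum_zero_sphere n k) (perm_rel n)"

end

theory Submission
  imports Defs
begin

text \<open>Both spaces are quotients of the compact space \<open>W\<close> of configurations of \<open>n\<close> weighted points of \<open>S\<^bsup>k\<^esup>\<close>. Identifying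
configurations that define the same measure yields the space of barycenters. Identifying only those with the
same multiset of nonzero weighted points, and sending \<open>\<Sum>i<n. t i \<cdot> x i\<close> to the vectors \<open>\<surd>(t i) \<cdot> x i\<close>, yields the
orbit space of the unit sphere of \<open>(\<real>\<^bsup>k+1\<^esup>)\<^bsup>n\<^esup>\<close> under \<open>\<SS>\<^sub>n\<close>. As \<open>(\<real>\<^bsup>k+1\<^esup>)\<^bsup>n\<^esup>\<close> is the sum of the diagonal, with trivial action,
and of the subspace of tuples with sum zero, this orbit space is \<open>S\<^bsup>k\<^esup> * Q\<^bsub>n,k\<^esub>\<close>.

The coarser quotient is reached from the finer one in finitely many stages, where stage \<open>(r, m)\<close> collapses the formal
sums with \<open>r\<close> positive weights and \<open>m < r\<close> distinct positions. A formal sum near those is deformed by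
trimming all weights but the \<open>r\<close> largest, gathering the positions into \<open>m\<close> clusters, and
moving the smallest weight of each cluster with several points to its largest one. At the end a formal sum
collapsed at stage \<open>(r, m)\<close> has fewer than \<open>r\<close> weights, so the deformation descends to both quotients and shows
that they are homotopy equivalent.\<close>

section \<open>Homotopy equivalences of quotients\<close>

text \<open>The obstacle is that the natural choices in such a deformation jump: the sorting at
  equal weights, the clusters at threshold distances, the clocks where their durations tend to 0. So
  continuity is asked for only modulo the finer relation, and one quantity, \<open>scale\<close>,
  controls the jumps. It vanishes where the \<open>r\<close> heaviest weights are not separated from
  the rest or have fewer than \<open>m\<close> positions. Where it is positive, the clusters are
  locally constant whenever weight is being transferred. Near its zeros they may jump, but only once
  trimming is over, and then every limit lies in the part collapsed earlier, where only the measure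
  counts. The measure does converge, because weight is transferred only between points that already
  coincide. This dictates the order of the three movements and the lexicographic order of the
  stages.

  No quotient is shown to be Hausdorff by hand: each one is recognized by a continuous complete
  invariant on a compact space, with values in a power of the real line indexed by test
  functions.\<close>

lemma quotient_maps_homeomorphic:
  assumes q: "quotient_map X P q" and q': "quotient_map X P' q'"
    and eq: "\<And>x y. \<lbrakk>x \<in> topspace X; y \<in> topspace X\<rbrakk> \<Longrightarrow> q x = q y \<longleftrightarrow> q' x = q' y"
  shows "P homeomorphic_space P'"
proof -
  obtain f where f: "continuous_map P P' f" "\<And>x. x \<in> topspace X \<Longrightarrow> f (q x) = q' x"
    using quotient_map_lift_exists[OF q quotient_imp_continuous_map[OF q']] eq by metis
  obtain g where g: "continuous_map P' P g" "\<And>x. x \<in> topspace X \<Longrightarrow> g (q' x) = q x"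
    using quotient_map_lift_exists[OF q' quotient_imp_continuous_map[OF q]] eq by metis
  have P: "topspace P = q ` topspace X" and P': "topspace P' = q' ` topspace X"
    using q q' by (auto simp: quotient_map_def)
  have "homeomorphic_maps P P' f g"
    using f g by (auto simp: homeomorphic_maps_def P P')
  then show ?thesis
    unfolding homeomorphic_space_def by blast
qed

text \<open>A continuous map from a compact space to a Hausdorff space is closed, hence a quotient
  map onto its image.\<close>

lemma quotient_map_onto_image:
  assumes "compact_space X" and "Hausdorff_space T" and "continuous_map X T f"
  shows "quotient_map X (subtopology T (f ` topspace X)) f"
proof (rule continuous_imp_quotient_map)
  show "continuous_map X (subtopology T (f ` topspace X)) f"
    using assms by (auto simp: continuous_map_in_subtopology)
  have "f ` topspace X \<subseteq> topspace T"
    using assms continuous_map_image_subset_topspace by blast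
  then show "f ` topspace X = topspace (subtopology T (f ` topspace X))"
    by auto
qed (use assms Hausdorff_space_subtopology in auto)

text \<open>This is what allows the collapsing homotopy to be discontinuous on configurations: only its
limit points modulo the finer relation matter.\<close>

lemma continuous_map_of_cluster_points:
  fixes W :: "'a::metric_space set" and Z :: "'b::metric_space set"
  assumes "compact W" and q: "continuous_map (top_of_set W) P q"
    and e: "\<And>z. z \<in> Z \<Longrightarrow> e z \<in> W"
    and seq: "\<And>zs z w. \<lbrakk>\<forall>k. zs k \<in> Z; z \<in> Z; zs \<longlonglongrightarrow> z; (\<lambda>k. e (zs k)) \<longlonglongrightarrow> w; w \<in> W\<rbrakk> \<Longrightarrow> q w = q (e z)"
  shows "continuous_map (top_of_set Z) P (q \<circ> e)"
  unfolding continuous_map_closedin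
proof (intro conjI ballI allI impI)
  show "q \<circ> e \<in> topspace (top_of_set Z) \<rightarrow> topspace P"
    using e continuous_map_funspace[OF q] by auto
  fix C assume C: "closedin P C"
  have "closedin (top_of_set W) {w \<in> W. q w \<in> C}"
    using closedin_continuous_map_preimage[OF q C] by simp
  then have "closed {w \<in> W. q w \<in> C}"
    using \<open>compact W\<close> closedin_closed_trans compact_imp_closed by blast
  then have D: "\<And>x l. \<lbrakk>\<And>n. x n \<in> W \<and> q (x n) \<in> C; x \<longlonglongrightarrow> l\<rbrakk> \<Longrightarrow> q l \<in> C"
    unfolding closed_sequential_limits by blast
  define D where "D = {z \<in> Z. q (e z) \<in> C}"
  have "z \<in> D" if zc: "z \<in> Z" "z \<in> closure D" for z
  proof -
    obtain zs where zs: "\<forall>n. zs n \<in> D" "zs \<longlonglongrightarrow> z" and z: "z \<in> Z"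
      using zc closure_sequential[of z D] by blast
    then have "\<forall>n. e (zs n) \<in> W" using e by (auto simp: D_def)
    then obtain w r where w: "w \<in> W" "strict_mono r" "((\<lambda>k. e (zs k)) \<circ> r) \<longlonglongrightarrow> w"
      using \<open>compact W\<close> unfolding compact_def by meson
    have "q w = q (e z)"
    proof (rule seq)
      show "\<forall>k. (zs \<circ> r) k \<in> Z" using zs by (auto simp: D_def)
      show "(zs \<circ> r) \<longlonglongrightarrow> z" using LIMSEQ_subseq_LIMSEQ zs(2) w(2) by blast
      show "(\<lambda>k. e ((zs \<circ> r) k)) \<longlonglongrightarrow> w" using w(3) by (simp add: o_def)
    qed (use z w in auto)
    moreover have "q w \<in> C"
      using D[of "\<lambda>k. e (zs (r k))" w] w zs e by (auto simp: o_def D_def)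
    ultimately show "z \<in> D" using z by (simp add: D_def)
  qed
  then have "D = Z \<inter> closure D"
    using closure_subset[of D] by (auto simp: D_def)
  then have "closedin (top_of_set Z) D"
    by (metis closed_closure closedin_closed_Int)
  then show "closedin (top_of_set Z) {x \<in> topspace (top_of_set Z). (q \<circ> e) x \<in> C}"
    by (simp add: D_def)
qed

lemma quotient_map_lift_top_of_set:
  assumes "quotient_map (top_of_set W) P q" and "continuous_map (top_of_set W) P' f"
    and "\<And>w w'. \<lbrakk>w \<in> W; w' \<in> W; q w = q w'\<rbrakk> \<Longrightarrow> f w = f w'"
  shows "\<exists>g. continuous_map P P' g \<and> (\<forall>w\<in>W. g (q w) = f w)"
proof -
  have "f x = f y" if "x \<in> topspace (top_of_set W)" "y \<in> topspace (top_of_set W)" "q x = q y" for x y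
    using that assms(3)[of x y] unfolding topspace_euclidean_subtopology by blast
  then obtain g where g: "continuous_map P P' g" "\<And>w. w \<in> topspace (top_of_set W) \<Longrightarrow> g (q w) = f w"
    using quotient_map_lift_exists[OF assms(1,2)] by metis
  have "\<forall>w\<in>W. g (q w) = f w" using g(2) unfolding topspace_euclidean_subtopology by blast
  with g(1) show ?thesis by (intro exI conjI)
qed

text \<open>The product of a quotient map with the identity of \<open>[0,1]\<close> is a quotient
  map, because \<open>[0,1]\<close> is locally compact Hausdorff; so a homotopy may be given on
  representatives.\<close>

lemma homotopic_with_lift:
  fixes W :: "'a::metric_space set" and f :: "real \<times> 'a \<Rightarrow> 'c"
  assumes q: "quotient_map (top_of_set W) P q"
    and cont: "continuous_map (top_of_set ({0..1} \<times> W)) P' f"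
    and resp: "\<And>s w w'. \<lbrakk>s \<in> {0..1}; w \<in> W; w' \<in> W; q w = q w'\<rbrakk> \<Longrightarrow> f (s, w) = f (s, w')"
    and start: "\<And>w. w \<in> W \<Longrightarrow> a (q w) = f (0, w)"
    and finish: "\<And>w. w \<in> W \<Longrightarrow> b (q w) = f (1, w)"
  shows "homotopic_with (\<lambda>x. True) P P' a b"
proof -
  let ?I = "top_of_set {0..1::real}"
  have I: "locally_compact_space ?I" "Hausdorff_space ?I"
    by (auto intro!: compact_imp_locally_compact_space Hausdorff_space_subtopology compact_space_subtopology)
  have Q: "quotient_map (prod_topology ?I (top_of_set W)) (prod_topology ?I P) (\<lambda>(x,y). (x, q y))"
    using quotient_map_prod_right[OF I(1) _ q] I(2) by blast
  have "continuous_map (prod_topology ?I (top_of_set W)) P' f"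
    using cont by (simp add: subtopology_Times[symmetric])
  then have cont': "continuous_map (prod_topology ?I (top_of_set W)) P' f" .
  obtain h where
    h: "continuous_map (prod_topology ?I P) P' h"
       "\<And>z. z \<in> topspace (prod_topology ?I (top_of_set W)) \<Longrightarrow> h ((\<lambda>(x,y). (x, q y)) z) = f z"
  proof (rule quotient_map_lift_exists[OF Q cont'])
    fix y z assume "y \<in> topspace (prod_topology ?I (top_of_set W))" "z \<in> topspace (prod_topology ?I (top_of_set W))"
      and yz: "(case y of (x, y) \<Rightarrow> (x, q y)) = (case z of (x, y) \<Rightarrow> (x, q y))"
    then show "f y = f z"
      using resp[of "fst z" "snd y" "snd z"] by (cases y, cases z) (simp add: split_beta mem_Times_iff)
  qed blast
  have P: "topspace P = q ` W" using q by (auto simp: quotient_map_def)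
  have h01: "h (0, q w) = f (0, w)" "h (1, q w) = f (1, w)" if "w \<in> W" for w
    using h(2)[of "(0, w)"] h(2)[of "(1, w)"] that by auto
  have ab: "\<forall>x\<in>topspace P. h (0, x) = a x" "\<forall>x\<in>topspace P. h (1, x) = b x"
    unfolding P using h01 start finish by auto
  have "\<exists>h. continuous_map (prod_topology ?I P) P' h \<and> (\<forall>x\<in>topspace P. h (0, x) = a x) \<and>
      (\<forall>x\<in>topspace P. h (1, x) = b x) \<and> (\<forall>t\<in>{0..1}. (\<lambda>x. True) (\<lambda>x. h (t, x)))"
    using h(1) ab by blast
  then show ?thesis
    by (rule iffD2[OF homotopic_with, rotated]) (rule refl)
qed

text \<open>By \<open>r21\<close> the end of the deformation induces a map from the coarser quotient
  back to the finer one. The deformation itself, read in \<open>P1\<close> by \<open>r1\<close> and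
  in \<open>P2\<close> by \<open>r2\<close>, supplies the homotopies showing that this map inverts
  the projection. In place of continuity of \<open>e\<close>, only \<open>seq\<close> is
  assumed.\<close>

lemma homotopy_equivalent_quotients:
  fixes W :: "'a::metric_space set" and e :: "real \<times> 'a \<Rightarrow> 'a"
  assumes W: "compact W"
    and q1: "quotient_map (top_of_set W) P1 q1" and q2: "quotient_map (top_of_set W) P2 q2"
    and finer: "\<And>w w'. \<lbrakk>w \<in> W; w' \<in> W; q1 w = q1 w'\<rbrakk> \<Longrightarrow> q2 w = q2 w'"
    and e: "\<And>s w. \<lbrakk>s \<in> {0..1}; w \<in> W\<rbrakk> \<Longrightarrow> e (s, w) \<in> W"
    and e0: "\<And>w. w \<in> W \<Longrightarrow> q1 (e (0, w)) = q1 w"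
    and seq: "\<And>zs z w. \<lbrakk>\<forall>k. zs k \<in> {0..1} \<times> W; z \<in> {0..1} \<times> W; zs \<longlonglongrightarrow> z; (\<lambda>k. e (zs k)) \<longlonglongrightarrow> w; w \<in> W\<rbrakk>
        \<Longrightarrow> q1 w = q1 (e z)"
    and r1: "\<And>s w w'. \<lbrakk>s \<in> {0..1}; w \<in> W; w' \<in> W; q1 w = q1 w'\<rbrakk> \<Longrightarrow> q1 (e (s, w)) = q1 (e (s, w'))"
    and r2: "\<And>s w w'. \<lbrakk>s \<in> {0..1}; w \<in> W; w' \<in> W; q2 w = q2 w'\<rbrakk> \<Longrightarrow> q2 (e (s, w)) = q2 (e (s, w'))"
    and r21: "\<And>w w'. \<lbrakk>w \<in> W; w' \<in> W; q2 w = q2 w'\<rbrakk> \<Longrightarrow> q1 (e (1, w)) = q1 (e (1, w'))"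
  shows "P1 homotopy_equivalent_space P2"
proof -
  have c1: "continuous_map (top_of_set ({0..1} \<times> W)) P1 (q1 \<circ> e)"
  proof (rule continuous_map_of_cluster_points[OF W quotient_imp_continuous_map[OF q1]])
    show "e z \<in> W" if "z \<in> {0..1} \<times> W" for z
      using e[of "fst z" "snd z"] that unfolding mem_Times_iff prod.collapse by blast
  next
    fix zs z w assume "\<forall>k. zs k \<in> {0..1} \<times> W" "z \<in> {0..1} \<times> W" "zs \<longlonglongrightarrow> z" "(\<lambda>k. e (zs k)) \<longlonglongrightarrow> w" "w \<in> W"
    then show "q1 w = q1 (e z)" by (rule seq[of zs z w])
  qed
  obtain p where p: "continuous_map P1 P2 p" "\<forall>w\<in>W. p (q1 w) = q2 w"
    using quotient_map_lift_top_of_set[OF q1 quotient_imp_continuous_map[OF q2] finer] by blast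
  have c2: "continuous_map (top_of_set ({0..1} \<times> W)) P2 (p \<circ> (q1 \<circ> e))"
    using continuous_map_compose[OF c1 p(1)] .
  have "continuous_map (top_of_set W) (top_of_set ({0..1::real} \<times> W)) (\<lambda>w. (1, w))"
    by (simp add: continuous_on_Pair continuous_on_const continuous_on_id image_subset_iff_funcset Pi_def)
  from continuous_map_compose[OF this c1]
  have "continuous_map (top_of_set W) P1 (\<lambda>w. q1 (e (1, w)))" by (simp add: o_def)
  from quotient_map_lift_top_of_set[OF q2 this r21]
  obtain g where g: "continuous_map P2 P1 g" "\<forall>w\<in>W. g (q2 w) = q1 (e (1, w))"
    by blast
  have "homotopic_with (\<lambda>x. True) P1 P1 id (g \<circ> p)"
  proof (rule homotopic_with_lift[OF q1 c1])
    show "(q1 \<circ> e) (s, w) = (q1 \<circ> e) (s, w')" if "s \<in> {0..1}" "w \<in> W" "w' \<in> W" "q1 w = q1 w'" for s w w'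
      unfolding o_apply using that by (rule r1)
    show "id (q1 w) = (q1 \<circ> e) (0, w)" if "w \<in> W" for w
      unfolding o_apply e0[OF that] by simp
    show "(g \<circ> p) (q1 w) = (q1 \<circ> e) (1, w)" if "w \<in> W" for w
      using p(2) g(2) that by simp
  qed
  moreover have "homotopic_with (\<lambda>x. True) P2 P2 id (p \<circ> g)"
  proof (rule homotopic_with_lift[OF q2 c2])
    have pe: "(p \<circ> (q1 \<circ> e)) (s, w) = q2 (e (s, w))" if "s \<in> {0..1}" "w \<in> W" for s w
      unfolding o_apply using p(2) e[OF that] by blast
    show "(p \<circ> (q1 \<circ> e)) (s, w) = (p \<circ> (q1 \<circ> e)) (s, w')"
      if "s \<in> {0..1}" "w \<in> W" "w' \<in> W" "q2 w = q2 w'" for s w w'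
      unfolding pe[OF that(1,2)] pe[OF that(1,3)] using that by (rule r2)
    show "id (q2 w) = (p \<circ> (q1 \<circ> e)) (0, w)" if "w \<in> W" for w
      using e0[OF that] p(2) that by simp
    show "(p \<circ> g) (q2 w) = (p \<circ> (q1 \<circ> e)) (1, w)" if "w \<in> W" for w
      using g(2) that by simp
  qed
  ultimately show ?thesis
    unfolding homotopy_equivalent_space_def
    using p(1) g(1) by (intro exI[of _ p] exI[of _ g]) (simp add: homotopic_with_sym)
qed

lemma quot_class_eq_iff_equiv:
  assumes "\<And>x. x \<in> topspace X \<Longrightarrow> r x x"
    and "\<And>x y. \<lbrakk>x \<in> topspace X; y \<in> topspace X; r x y\<rbrakk> \<Longrightarrow> r y x"
    and "\<And>x y z. \<lbrakk>x \<in> topspace X; y \<in> topspace X; z \<in> topspace X; r x y; r y z\<rbrakk> \<Longrightarrow> r x z"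
    and xy: "x \<in> topspace X" "y \<in> topspace X"
  shows "quot_class X r x = quot_class X r y \<longleftrightarrow> r x y"
proof
  assume "quot_class X r x = quot_class X r y"
  then have "equivclp (\<lambda>a b. a \<in> topspace X \<and> b \<in> topspace X \<and> r a b) x y"
    by (simp add: quot_class_eq_iff)
  then show "r x y"
  proof (induction rule: equivclp_induct)
    case base then show ?case using assms(1) xy(1) .
  next
    case (step y z)
    then have "y \<in> topspace X" "z \<in> topspace X" "r y z \<or> r z y" by blast+
    then show ?case using step.IH assms(2)[of z y] assms(3)[of x y z] xy(1) by blast
  qed
next
  assume "r x y" then show "quot_class X r x = quot_class X r y"
    unfolding quot_class_eq_iff by (intro r_into_equivclp conjI xy)
qed

lemma equivclp_invariant:
  assumes "equivclp r x y" and "\<And>a b. r a b \<Longrightarrow> f a = f b"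
  shows "f x = f y"
  using assms(1)
proof (induction rule: equivclp_induct)
  case (step y z) then show ?case using assms(2)[of y z] assms(2)[of z y] by auto
qed simp

text \<open>Lagrange interpolation with distances in place of differences. It makes continuous test
  functions as good as arbitrary ones for finitely supported measures.\<close>

lemma finite_continuous_interpolation:
  fixes G :: "'a::metric_space \<Rightarrow> real"
  assumes "finite F"
  obtains g where "continuous_on UNIV g" "\<And>y. y \<in> F \<Longrightarrow> g y = G y"
proof
  let ?b = "\<lambda>y z. \<Prod>y'\<in>F - {y}. dist z y' / dist y y'"
  show "continuous_on UNIV (\<lambda>z. \<Sum>y\<in>F. G y * ?b y z)"
    by (intro continuous_intros) auto
  fix x assume x: "x \<in> F"
  have "?b y x = (if y = x then 1 else 0)" if "y \<in> F" for y
    using assms x by (auto intro!: prod.neutral prod_zero)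
  then have "(\<Sum>y\<in>F. G y * ?b y x) = (\<Sum>y\<in>F. if y = x then G y else 0)"
    by (intro sum.cong) auto
  then show "(\<Sum>y\<in>F. G y * ?b y x) = G x" using assms x by simp
qed

section \<open>Weighted configurations\<close>

type_synonym config = "(nat \<Rightarrow> real) \<times> (nat \<Rightarrow> nat \<Rightarrow> real)"

abbreviation sphere_set :: "nat \<Rightarrow> (nat \<Rightarrow> real) set" where
  "sphere_set k \<equiv> topspace (nsphere k)"

text \<open>Every index carries a position, which makes this a compact subset of a metric product
  space. Positions from \<open>n\<close> on, and those of weight 0, are seen by neither relation
  below.\<close>

definition configs :: "nat \<Rightarrow> nat \<Rightarrow> config set" where
  "configs n k = standard_simplex (n - 1) \<times> {x. \<forall>i. x i \<in> sphere_set k}"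

definition wsum :: "nat \<Rightarrow> config \<Rightarrow> (real \<Rightarrow> (nat \<Rightarrow> real) \<Rightarrow> real) \<Rightarrow> real" where
  "wsum n c \<Psi> = (\<Sum>i<n. \<Psi> (fst c i) (snd c i))"

text \<open>\<open>same_sum\<close> is equality of the multisets of weighted points with nonzero weight, and \<open>same_measure\<close>
equality of the measures \<open>\<Sum>i<n. t i \<cdot> \<delta>(x i)\<close>.\<close>

definition same_sum :: "nat \<Rightarrow> config \<Rightarrow> config \<Rightarrow> bool" where
  "same_sum n c c' \<longleftrightarrow> (\<forall>\<Psi>. (\<forall>y. \<Psi> 0 y = 0) \<longrightarrow> wsum n c \<Psi> = wsum n c' \<Psi>)"

definition same_measure :: "nat \<Rightarrow> config \<Rightarrow> config \<Rightarrow> bool" where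
  "same_measure n c c' \<longleftrightarrow> (\<forall>\<phi>. wsum n c (\<lambda>a y. a * \<phi> y) = wsum n c' (\<lambda>a y. a * \<phi> y))"

definition support :: "nat \<Rightarrow> config \<Rightarrow> nat set" where
  "support n c = {i. i < n \<and> fst c i \<noteq> 0}"

text \<open>The stages \<open>(r, m)\<close> are ordered lexicographically; passing from \<open>(r, m - 1)\<close> to \<open>(r, m)\<close> identifies
the formal sums with \<open>r\<close> positive weights and \<open>m\<close> distinct positions that define the same measure.\<close>

definition low :: "nat \<Rightarrow> nat \<Rightarrow> nat \<Rightarrow> config \<Rightarrow> bool" where
  "low n r m c \<longleftrightarrow> card (support n c) < r \<or> (card (support n c) \<le> r \<and> card (snd c ` support n c) \<le> m)"

definition stage_rel :: "nat \<Rightarrow> nat \<Rightarrow> nat \<Rightarrow> config \<Rightarrow> config \<Rightarrow> bool" where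
  "stage_rel n r m c c' \<longleftrightarrow> same_sum n c c' \<or> (same_measure n c c' \<and> low n r m c \<and> low n r m c')"

lemma finite_support [simp]: "finite (support n c)"
  by (simp add: support_def)

lemma same_sum_refl: "same_sum n c c"
  by (simp add: same_sum_def)

lemma same_sum_sym: "same_sum n c c' \<Longrightarrow> same_sum n c' c"
  by (simp add: same_sum_def)

lemma same_sum_trans: "same_sum n c c' \<Longrightarrow> same_sum n c' c'' \<Longrightarrow> same_sum n c c''"
  by (simp add: same_sum_def)

lemma same_measure_refl: "same_measure n c c"
  by (simp add: same_measure_def)

lemma same_measure_sym: "same_measure n c c' \<Longrightarrow> same_measure n c' c"
  by (simp add: same_measure_def)

lemma same_measure_trans: "same_measure n c c' \<Longrightarrow> same_measure n c' c'' \<Longrightarrow> same_measure n c c''"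
  by (simp add: same_measure_def)

lemma same_sum_imp_same_measure: "same_sum n c c' \<Longrightarrow> same_measure n c c'"
  unfolding same_sum_def same_measure_def by auto

lemma same_sum_permI:
  assumes p: "p permutes {..<n}"
    and t: "\<And>i. i < n \<Longrightarrow> fst c' i = fst c (p i)"
    and x: "\<And>i. i < n \<Longrightarrow> fst c' i \<noteq> 0 \<Longrightarrow> snd c' i = snd c (p i)"
  shows "same_sum n c c'"
  unfolding same_sum_def wsum_def
proof (intro allI impI)
  fix \<Psi> :: "real \<Rightarrow> (nat \<Rightarrow> real) \<Rightarrow> real" assume z: "\<forall>y. \<Psi> 0 y = 0"
  have "(\<Sum>i<n. \<Psi> (fst c i) (snd c i)) = (\<Sum>i<n. \<Psi> (fst c (p i)) (snd c (p i)))"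
    using sum.permute[OF p, of "\<lambda>i. \<Psi> (fst c i) (snd c i)"] by (simp add: o_def)
  also have "\<dots> = (\<Sum>i<n. \<Psi> (fst c' i) (snd c' i))"
  proof (rule sum.cong[OF refl])
    fix i assume "i \<in> {..<n}"
    then show "\<Psi> (fst c (p i)) (snd c (p i)) = \<Psi> (fst c' i) (snd c' i)"
      using t[of i] x[of i] z by (cases "fst c' i = 0") auto
  qed
  finally show "(\<Sum>i<n. \<Psi> (fst c i) (snd c i)) = (\<Sum>i<n. \<Psi> (fst c' i) (snd c' i))" .
qed

lemma image_mset_eq_of_card:
  assumes "finite A" and "\<And>y. card {i\<in>A. f i = y} = card {i\<in>A. g i = y}"
  shows "image_mset f (mset_set A) = image_mset g (mset_set A)"
proof (rule multiset_eqI)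
  have "count (image_mset h (mset_set A)) y = card {i\<in>A. h i = y}" for h :: "'a \<Rightarrow> 'b" and y
  proof -
    have "count (image_mset h (mset_set A)) y = sum (count (mset_set A)) {i \<in> A. h i = y}"
      unfolding count_image_mset' using assms(1) by (intro sum.cong) auto
    also have "\<dots> = card {i\<in>A. h i = y}"
      using assms(1) by (simp add: count_mset_set)
    finally show ?thesis .
  qed
  then show "count (image_mset f (mset_set A)) y = count (image_mset g (mset_set A)) y" for y
    using assms(2) by simp
qed

text \<open>Indicator functions in the role of \<open>\<Psi>\<close> count the entries equal to a
  given weighted point, and equal multiplicities yield a permutation.\<close>

lemma same_sum_permD:
  assumes "same_sum n c c'"
  shows "\<exists>p. p permutes {..<n} \<and> (\<forall>i<n. fst c' i = fst c (p i) \<and> (fst c' i \<noteq> 0 \<longrightarrow> snd c' i = snd c (p i)))"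
proof -
  \<comment> \<open>Positions of weight 0 need not correspond, so they are replaced by a common
    default.\<close>
  define f where "f c i = (fst c i, if fst c i = 0 then undefined else snd c i)" for c :: config and i
  have nz: "card {i\<in>{..<n}. fst c i = a \<and> snd c i = y} = card {i\<in>{..<n}. fst c' i = a \<and> snd c' i = y}"
    if "a \<noteq> 0" for a y
  proof -
    let ?\<Psi> = "\<lambda>b z. if b = a \<and> z = y then 1 else 0 :: real"
    have "wsum n c ?\<Psi> = wsum n c' ?\<Psi>" using assms that unfolding same_sum_def by auto
    then show ?thesis by (simp add: wsum_def sum.If_cases Int_def)
  qed
  \<comment> \<open>No admissible \<open>\<Psi>\<close> sees the zero weights; they are counted as
    the complement of the others.\<close>
  have z: "card {i\<in>{..<n}. fst c i = 0} = card {i\<in>{..<n}. fst c' i = 0}"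
  proof -
    let ?\<Psi> = "\<lambda>b z. if b = 0 then 0 else 1 :: real"
    have "wsum n c ?\<Psi> = wsum n c' ?\<Psi>" using assms unfolding same_sum_def by auto
    then have e: "card {i\<in>{..<n}. fst c i \<noteq> 0} = card {i\<in>{..<n}. fst c' i \<noteq> 0}"
      by (simp add: wsum_def sum.If_cases Int_def)
    have "card {i\<in>{..<n}. fst d i = 0} = n - card {i\<in>{..<n}. fst d i \<noteq> 0}" for d :: config
    proof -
      have "{i\<in>{..<n}. fst d i = 0} = {..<n} - {i\<in>{..<n}. fst d i \<noteq> 0}" by auto
      then show ?thesis by (simp add: card_Diff_subset subset_eq)
    qed
    with e show ?thesis by simp
  qed
  have fc: "card {i\<in>{..<n}. f d i = (a, y)} = (if a = 0 then (if y = undefined then card {i\<in>{..<n}. fst d i = 0} else 0)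
       else card {i\<in>{..<n}. fst d i = a \<and> snd d i = y})" for d :: config and a and y :: "nat \<Rightarrow> real"
  proof -
    have "{i\<in>{..<n}. f d i = (a, y)} = (if a = 0 then (if y = undefined then {i\<in>{..<n}. fst d i = 0} else {})
       else {i\<in>{..<n}. fst d i = a \<and> snd d i = y})"
      by (auto simp: f_def)
    then show ?thesis by simp
  qed
  have "image_mset (f c') (mset_set {..<n}) = image_mset (f c) (mset_set {..<n})"
  proof (rule image_mset_eq_of_card)
    show "card {i \<in> {..<n}. f c' i = y} = card {i \<in> {..<n}. f c i = y}" for y
      using nz z fc[of c' "fst y" "snd y"] fc[of c "fst y" "snd y"] by simp
  qed simp
  then obtain p where p: "p permutes {..<n}" "\<forall>i\<in>{..<n}. f c' i = f c (p i)"
    using image_mset_eq_implies_permutes[of "{..<n}" "f c'" "f c"] by blast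
  have "fst c' i = fst c (p i) \<and> (fst c' i \<noteq> 0 \<longrightarrow> snd c' i = snd c (p i))" if i: "i < n" for i
  proof -
    have "f c' i = f c (p i)" using i p(2) by blast
    then show ?thesis by (auto simp: f_def)
  qed
  with p(1) show ?thesis by blast
qed

text \<open>Sorted lists with the same multiset of entries are equal; the sign turns antitone into
  sorted. So two sorted configurations with the same formal sum have the same weights, index by
  index.\<close>

lemma antitone_perm_eq:
  fixes t t' :: "nat \<Rightarrow> real"
  assumes p: "p permutes {..<n}" and tp: "\<And>i. i < n \<Longrightarrow> t' i = t (p i)"
    and t: "\<And>i j. i \<le> j \<Longrightarrow> j < n \<Longrightarrow> t j \<le> t i" and t': "\<And>i j. i \<le> j \<Longrightarrow> j < n \<Longrightarrow> t' j \<le> t' i"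
    and i: "i < n"
  shows "t' i = t i"
proof -
  have s: "sorted (map (\<lambda>i. - u i) [0..<n])" if "\<And>i j. i \<le> j \<Longrightarrow> j < n \<Longrightarrow> u j \<le> u i" for u :: "nat \<Rightarrow> real"
    using that by (auto simp: sorted_iff_nth_mono)
  have "mset (map (\<lambda>i. - t' i) [0..<n]) = image_mset (\<lambda>i. - t (p i)) (mset_set {..<n})"
    using tp by (auto simp: mset_upt atLeast0LessThan intro!: image_mset_cong)
  also have "\<dots> = image_mset (\<lambda>i. - t i) (image_mset p (mset_set {..<n}))"
    by (simp add: multiset.map_comp o_def)
  also have "image_mset p (mset_set {..<n}) = mset_set {..<n}"
    using p by (simp add: permutes_image_mset)
  also have "image_mset (\<lambda>i. - t i) (mset_set {..<n}) = mset (map (\<lambda>i. - t i) [0..<n])"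
    by (simp add: atLeast0LessThan)
  finally have "sort (map (\<lambda>i. - t i) [0..<n]) = map (\<lambda>i. - t' i) [0..<n]"
    by (rule properties_for_sort) (rule s[OF t'])
  then have "map (\<lambda>i. - t i) [0..<n] = map (\<lambda>i. - t' i) [0..<n]"
    using sort_key_id_if_sorted[OF s[OF t]] by (metis sorted_sort_id s t)
  then show ?thesis using i by (auto dest: arg_cong[of _ _ "\<lambda>l. l ! i"])
qed

lemma antitone_perm_exists:
  fixes t :: "nat \<Rightarrow> real"
  obtains p where "p permutes {..<n}" "\<And>i j. i \<le> j \<Longrightarrow> j < n \<Longrightarrow> t (p j) \<le> t (p i)"
proof -
  let ?l = "sort_key (\<lambda>i. - t i) [0..<n]"
  have "mset ?l = mset [0..<n]" by simp
  have len: "length ?l = n" by simp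
  have dis: "distinct ?l" by simp
  have set: "set ?l = {..<n}" by auto
  define p where "p i = (if i < n then ?l ! i else i)" for i
  have "bij_betw p {..<n} {..<n}"
    using bij_betw_nth[OF dis, of "{..<n}" "{..<n}"] len set
    by (auto simp: p_def intro: bij_betw_cong[THEN iffD1, rotated])
  then have "p permutes {..<n}"
    by (rule bij_imp_permutes) (simp add: p_def)
  moreover have "t (p j) \<le> t (p i)" if "i \<le> j" "j < n" for i j
  proof -
    have "sorted (map (\<lambda>i. - t i) ?l)" by simp
    then have "map (\<lambda>i. - t i) ?l ! i \<le> map (\<lambda>i. - t i) ?l ! j"
      using sorted_nth_mono that len by (metis length_map)
    then show ?thesis using that len by (simp add: p_def)
  qed
  ultimately show thesis using that by blast
qed

lemma same_sum_support:
  assumes "same_sum n c c'"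
  shows "card (support n c) = card (support n c')" "snd c ` support n c = snd c' ` support n c'"
proof -
  obtain p where p: "p permutes {..<n}"
    and pc: "\<forall>i<n. fst c' i = fst c (p i) \<and> (fst c' i \<noteq> 0 \<longrightarrow> snd c' i = snd c (p i))"
    using same_sum_permD[OF assms] by (elim exE conjE) (rule that)
  have lt: "p i < n \<longleftrightarrow> i < n" for i
    using permutes_in_image[OF p, of i] by simp
  have sup: "p i \<in> support n c \<longleftrightarrow> i \<in> support n c'" for i
  proof (cases "i < n")
    case True
    then have "fst c' i = fst c (p i)" using pc by blast
    then show ?thesis by (simp only: support_def mem_Collect_eq lt)
  next
    case False
    then show ?thesis by (simp only: support_def mem_Collect_eq lt simp_thms)
  qed
  have im: "support n c = p ` support n c'"
  proof (rule Set.set_eqI)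
    fix i
    have "p (inv_into UNIV p i) = i" using p by (simp add: permutes_inverses)
    then show "i \<in> support n c \<longleftrightarrow> i \<in> p ` support n c'"
      using sup[of "inv_into UNIV p i"] sup by (metis imageE imageI)
  qed
  show "card (support n c) = card (support n c')"
    unfolding im by (rule card_image[OF permutes_inj_on[OF p]])
  have "snd c (p i) = snd c' i" if "i \<in> support n c'" for i
    using pc that by (simp only: support_def mem_Collect_eq) metis
  then show "snd c ` support n c = snd c' ` support n c'"
    unfolding im image_image by (rule image_cong[OF refl])
qed

lemma same_sum_low: "same_sum n c c' \<Longrightarrow> low n r m c \<longleftrightarrow> low n r m c'"
  unfolding low_def using same_sum_support[of n c c'] by simp

lemma stage_rel_refl: "stage_rel n r m c c"
  by (simp add: stage_rel_def same_sum_refl)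

lemma stage_rel_sym: "stage_rel n r m c c' \<Longrightarrow> stage_rel n r m c' c"
  unfolding stage_rel_def using same_sum_sym same_measure_sym by blast

lemma stage_rel_trans: "stage_rel n r m c c' \<Longrightarrow> stage_rel n r m c' c'' \<Longrightarrow> stage_rel n r m c c''"
  unfolding stage_rel_def
  using same_sum_trans[of n c c' c''] same_measure_trans[of n c c' c''] same_sum_imp_same_measure[of n c c']
    same_sum_imp_same_measure[of n c' c''] same_sum_low[of n c c' r m] same_sum_low[of n c' c'' r m] by blast

lemma stage_rel_imp_same_measure: "stage_rel n r m c c' \<Longrightarrow> same_measure n c c'"
  unfolding stage_rel_def using same_sum_imp_same_measure by blast

text \<open>Nonnegative weights cannot cancel, so the occupied positions are the atoms of the
  measure.\<close>

lemma same_measure_positions: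
  assumes "same_measure n c c'" and "\<And>i. 0 \<le> fst c i" and "\<And>i. 0 \<le> fst c' i"
  shows "snd c ` support n c = snd c' ` support n c'"
proof -
  have "y \<in> snd d ` support n d \<longleftrightarrow> wsum n d (\<lambda>a z. a * (if z = y then 1 else 0)) \<noteq> 0"
    if "\<And>i. 0 \<le> fst d i" for d y
    unfolding wsum_def using that by (subst sum_nonneg_eq_0_iff) (auto simp: support_def)
  note pos = this
  have "y \<in> snd c ` support n c \<longleftrightarrow> y \<in> snd c' ` support n c'" for y
    unfolding pos[OF assms(2)] pos[OF assms(3)] using assms(1)[unfolded same_measure_def] by simp
  then show ?thesis by blast
qed

lemma wsum_distinct_positions:
  assumes "inj_on (snd c) (support n c)" and "\<And>y. \<Psi> 0 y = 0"
  shows "wsum n c \<Psi> = (\<Sum>y\<in>snd c ` support n c. \<Psi> (wsum n c (\<lambda>a z. a * (if z = y then 1 else 0))) y)"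
proof -
  have s: "wsum n c \<Phi> = (\<Sum>i\<in>support n c. \<Phi> (fst c i) (snd c i))" if "\<And>y. \<Phi> 0 y = 0" for \<Phi>
    unfolding wsum_def support_def using that by (intro sum.mono_neutral_right) auto
  have "wsum n c (\<lambda>a z. a * (if z = snd c i then 1 else 0)) = fst c i" if i: "i \<in> support n c" for i
  proof -
    have "wsum n c (\<lambda>a z. a * (if z = snd c i then 1 else 0)) = (\<Sum>j\<in>support n c. if j = i then fst c i else 0)"
      unfolding s[of "\<lambda>a z. a * (if z = snd c i then 1 else 0)", simplified]
      using i assms(1) by (intro sum.cong) (auto simp: inj_on_def)
    then show ?thesis using i by simp
  qed
  then show ?thesis
    unfolding sum.reindex[OF assms(1)] s[of \<Psi>, OF assms(2)] by simp
qed

text \<open>The cardinalities force distinct positions on both supports; each weight is then the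
  mass of its atom.\<close>

lemma same_measure_distinct_positions:
  assumes f: "same_measure n c c'" and nn: "\<And>i. 0 \<le> fst c i" "\<And>i. 0 \<le> fst c' i"
    and r: "card (support n c) \<le> card (snd c ` support n c)" "card (support n c') \<le> card (snd c ` support n c)"
  shows "same_sum n c c'"
proof -
  have P: "snd c ` support n c = snd c' ` support n c'" by (rule same_measure_positions[OF f nn])
  have i: "inj_on (snd c) (support n c)" "inj_on (snd c') (support n c')"
    using r P card_image_le[of "support n c" "snd c"] card_image_le[of "support n c'" "snd c'"]
    by (simp_all add: eq_card_imp_inj_on le_antisym)
  show ?thesis
    unfolding same_sum_def
  proof (intro allI impI)
    fix \<Psi> :: "real \<Rightarrow> (nat \<Rightarrow> real) \<Rightarrow> real" assume z: "\<forall>y. \<Psi> 0 y = 0"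
    show "wsum n c \<Psi> = wsum n c' \<Psi>"
      using wsum_distinct_positions[OF i(1), of \<Psi>, OF z[rule_format]]
        wsum_distinct_positions[OF i(2), of \<Psi>, OF z[rule_format]] P f[unfolded same_measure_def] by simp
  qed
qed

text \<open>A measure with \<open>r\<close> atoms comes from only one formal sum with at most
  \<open>r\<close> positive weights, so collapsing the sums with \<open>r\<close> weights at
  \<open>r\<close> positions identifies nothing new. Here one row of stages is attached to the
  next.\<close>

lemma stage_rel_Suc_zero:
  assumes "r \<ge> 1" and nn: "\<And>i. 0 \<le> fst c i" "\<And>i. 0 \<le> fst c' i"
  shows "stage_rel n r (r - 1) c c' \<longleftrightarrow> stage_rel n (Suc r) 0 c c'"
proof -
  have l: "low n (Suc r) 0 d \<longleftrightarrow> card (support n d) \<le> r" for d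
    by (auto simp: low_def)
  have l2: "low n r (r - 1) d \<longleftrightarrow> card (support n d) \<le> r \<and> \<not> (card (support n d) = r \<and> card (snd d ` support n d) = r)" for d
    using assms(1) card_image_le[OF finite_support, of "snd d" n d] unfolding low_def by linarith
  show ?thesis
  proof
    assume "stage_rel n r (r - 1) c c'"
    then show "stage_rel n (Suc r) 0 c c'" unfolding stage_rel_def l l2[of c] l2[of c'] by blast
  next
    assume a: "stage_rel n (Suc r) 0 c c'"
    show "stage_rel n r (r - 1) c c'"
    proof (cases "low n r (r - 1) c \<and> low n r (r - 1) c'")
      case True
      then show ?thesis using stage_rel_imp_same_measure[OF a] by (simp add: stage_rel_def)
    next
      case False
      have "same_sum n c c'"
      proof (rule ccontr)
        assume ns: "\<not> same_sum n c c'"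
        then have m: "same_measure n c c'" and r: "card (support n c) \<le> r" "card (support n c') \<le> r"
          using a by (auto simp: stage_rel_def l)
        have "card (snd c ` support n c) = r"
          using False r same_measure_positions[OF m nn] unfolding l2[of c] l2[of c'] by metis
        then show False using same_measure_distinct_positions[OF m nn] r ns by simp
      qed
      then show ?thesis by (simp add: stage_rel_def)
    qed
  qed
qed

text \<open>Weights of total 1 do not all vanish, so nothing is low at stage
  \<open>(1, 0)\<close>.\<close>

lemma stage_rel_first:
  assumes "wsum n c (\<lambda>a y. a) = 1" "wsum n c' (\<lambda>a y. a) = 1"
  shows "stage_rel n 1 0 c c' \<longleftrightarrow> same_sum n c c'"
proof -
  have "\<not> low n 1 0 d" if "wsum n d (\<lambda>a y. a) = 1" for d
  proof
    assume "low n 1 0 d"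
    then have "support n d = {}" by (auto simp: low_def)
    then have "wsum n d (\<lambda>a y. a) = 0" by (auto simp: wsum_def support_def intro!: sum.neutral)
    then show False using that by simp
  qed
  then show ?thesis using assms by (auto simp: stage_rel_def)
qed

section \<open>Deformations of weights and positions\<close>

definition equiv_below :: "nat \<Rightarrow> (nat \<Rightarrow> nat \<Rightarrow> bool) \<Rightarrow> bool" where
  "equiv_below r R \<longleftrightarrow> (\<forall>i<r. R i i) \<and> (\<forall>i<r. \<forall>j<r. R i j \<longrightarrow> R j i) \<and>
     (\<forall>i<r. \<forall>j<r. \<forall>l<r. R i j \<longrightarrow> R j l \<longrightarrow> R i l)"

definition cls :: "nat \<Rightarrow> (nat \<Rightarrow> nat \<Rightarrow> bool) \<Rightarrow> nat \<Rightarrow> nat set" where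
  "cls r R i = {j. j < r \<and> R i j}"

text \<open>For antitone \<open>t\<close>: in each class of \<open>R\<close>, the fraction \<open>\<sigma>\<close> of the weight of the last (lightest) index is
moved to the first (heaviest) one. This choice is insensitive to reorderings of equal weights, up to
permutation, and at \<open>\<sigma> = 1\<close> a class with several elements has lost one of them.\<close>

definition transfer :: "nat \<Rightarrow> (nat \<Rightarrow> nat \<Rightarrow> bool) \<Rightarrow> real \<Rightarrow> (nat \<Rightarrow> real) \<Rightarrow> nat \<Rightarrow> real" where
  "transfer r R \<sigma> t i = (if i < r then t i + \<sigma> * ((if \<forall>j<i. \<not> R j i then t (Max (cls r R i)) else 0)
      - (if \<forall>j. i < j \<and> j < r \<longrightarrow> \<not> R i j then t i else 0)) else t i)"

lemma finite_cls [simp]: "finite (cls r R i)"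
  by (simp add: cls_def)

lemma cls_self: "equiv_below r R \<Longrightarrow> i < r \<Longrightarrow> i \<in> cls r R i"
  by (simp add: cls_def equiv_below_def)

lemma cls_eq: "equiv_below r R \<Longrightarrow> i < r \<Longrightarrow> j \<in> cls r R i \<Longrightarrow> cls r R j = cls r R i"
  unfolding cls_def equiv_below_def by (intro Collect_cong) blast

text \<open>Each summand occurs once for every member of its class and is divided by their number.
  Identities can thus be checked class by class without choosing representatives.\<close>

lemma sum_class_average:
  fixes F :: "nat \<Rightarrow> real"
  assumes R: "equiv_below r R"
  shows "(\<Sum>i<r. F i) = (\<Sum>i<r. (\<Sum>j\<in>cls r R i. F j) / card (cls r R i))"
proof -
  have "(\<Sum>i<r. (\<Sum>j\<in>cls r R i. F j) / card (cls r R i)) = (\<Sum>i<r. \<Sum>j | j \<in> {..<r} \<and> R i j. F j / card (cls r R i))"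
    by (simp add: sum_divide_distrib cls_def)
  also have "\<dots> = (\<Sum>j<r. \<Sum>i | i \<in> {..<r} \<and> R i j. F j / card (cls r R i))"
    by (rule sum.swap_restrict) auto
  also have "\<dots> = (\<Sum>j<r. F j)"
  proof (rule sum.cong[OF refl])
    fix j assume j: "j \<in> {..<r}"
    have e: "{i. i \<in> {..<r} \<and> R i j} = cls r R j"
      using R j unfolding equiv_below_def cls_def by (intro Collect_cong) auto
    have "(\<Sum>i\<in>cls r R j. F j / card (cls r R i)) = (\<Sum>i\<in>cls r R j. F j / card (cls r R j))"
      using cls_eq[OF R, of j] j by (intro sum.cong) auto
    also have "\<dots> = F j"
      using cls_self[OF R, of j] j by (auto simp: card_gt_0_iff)
    finally show "(\<Sum>i | i \<in> {..<r} \<and> R i j. F j / card (cls r R i)) = F j" unfolding e .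
  qed
  finally show ?thesis by simp
qed

text \<open>As \<open>t\<close> is antitone, the first index of a class has its largest weight
  \<open>A\<close> and the last its smallest weight \<open>B\<close>. The right-hand side no longer
  refers to the order of the indices in the class.\<close>

lemma transfer_class_sum:
  fixes \<Psi> :: "real \<Rightarrow> 'a \<Rightarrow> real"
  assumes R: "equiv_below r R" and i: "i < r"
    and t: "\<And>i j. i \<le> j \<Longrightarrow> j < r \<Longrightarrow> t j \<le> t i"
    and y: "\<And>j. j \<in> cls r R i \<Longrightarrow> y j = y i"
  defines "A \<equiv> Max (t ` cls r R i)" and "B \<equiv> Min (t ` cls r R i)"
  shows "(\<Sum>j\<in>cls r R i. \<Psi> (transfer r R \<sigma> t j) (y j)) = (\<Sum>j\<in>cls r R i. \<Psi> (t j) (y j)) +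
    (if card (cls r R i) = 1 then 0
     else \<Psi> (A + \<sigma> * B) (y i) - \<Psi> A (y i) + \<Psi> (B - \<sigma> * B) (y i) - \<Psi> B (y i))"
proof -
  define C where "C = cls r R i"
  have C: "finite C" "C \<noteq> {}" and Cr: "\<And>j. j \<in> C \<Longrightarrow> j < r"
    using cls_self[OF R i] by (auto simp: C_def cls_def)
  define a b where "a = Min C" and "b = Max C"
  have ab: "a \<in> C" "b \<in> C" "\<And>j. j \<in> C \<Longrightarrow> a \<le> j" "\<And>j. j \<in> C \<Longrightarrow> j \<le> b"
    using C by (auto simp: a_def b_def)
  have cj: "cls r R j = C" if "j \<in> C" for j
    using cls_eq[OF R i, of j] that by (simp add: C_def)
  have sym: "R j l \<longleftrightarrow> R l j" if "j < r" "l < r" for j l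
    using R that unfolding equiv_below_def by blast
  have first: "(\<forall>l<j. \<not> R l j) \<longleftrightarrow> j = a" if j: "j \<in> C" for j
  proof
    assume *: "\<forall>l<j. \<not> R l j"
    have "R j a" using ab(1) cj[OF j] by (auto simp: cls_def)
    then have "R a j" using sym Cr ab(1) j by blast
    then show "j = a" using * ab(3)[OF j] by (metis le_neq_implies_less)
  next
    assume ja: "j = a"
    show "\<forall>l<j. \<not> R l j"
    proof (intro allI impI notI)
      fix l assume l: "l < j" "R l j"
      then have "l \<in> cls r R j" using sym[of l j] Cr[OF j] by (simp add: cls_def)
      then show False using ab(3)[of l] l ja cj[OF j] by simp
    qed
  qed
  have last: "(\<forall>l. j < l \<and> l < r \<longrightarrow> \<not> R j l) \<longleftrightarrow> j = b" if j: "j \<in> C" for j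
  proof
    assume *: "\<forall>l. j < l \<and> l < r \<longrightarrow> \<not> R j l"
    have "R j b" using ab(2) cj[OF j] by (auto simp: cls_def)
    then show "j = b" using * ab(4)[OF j] Cr[OF ab(2)] by (metis le_neq_implies_less)
  next
    assume jb: "j = b"
    show "\<forall>l. j < l \<and> l < r \<longrightarrow> \<not> R j l"
    proof (intro allI impI notI)
      fix l assume l: "j < l \<and> l < r" "R j l"
      then have "l \<in> cls r R j" by (simp add: cls_def)
      then show False using ab(4)[of l] l jb cj[OF j] by simp
    qed
  qed
  have tr: "transfer r R \<sigma> t j = t j + \<sigma> * ((if j = a then t b else 0) - (if j = b then t j else 0))"
    if j: "j \<in> C" for j
    unfolding transfer_def first[OF j] last[OF j] cj[OF j] using Cr[OF j] by (simp add: b_def)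
  have A: "A = t a"
    unfolding A_def C_def[symmetric] using C ab t Cr by (intro Max_eqI) auto
  have B: "B = t b"
    unfolding B_def C_def[symmetric] using C ab t Cr by (intro Min_eqI) auto
  have yC: "\<And>j. j \<in> C \<Longrightarrow> y j = y i" using y by (simp add: C_def)
  show ?thesis
  proof (cases "card C = 1")
    \<comment> \<open>A singleton class gives to itself, and the two corrections cancel.\<close>
    case True
    then obtain z where z: "C = {z}" by (auto simp: card_1_singleton_iff)
    then have "a = z" "b = z" using ab by auto
    then show ?thesis unfolding C_def[symmetric] z using tr[of z] z True by simp
  next
    case False
    have "a \<noteq> b"
    proof
      assume "a = b"
      then have "C = {a}" using ab by force
      then show False using False by simp
    qed
    have "(\<Sum>j\<in>C. \<Psi> (transfer r R \<sigma> t j) (y j)) =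
        (\<Sum>j\<in>C. \<Psi> (t j) (y j) + (if j = a then \<Psi> (A + \<sigma> * B) (y i) - \<Psi> A (y i) else 0)
           + (if j = b then \<Psi> (B - \<sigma> * B) (y i) - \<Psi> B (y i) else 0))"
      using \<open>a \<noteq> b\<close> by (intro sum.cong) (auto simp: tr yC A B)
    also have "\<dots> = (\<Sum>j\<in>C. \<Psi> (t j) (y j)) + (\<Psi> (A + \<sigma> * B) (y i) - \<Psi> A (y i))
           + (\<Psi> (B - \<sigma> * B) (y i) - \<Psi> B (y i))"
      using C ab by (simp add: sum.distrib)
    finally show ?thesis unfolding C_def[symmetric] using False by simp
  qed
qed

text \<open>For a function linear in the weight, the correction term of
  \<open>transfer_class_sum\<close> cancels.\<close>

lemma transfer_linear_sum:
  assumes R: "equiv_below r R" and t: "\<And>i j. i \<le> j \<Longrightarrow> j < r \<Longrightarrow> t j \<le> t i"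
    and y: "\<And>i j. i < r \<Longrightarrow> j < r \<Longrightarrow> R i j \<Longrightarrow> y j = y i"
  shows "(\<Sum>i<r. transfer r R \<sigma> t i * \<phi> (y i)) = (\<Sum>i<r. t i * \<phi> (y i))"
proof -
  have "(\<Sum>j\<in>cls r R i. transfer r R \<sigma> t j * \<phi> (y j)) = (\<Sum>j\<in>cls r R i. t j * \<phi> (y j))" if i: "i < r" for i
    using transfer_class_sum[OF R i, of t y "\<lambda>a z. a * \<phi> z" \<sigma>] t y i
    by (simp add: cls_def algebra_simps)
  then have "(\<Sum>i<r. (\<Sum>j\<in>cls r R i. transfer r R \<sigma> t j * \<phi> (y j)) / card (cls r R i)) =
      (\<Sum>i<r. (\<Sum>j\<in>cls r R i. t j * \<phi> (y j)) / card (cls r R i))"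
    by (intro sum.cong) auto
  then show ?thesis
    using sum_class_average[OF R, of "\<lambda>i. transfer r R \<sigma> t i * \<phi> (y i)"]
      sum_class_average[OF R, of "\<lambda>i. t i * \<phi> (y i)"] by simp
qed

text \<open>Within a class \<open>p\<close> need not preserve the order of the indices, so giver and
  receiver may change; by \<open>transfer_class_sum\<close> only the largest and the smallest weight
  of the class matter.\<close>

lemma transfer_reindex_sum:
  fixes \<Psi> :: "real \<Rightarrow> 'a \<Rightarrow> real"
  assumes R: "equiv_below r R" and R': "equiv_below r R'"
    and p: "bij_betw p {..<r} {..<r}"
    and t: "\<And>i j. i \<le> j \<Longrightarrow> j < r \<Longrightarrow> t j \<le> t i" and tp: "\<And>i. i < r \<Longrightarrow> t (p i) = t i"
    and Rp: "\<And>i j. i < r \<Longrightarrow> j < r \<Longrightarrow> R' i j \<longleftrightarrow> R (p i) (p j)"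
    and y: "\<And>i j. i < r \<Longrightarrow> j < r \<Longrightarrow> R i j \<Longrightarrow> y j = y i"
    and y': "\<And>i. i < r \<Longrightarrow> y' i = y (p i)"
  shows "(\<Sum>i<r. \<Psi> (transfer r R' \<sigma> t i) (y' i)) = (\<Sum>i<r. \<Psi> (transfer r R \<sigma> t i) (y i))"
proof -
  have pr: "p i < r" if "i < r" for i using p that by (auto simp: bij_betw_def)
  have inj: "inj_on p {..<r}" using p by (simp add: bij_betw_def)
  have pc: "cls r R (p i) = p ` cls r R' i" if i: "i < r" for i
  proof (rule Set.set_eqI)
    fix j
    show "j \<in> cls r R (p i) \<longleftrightarrow> j \<in> p ` cls r R' i"
    proof
      assume j: "j \<in> cls r R (p i)"
      then have "j \<in> p ` {..<r}" using p by (simp add: bij_betw_def cls_def)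
      then obtain l where l: "l < r" "j = p l" by auto
      then show "j \<in> p ` cls r R' i" using j Rp[OF i l(1)] by (auto simp: cls_def)
    next
      assume "j \<in> p ` cls r R' i"
      then show "j \<in> cls r R (p i)" using Rp[OF i] pr by (auto simp: cls_def)
    qed
  qed
  have ic: "inj_on p (cls r R' i)" for i
    by (rule inj_on_subset[OF inj]) (auto simp: cls_def)
  have tc: "t ` cls r R (p i) = t ` cls r R' i" if i: "i < r" for i
    unfolding pc[OF i] image_image using tp by (intro image_cong) (auto simp: cls_def)
  have y'c: "\<And>i j. i < r \<Longrightarrow> j < r \<Longrightarrow> R' i j \<Longrightarrow> y' j = y' i"
    using y y' Rp pr by simp
  have G: "(\<Sum>j\<in>cls r R' i. \<Psi> (transfer r R' \<sigma> t j) (y' j)) / card (cls r R' i) =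
    (\<Sum>j\<in>cls r R (p i). \<Psi> (transfer r R \<sigma> t j) (y j)) / card (cls r R (p i))" if i: "i < r" for i
  proof -
    have cc: "card (cls r R (p i)) = card (cls r R' i)"
      unfolding pc[OF i] by (rule card_image[OF ic])
    have "(\<Sum>j\<in>cls r R (p i). \<Psi> (t j) (y j)) = (\<Sum>j\<in>cls r R' i. \<Psi> (t (p j)) (y (p j)))"
      unfolding pc[OF i] by (simp add: sum.reindex[OF ic])
    also have "\<dots> = (\<Sum>j\<in>cls r R' i. \<Psi> (t j) (y' j))"
      using tp y' by (intro sum.cong) (auto simp: cls_def)
    finally have s: "(\<Sum>j\<in>cls r R (p i). \<Psi> (t j) (y j)) = (\<Sum>j\<in>cls r R' i. \<Psi> (t j) (y' j))" .
    have yi: "y (p i) = y' i" using y'[OF i] by simp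
    have 1: "\<And>j. j \<in> cls r R' i \<Longrightarrow> y' j = y' i" using y'c[OF i] by (simp add: cls_def)
    have 2: "\<And>j. j \<in> cls r R (p i) \<Longrightarrow> y j = y (p i)" using y[OF pr[OF i]] by (simp add: cls_def)
    show ?thesis
      using transfer_class_sum[OF R' i, where t = t and y = y' and \<Psi> = \<Psi> and \<sigma> = \<sigma>, OF t 1]
        transfer_class_sum[OF R pr[OF i], where t = t and y = y and \<Psi> = \<Psi> and \<sigma> = \<sigma>, OF t 2]
      unfolding s yi cc tc[OF i] by simp
  qed
  have "(\<Sum>i<r. \<Psi> (transfer r R' \<sigma> t i) (y' i)) =
     (\<Sum>i<r. (\<Sum>j\<in>cls r R (p i). \<Psi> (transfer r R \<sigma> t j) (y j)) / card (cls r R (p i)))"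
    unfolding sum_class_average[OF R', of "\<lambda>i. \<Psi> (transfer r R' \<sigma> t i) (y' i)"]
    by (rule sum.cong[OF refl]) (simp only: lessThan_iff G)
  also have "\<dots> = (\<Sum>i<r. (\<Sum>j\<in>cls r R i. \<Psi> (transfer r R \<sigma> t j) (y j)) / card (cls r R i))"
    by (rule sum.reindex_bij_betw[OF p])
  finally show ?thesis using sum_class_average[OF R, of "\<lambda>i. \<Psi> (transfer r R \<sigma> t i) (y i)"] by simp
qed

lemma transfer_zero [simp]: "transfer r R 0 t = t"
  by (auto simp: transfer_def)

lemma transfer_nonneg:
  assumes "\<And>i. 0 \<le> t i" "0 \<le> \<sigma>" "\<sigma> \<le> 1"
  shows "0 \<le> transfer r R \<sigma> t i"
proof -
  have "0 \<le> \<sigma> * t (Max (cls r R i))" "0 \<le> t i - \<sigma> * t i" "0 \<le> t i"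
    using assms mult_left_le_one_le[of "t i" \<sigma>] by auto
  then show ?thesis unfolding transfer_def by (auto simp: algebra_simps)
qed

text \<open>The last index in the class of \<open>i\<close> gives all its weight away and, being
  preceded by \<open>i\<close>, receives nothing.\<close>

lemma transfer_support_less:
  assumes R: "equiv_below r R" and ij: "i < j" "j < r" "R i j" and z: "\<And>i. r \<le> i \<Longrightarrow> t i = 0"
    and n: "r \<le> n"
  shows "card (support n (transfer r R 1 t, x)) < r"
proof -
  define b where "b = Max (cls r R i)"
  have jc: "j \<in> cls r R i" using ij by (simp add: cls_def)
  then have bi: "b \<in> cls r R i" and jb: "j \<le> b"
    unfolding b_def by (intro Max_in Max_ge; auto)+
  have b: "b < r" "R i b" using bi by (auto simp: cls_def)
  have "\<not> R b l" if "b < l" "l < r" for l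
  proof
    assume l: "R b l"
    have "i < r" using ij by simp
    with l have "R i l" using R b that unfolding equiv_below_def by blast
    then have "l \<in> cls r R i" using that by (simp add: cls_def)
    then have "l \<le> b" unfolding b_def by simp
    then show False using that by simp
  qed
  moreover have "\<not> (\<forall>l<b. \<not> R l b)" using b(2) less_le_trans[OF ij(1) jb] by blast
  ultimately have tb: "transfer r R 1 t b = 0" using b(1) unfolding transfer_def by auto
  then have "support n (transfer r R 1 t, x) \<subseteq> {..<r} - {b}"
    using z by (auto simp: support_def tb) (metis not_less transfer_def)
  then have "card (support n (transfer r R 1 t, x)) \<le> card ({..<r} - {b})"
    by (intro card_mono) auto
  also have "\<dots> < r" using b by (simp add: card_Diff_singleton_if)
  finally show ?thesis .
qed

section \<open>Squared distances and normalized sums on the sphere\<close>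

definition sqd :: "nat \<Rightarrow> (nat \<Rightarrow> real) \<Rightarrow> (nat \<Rightarrow> real) \<Rightarrow> real" where
  "sqd k x y = (\<Sum>j\<le>k. (x j - y j)\<^sup>2)"

definition radial :: "nat \<Rightarrow> (nat \<Rightarrow> real) \<Rightarrow> nat \<Rightarrow> real" where
  "radial k v = (\<lambda>j. v j / sqrt (\<Sum>l\<le>k. (v l)\<^sup>2))"

lemma sphere_set_iff: "x \<in> sphere_set k \<longleftrightarrow> (\<forall>i>k. x i = 0) \<and> (\<Sum>i\<le>k. (x i)\<^sup>2) = 1"
  by (auto simp: nsphere)

lemma sphere_set_nonempty: "(\<lambda>j. if j = 0 then 1 else 0) \<in> sphere_set k"
  by (rule in_topspace_nsphere)

lemma sqd_nonneg [simp]: "0 \<le> sqd k x y"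
  by (simp add: sqd_def sum_nonneg)

lemma sqd_commute: "sqd k x y = sqd k y x"
  by (simp add: sqd_def power2_commute)

lemma sqd_self [simp]: "sqd k x x = 0"
  by (simp add: sqd_def)

lemma sqd_triangle: "sqd k x z \<le> 2 * sqd k x y + 2 * sqd k y z"
proof -
  have "(x j - z j)\<^sup>2 \<le> 2 * (x j - y j)\<^sup>2 + 2 * (y j - z j)\<^sup>2" for j
    using zero_le_power2[of "(x j - y j) - (y j - z j)"] by (simp add: power2_eq_square algebra_simps)
  then show ?thesis
    unfolding sqd_def sum_distrib_left sum.distrib[symmetric] by (intro sum_mono) auto
qed

lemma sqd_eq_0_iff:
  assumes "x \<in> sphere_set k" "y \<in> sphere_set k"
  shows "sqd k x y = 0 \<longleftrightarrow> x = y"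
proof
  assume "sqd k x y = 0"
  then have "\<forall>j\<le>k. x j = y j" by (simp add: sqd_def sum_nonneg_eq_0_iff)
  then show "x = y" using assms by (auto simp: sphere_set_iff fun_eq_iff) (metis not_less)
qed simp

lemma sqd_inner:
  assumes "x \<in> sphere_set k" "y \<in> sphere_set k"
  shows "(\<Sum>j\<le>k. x j * y j) = 1 - sqd k x y / 2"
proof -
  have "sqd k x y = (\<Sum>j\<le>k. (x j)\<^sup>2) + (\<Sum>j\<le>k. (y j)\<^sup>2) - 2 * (\<Sum>j\<le>k. x j * y j)"
    unfolding sqd_def by (simp add: power2_eq_square algebra_simps sum.distrib sum_subtractf sum_distrib_left)
  then show ?thesis using assms by (simp add: sphere_set_iff field_simps)
qed

lemma radial_in_sphere:
  assumes "\<And>j. j > k \<Longrightarrow> v j = 0" and "(\<Sum>l\<le>k. (v l)\<^sup>2) > 0"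
  shows "radial k v \<in> sphere_set k"
proof -
  have "(\<Sum>i\<le>k. (v i)\<^sup>2 / (\<Sum>l\<le>k. (v l)\<^sup>2)) = 1"
    using assms(2) by (simp add: sum_divide_distrib[symmetric])
  then show ?thesis
    using assms by (simp add: sphere_set_iff radial_def power_divide sum_nonneg)
qed

lemma radial_scale:
  assumes "x \<in> sphere_set k" "0 < a"
  shows "radial k (\<lambda>l. a * x l) = x"
proof -
  have "(\<Sum>l\<le>k. (a * x l)\<^sup>2) = a\<^sup>2"
    using assms by (simp add: sphere_set_iff power_mult_distrib sum_distrib_left[symmetric])
  then show ?thesis using assms by (simp add: radial_def)
qed

text \<open>Small spherical caps are closed under normalized nonnegative combinations: the inner
  product of \<open>z\<close> with the center \<open>y\<close> is at least
  \<open>1 - \<eta> / 2\<close> times the total coefficient, and the total coefficient bounds the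
  norm of \<open>z\<close> from above.\<close>

lemma radial_sum_close:
  fixes x :: "nat \<Rightarrow> nat \<Rightarrow> real"
  assumes x: "\<And>j. j < r \<Longrightarrow> x j \<in> sphere_set k" and y: "y \<in> sphere_set k"
    and c: "\<And>j. j < r \<Longrightarrow> 0 \<le> c j" "(\<Sum>j<r. c j) > 0"
    and close: "\<And>j. j < r \<Longrightarrow> c j \<noteq> 0 \<Longrightarrow> sqd k y (x j) \<le> \<eta>" and \<eta>: "\<eta> \<le> 1"
  defines "z \<equiv> \<lambda>l. \<Sum>j<r. c j * x j l"
  shows "(\<Sum>l\<le>k. (z l)\<^sup>2) > 0" "radial k z \<in> sphere_set k" "sqd k (radial k z) y \<le> \<eta>"
proof -
  let ?s = "\<Sum>j<r. c j" and ?N = "sqrt (\<Sum>l\<le>k. (z l)\<^sup>2)"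
  have inner: "(\<Sum>l\<le>k. z l * w l) = (\<Sum>j<r. c j * (\<Sum>l\<le>k. x j l * w l))" for w
  proof -
    have "(\<Sum>l\<le>k. z l * w l) = (\<Sum>l\<le>k. \<Sum>j<r. c j * (x j l * w l))"
      by (simp add: z_def sum_distrib_right mult.assoc)
    also have "\<dots> = (\<Sum>j<r. \<Sum>l\<le>k. c j * (x j l * w l))" by (rule sum.swap)
    finally show ?thesis by (simp add: sum_distrib_left)
  qed
  have termwise: "c j * (1 - \<eta> / 2) \<le> c j * (\<Sum>l\<le>k. x j l * y l)" if j: "j < r" for j
  proof (cases "c j = 0")
    case False
    then have "1 - \<eta> / 2 \<le> (\<Sum>l\<le>k. x j l * y l)"
      using close[OF j False] sqd_inner[OF x[OF j] y] sqd_commute[of k y "x j"] by simp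
    then show ?thesis using c(1)[OF j] by (rule mult_left_mono)
  qed simp
  have lower: "?s * (1 - \<eta> / 2) \<le> (\<Sum>l\<le>k. z l * y l)"
    unfolding inner sum_distrib_right using termwise by (intro sum_mono) auto
  have "0 < ?s * (1 - \<eta> / 2)" using c(2) \<eta> by simp
  with lower have zy: "0 < (\<Sum>l\<le>k. z l * y l)" by linarith
  have "\<not> (\<forall>l\<in>{..k}. z l = 0)"
  proof
    assume "\<forall>l\<in>{..k}. z l = 0"
    then have "(\<Sum>l\<le>k. z l * y l) = 0" by (intro sum.neutral) auto
    with zy show False by simp
  qed
  then show pos: "(\<Sum>l\<le>k. (z l)\<^sup>2) > 0"
    by (auto simp: less_le sum_nonneg sum_nonneg_eq_0_iff)
  then have N: "?N > 0" by simp
  have "z j = 0" if "j > k" for j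
    unfolding z_def using x that by (intro sum.neutral) (auto simp: sphere_set_iff)
  then show sph: "radial k z \<in> sphere_set k" using pos by (rule radial_in_sphere)
  have "?N = (\<Sum>l\<le>k. z l * radial k z l)"
  proof -
    have "(\<Sum>l\<le>k. z l * radial k z l) = (\<Sum>l\<le>k. (z l)\<^sup>2) / ?N"
      by (simp add: radial_def sum_divide_distrib power2_eq_square)
    also have "\<dots> = ?N" using pos by (simp add: real_div_sqrt)
    finally show ?thesis ..
  qed
  also have "\<dots> \<le> (\<Sum>j<r. c j * 1)"
    unfolding inner
  proof (intro sum_mono mult_left_mono)
    fix j assume "j \<in> {..<r}"
    then show "(\<Sum>l\<le>k. x j l * radial k z l) \<le> 1" using sqd_inner[OF x sph] by simp
  qed (use c in auto)
  finally have Ns: "?N \<le> ?s" by simp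
  have "(1 - \<eta> / 2) * ?N \<le> (1 - \<eta> / 2) * ?s" using Ns \<eta> by (intro mult_left_mono) auto
  also have "\<dots> \<le> (\<Sum>l\<le>k. z l * y l)" using lower by (simp add: mult.commute)
  also have "\<dots> = (\<Sum>l\<le>k. radial k z l * y l) * ?N"
    using N by (simp add: radial_def sum_distrib_right)
  finally have "1 - \<eta> / 2 \<le> (\<Sum>l\<le>k. radial k z l * y l)" using N by simp
  then show "sqd k (radial k z) y \<le> \<eta>" using sqd_inner[OF sph y] by simp
qed

text \<open>The constants make \<open>kern\<close> the indicator function of \<open>near\<close>, and \<open>near\<close> an equivalence relation, as soon
as \<open>gap < 1\<close>, which keeps the squared distances away from \<open>[\<epsilon>/16, 7\<epsilon>/16]\<close>.\<close>

definition near :: "nat \<Rightarrow> real \<Rightarrow> (nat \<Rightarrow> nat \<Rightarrow> real) \<Rightarrow> nat \<Rightarrow> nat \<Rightarrow> bool" where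
  "near k \<epsilon> x i j \<longleftrightarrow> sqd k (x i) (x j) < \<epsilon> / 4"

definition kern :: "nat \<Rightarrow> real \<Rightarrow> (nat \<Rightarrow> nat \<Rightarrow> real) \<Rightarrow> nat \<Rightarrow> nat \<Rightarrow> real" where
  "kern k \<epsilon> x i j = max 0 (min 1 (2 - 5 * sqd k (x i) (x j) / \<epsilon>))"

definition gap :: "nat \<Rightarrow> nat \<Rightarrow> real \<Rightarrow> (nat \<Rightarrow> nat \<Rightarrow> real) \<Rightarrow> real" where
  "gap r k \<epsilon> x = 16 / \<epsilon> * (\<Sum>i<r. \<Sum>j<r. min (sqd k (x i) (x j)) (max 0 (\<epsilon> / 2 - sqd k (x i) (x j))))"

definition gather :: "nat \<Rightarrow> nat \<Rightarrow> real \<Rightarrow> real \<Rightarrow> (nat \<Rightarrow> nat \<Rightarrow> real) \<Rightarrow> nat \<Rightarrow> nat \<Rightarrow> real" where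
  "gather r k \<epsilon> \<sigma> x i = (if i < r \<and> 0 < \<epsilon>
     then radial k (\<lambda>l. \<Sum>j<r. ((if j = i then 1 - \<sigma> else 0) + \<sigma> * kern k \<epsilon> x i j) * x j l) else x i)"

lemma kern_bounds: "0 \<le> kern k \<epsilon> x i j" "kern k \<epsilon> x i j \<le> 1" "kern k \<epsilon> x i i = 1"
  by (auto simp: kern_def)

lemma kern_nonzero: "0 < \<epsilon> \<Longrightarrow> kern k \<epsilon> x i j \<noteq> 0 \<Longrightarrow> sqd k (x i) (x j) \<le> \<epsilon>"
  by (auto simp: kern_def max_def min_def field_simps split: if_splits)

text \<open>The coefficient of \<open>x i\<close> itself is 1 for every \<open>\<sigma>\<close>, and
  the other nonzero coefficients belong to points within \<open>\<epsilon>\<close>, so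
  \<open>radial_sum_close\<close> applies around \<open>x i\<close>.\<close>

lemma gather_close:
  assumes x: "\<And>j. x j \<in> sphere_set k" and \<epsilon>: "0 \<le> \<epsilon>" "\<epsilon> \<le> 1" and \<sigma>: "0 \<le> \<sigma>" "\<sigma> \<le> 1"
  shows "gather r k \<epsilon> \<sigma> x i \<in> sphere_set k" "sqd k (gather r k \<epsilon> \<sigma> x i) (x i) \<le> \<epsilon>"
    and "i < r \<Longrightarrow> 0 < \<epsilon> \<Longrightarrow>
      (\<Sum>l\<le>k. (\<Sum>j<r. ((if j = i then 1 - \<sigma> else 0) + \<sigma> * kern k \<epsilon> x i j) * x j l)\<^sup>2) > 0"
proof -
  define c where "c j = (if j = i then 1 - \<sigma> else 0) + \<sigma> * kern k \<epsilon> x i j" for j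
  have *: "(\<Sum>l\<le>k. (\<Sum>j<r. c j * x j l)\<^sup>2) > 0 \<and> radial k (\<lambda>l. \<Sum>j<r. c j * x j l) \<in> sphere_set k \<and>
     sqd k (radial k (\<lambda>l. \<Sum>j<r. c j * x j l)) (x i) \<le> \<epsilon>" if i: "i < r" and e: "0 < \<epsilon>"
  proof -
    have c0: "0 \<le> c j" for j using \<sigma> kern_bounds(1)[of k \<epsilon> x i j] by (simp add: c_def)
    have "c i = 1" using kern_bounds(3) by (simp add: c_def)
    then have c1: "(\<Sum>j<r. c j) > 0"
      using c0 i by (intro sum_pos2[of _ i]) auto
    have cl: "sqd k (x i) (x j) \<le> \<epsilon>" if "c j \<noteq> 0" for j
      using that kern_nonzero[OF e, of k x i j] \<epsilon> by (cases "j = i") (auto simp: c_def)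
    show ?thesis
      using radial_sum_close[of r x k "x i" c \<epsilon>] x c0 c1 cl \<epsilon> by blast
  qed
  show "gather r k \<epsilon> \<sigma> x i \<in> sphere_set k" "sqd k (gather r k \<epsilon> \<sigma> x i) (x i) \<le> \<epsilon>"
    using * x \<epsilon> unfolding gather_def c_def by auto
  show "i < r \<Longrightarrow> 0 < \<epsilon> \<Longrightarrow>
      (\<Sum>l\<le>k. (\<Sum>j<r. ((if j = i then 1 - \<sigma> else 0) + \<sigma> * kern k \<epsilon> x i j) * x j l)\<^sup>2) > 0"
    using * unfolding c_def by blast
qed

lemma gap_nonneg: "0 \<le> \<epsilon> \<Longrightarrow> 0 \<le> gap r k \<epsilon> x"
  unfolding gap_def by (intro mult_nonneg_nonneg sum_nonneg) auto

lemma gap_term: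
  assumes "0 < \<epsilon>" "i < r" "j < r"
  shows "16 / \<epsilon> * min (sqd k (x i) (x j)) (max 0 (\<epsilon> / 2 - sqd k (x i) (x j))) \<le> gap r k \<epsilon> x"
proof -
  let ?f = "\<lambda>i j. min (sqd k (x i) (x j)) (max 0 (\<epsilon> / 2 - sqd k (x i) (x j)))"
  have nn: "0 \<le> ?f i j" for i j by auto
  have "?f i j \<le> (\<Sum>j<r. ?f i j)"
    using assms nn by (intro member_le_sum) auto
  also have "\<dots> \<le> (\<Sum>i<r. \<Sum>j<r. ?f i j)"
    using assms nn by (intro member_le_sum[of i "{..<r}" "\<lambda>i. \<Sum>j<r. ?f i j"] sum_nonneg) auto
  finally show ?thesis unfolding gap_def using assms(1) by (intro mult_left_mono) auto
qed

text \<open>As each summand of \<open>gap\<close> is less than 1, the minimum in it is less than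
  \<open>\<epsilon> / 16\<close>; the upper bound is
  \<open>\<epsilon> / 2 - \<epsilon> / 16\<close>.\<close>

lemma gap_dichotomy:
  assumes "0 < \<epsilon>" "gap r k \<epsilon> x < 1" "i < r" "j < r"
  shows "sqd k (x i) (x j) < \<epsilon> / 16 \<or> sqd k (x i) (x j) > 7 / 16 * \<epsilon>"
proof -
  have "16 / \<epsilon> * min (sqd k (x i) (x j)) (max 0 (\<epsilon> / 2 - sqd k (x i) (x j))) < 1"
    using gap_term[OF assms(1,3,4), of k x] assms(2) by linarith
  then have "min (sqd k (x i) (x j)) (max 0 (\<epsilon> / 2 - sqd k (x i) (x j))) < \<epsilon> / 16"
    using assms(1) by (simp add: field_simps)
  then show ?thesis by (auto simp: min_def max_def split: if_splits)
qed

lemma near_iff: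
  assumes "0 < \<epsilon>" "gap r k \<epsilon> x < 1" "i < r" "j < r"
  shows "near k \<epsilon> x i j \<longleftrightarrow> sqd k (x i) (x j) < \<epsilon> / 16"
  using gap_dichotomy[OF assms] assms(1) by (auto simp: near_def)

text \<open>Near pairs have squared distance below \<open>\<epsilon> / 16\<close>, and the factor 2
  in \<open>sqd_triangle\<close> brings two of them to less than \<open>\<epsilon> / 4\<close>,
  which is near again.\<close>

lemma near_equiv:
  assumes "0 < \<epsilon>" "gap r k \<epsilon> x < 1"
  shows "equiv_below r (near k \<epsilon> x)"
  unfolding equiv_below_def
proof (intro conjI allI impI)
  show "near k \<epsilon> x i i" for i using assms by (simp add: near_def)
  show "near k \<epsilon> x j i" if "near k \<epsilon> x i j" for i j
    using that by (simp add: near_def sqd_commute)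
  show "near k \<epsilon> x i l" if "i < r" "j < r" "l < r" "near k \<epsilon> x i j" "near k \<epsilon> x j l" for i j l
    using that near_iff[OF assms, of i j] near_iff[OF assms, of j l] sqd_triangle[of k "x i" "x l" "x j"]
    by (simp add: near_def)
qed

text \<open>The kernel is 1 up to \<open>\<epsilon> / 5\<close> and 0 from
  \<open>2 * \<epsilon> / 5\<close> on, and \<open>1/16 < 1/5\<close> and
  \<open>2/5 < 7/16\<close>.\<close>

lemma kern_eq:
  assumes "0 < \<epsilon>" "gap r k \<epsilon> x < 1" "i < r" "j < r"
  shows "kern k \<epsilon> x i j = (if near k \<epsilon> x i j then 1 else 0)"
proof (cases "sqd k (x i) (x j) < \<epsilon> / 16")
  case True
  then have "5 * sqd k (x i) (x j) / \<epsilon> \<le> 1" using assms(1) by (simp add: field_simps)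
  then show ?thesis using True near_iff[OF assms] by (simp add: kern_def)
next
  case False
  then have "7 / 16 * \<epsilon> < sqd k (x i) (x j)" using gap_dichotomy[OF assms] by simp
  then have "2 \<le> 5 * sqd k (x i) (x j) / \<epsilon>" using assms(1) by (simp add: field_simps)
  then show ?thesis using False near_iff[OF assms] by (simp add: kern_def)
qed

text \<open>Members of one class have equal rows of \<open>kern\<close>, hence at
  \<open>\<sigma> = 1\<close> the same sum to normalize.\<close>

lemma gather_eq_of_near:
  assumes "0 < \<epsilon>" "gap r k \<epsilon> x < 1" "i < r" "j < r" "near k \<epsilon> x i j"
  shows "gather r k \<epsilon> 1 x j = gather r k \<epsilon> 1 x i"
proof -
  have E: "equiv_below r (near k \<epsilon> x)" by (rule near_equiv[OF assms(1,2)])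
  have "kern k \<epsilon> x j l = kern k \<epsilon> x i l" if "l < r" for l
    using kern_eq[OF assms(1,2,4) that] kern_eq[OF assms(1,2,3) that] E assms that
    unfolding equiv_below_def by metis
  then have "(\<Sum>m<r. ((if m = j then 1 - 1 else 0) + 1 * kern k \<epsilon> x j m) * x m l) =
      (\<Sum>m<r. ((if m = i then 1 - 1 else 0) + 1 * kern k \<epsilon> x i m) * x m l)" for l
    by (intro sum.cong) auto
  then show ?thesis using assms by (simp only: gather_def if_True simp_thms)
qed

lemma gap_zero_near:
  assumes "0 < \<epsilon>" "gap r k \<epsilon> x = 0" "i < r" "j < r"
  shows "near k \<epsilon> x i j \<longleftrightarrow> sqd k (x i) (x j) = 0"
proof -
  have "16 / \<epsilon> * min (sqd k (x i) (x j)) (max 0 (\<epsilon> / 2 - sqd k (x i) (x j))) \<le> 0"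
    using gap_term[OF assms(1,3,4), of k x] assms(2) by simp
  then have "min (sqd k (x i) (x j)) (max 0 (\<epsilon> / 2 - sqd k (x i) (x j))) \<le> 0"
    using assms(1) by (simp add: divide_le_0_iff)
  then show ?thesis using assms(1) sqd_nonneg[of k "x i" "x j"]
    by (auto simp: near_def min_def max_def intro: order_antisym split: if_splits)
qed

text \<open>All points that contribute coincide with \<open>x i\<close>, so the sum is a positive
  multiple of it.\<close>

lemma gather_trivial:
  assumes "0 < \<epsilon>" "gap r k \<epsilon> x = 0" and x: "\<And>j. x j \<in> sphere_set k" and \<sigma>: "0 \<le> \<sigma>" "\<sigma> \<le> 1"
  shows "gather r k \<epsilon> \<sigma> x i = x i"
proof (cases "i < r")
  case True
  let ?c = "\<lambda>j. (if j = i then 1 - \<sigma> else 0) + \<sigma> * kern k \<epsilon> x i j"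
  have "?c j * x j l = ?c j * x i l" if "j < r" for j l
  proof (cases "?c j = 0")
    case False
    then have "near k \<epsilon> x i j"
      using kern_eq[of \<epsilon> r k x i j] assms True that by (cases "j = i") (auto simp: near_def split: if_splits)
    then have "x j = x i"
      using gap_zero_near[OF assms(1,2) True that] sqd_eq_0_iff[OF x x] by auto
    then show ?thesis by simp
  qed simp
  then have "(\<lambda>l. \<Sum>j<r. ?c j * x j l) = (\<lambda>l. (\<Sum>j<r. ?c j) * x i l)"
    by (auto simp: sum_distrib_right intro!: sum.cong)
  moreover have "0 < (\<Sum>j<r. ?c j)"
    using True \<sigma> kern_bounds by (intro sum_pos2[of _ i]) auto
  ultimately show ?thesis
    using radial_scale[OF x] True assms(1) by (simp add: gather_def)
qed (simp add: gather_def)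

lemma gather_zero:
  assumes x: "\<And>j. x j \<in> sphere_set k"
  shows "gather r k \<epsilon> 0 x = x"
proof
  fix i
  have "(\<lambda>l. \<Sum>j<r. (if j = i then 1 - 0 else 0) * x j l) = (\<lambda>l. 1 * x i l)" if "i < r"
    using that by (auto simp: if_distrib[of "\<lambda>a. a * _"] cong: if_cong)
  then show "gather r k \<epsilon> 0 x i = x i"
    using radial_scale[OF x, of 1 i] by (simp add: gather_def)
qed

lemma gather_perm:
  assumes p: "bij_betw p {..<r} {..<r}" and x: "\<And>i. i < r \<Longrightarrow> x' i = x (p i)"
  shows "i < r \<Longrightarrow> gather r k \<epsilon> \<sigma> x' i = gather r k \<epsilon> \<sigma> x (p i)"
    and "gap r k \<epsilon> x' = gap r k \<epsilon> x"
    and "i < r \<Longrightarrow> j < r \<Longrightarrow> near k \<epsilon> x' i j \<longleftrightarrow> near k \<epsilon> x (p i) (p j)"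
proof -
  have pr: "p i < r" if "i < r" for i using p that by (auto simp: bij_betw_def)
  have inj: "p i = p j \<longleftrightarrow> i = j" if "i < r" "j < r" for i j
    using p that by (auto simp: bij_betw_def inj_on_def)
  show "gather r k \<epsilon> \<sigma> x' i = gather r k \<epsilon> \<sigma> x (p i)" if i: "i < r"
  proof -
    let ?F = "\<lambda>l j. ((if j = p i then 1 - \<sigma> else 0) + \<sigma> * kern k \<epsilon> x (p i) j) * x j l"
    have "(\<Sum>j<r. ((if j = i then 1 - \<sigma> else 0) + \<sigma> * kern k \<epsilon> x' i j) * x' j l) = (\<Sum>j<r. ?F l (p j))" for l
      using x i inj by (intro sum.cong) (auto simp: kern_def)
    also have "(\<Sum>j<r. ?F l (p j)) = (\<Sum>j<r. ?F l j)" for l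
      by (rule sum.reindex_bij_betw[OF p])
    finally show ?thesis using i pr x by (simp add: gather_def)
  qed
  show "gap r k \<epsilon> x' = gap r k \<epsilon> x"
  proof -
    let ?f = "\<lambda>i j. min (sqd k (x i) (x j)) (max 0 (\<epsilon> / 2 - sqd k (x i) (x j)))"
    have "(\<Sum>i<r. \<Sum>j<r. min (sqd k (x' i) (x' j)) (max 0 (\<epsilon> / 2 - sqd k (x' i) (x' j)))) = (\<Sum>i<r. \<Sum>j<r. ?f (p i) (p j))"
      using x by (intro sum.cong) auto
    also have "\<dots> = (\<Sum>i<r. \<Sum>j<r. ?f (p i) j)"
      by (rule sum.cong[OF refl]) (rule sum.reindex_bij_betw[OF p])
    also have "\<dots> = (\<Sum>i<r. \<Sum>j<r. ?f i j)"
      by (rule sum.reindex_bij_betw[OF p])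
    finally show ?thesis by (simp add: gap_def)
  qed
  show "near k \<epsilon> x' i j \<longleftrightarrow> near k \<epsilon> x (p i) (p j)" if "i < r" "j < r"
    using x that by (simp add: near_def)
qed

section \<open>Continuity of gathering\<close>

lemma tendsto_fun_iff:
  fixes f :: "'b \<Rightarrow> 'a \<Rightarrow> 'c::topological_space"
  shows "(f \<longlongrightarrow> l) F \<longleftrightarrow> (\<forall>i. ((\<lambda>k. f k i) \<longlongrightarrow> l i) F)"
  using limitin_componentwise[of "\<lambda>_. euclidean" UNIV f l F]
  by (simp add: euclidean_product_topology)

lemma tendsto_component: "(f \<longlongrightarrow> l) F \<Longrightarrow> ((\<lambda>k. f k i) \<longlongrightarrow> l i) F"
  by (simp add: tendsto_fun_iff)

lemma tendsto_sqd [tendsto_intros]: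
  assumes "(x \<longlongrightarrow> a) F" "(y \<longlongrightarrow> b) F"
  shows "((\<lambda>z. sqd k (x z) (y z)) \<longlongrightarrow> sqd k a b) F"
  unfolding sqd_def
  by (intro tendsto_sum tendsto_power tendsto_diff tendsto_component[OF assms(1)] tendsto_component[OF assms(2)])

text \<open>At the limit \<open>\<epsilon> = 0\<close> the kernel need not converge, but there
  gathering moves points by at most \<open>es k\<close> in squared distance. For positive
  \<open>\<epsilon>\<close> all formulas are continuous, since the vector to be normalized is
  nonzero.\<close>

lemma gather_tendsto:
  assumes xs: "\<And>k j. xs k j \<in> sphere_set K" and x: "\<And>j. x j \<in> sphere_set K" and lim: "xs \<longlonglongrightarrow> x"
    and es: "\<And>k. 0 \<le> es k" "\<And>k. es k \<le> 1" "es \<longlonglongrightarrow> \<epsilon>"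
    and ss: "\<And>k. 0 \<le> ss k" "\<And>k. ss k \<le> 1" "ss \<longlonglongrightarrow> \<sigma>"
  shows "(\<lambda>k. gather r K (es k) (ss k) (xs k)) \<longlonglongrightarrow> gather r K \<epsilon> \<sigma> x"
proof -
  have lim': "(\<lambda>k. xs k j l) \<longlonglongrightarrow> x j l" for j l
    using lim by (simp add: tendsto_fun_iff)
  have limj: "(\<lambda>k. xs k j) \<longlonglongrightarrow> x j" for j
    using lim by (simp add: tendsto_fun_iff)
  have \<epsilon>: "0 \<le> \<epsilon>" "\<epsilon> \<le> 1" and \<sigma>: "0 \<le> \<sigma>" "\<sigma> \<le> 1"
    using LIMSEQ_le_const[OF es(3), of 0] LIMSEQ_le_const2[OF es(3), of 1]
      LIMSEQ_le_const[OF ss(3), of 0] LIMSEQ_le_const2[OF ss(3), of 1] es ss by auto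
  show ?thesis
  proof (cases "\<epsilon> = 0")
    case True
    have "(\<lambda>k. gather r K (es k) (ss k) (xs k) i l) \<longlonglongrightarrow> x i l" for i l
    proof -
      have "(gather r K (es k) (ss k) (xs k) i l - xs k i l)\<^sup>2 \<le> es k" for k
      proof (cases "l \<le> K")
        case True
        then have "(gather r K (es k) (ss k) (xs k) i l - xs k i l)\<^sup>2 \<le> sqd K (gather r K (es k) (ss k) (xs k) i) (xs k i)"
          unfolding sqd_def by (intro member_le_sum) auto
        also have "\<dots> \<le> es k"
          by (rule gather_close(2)) (use xs es ss in auto)
        finally show ?thesis .
      next
        case False
        have "gather r K (es k) (ss k) (xs k) i \<in> sphere_set K"
          by (rule gather_close(1)) (use xs es ss in auto)
        then show ?thesis using False xs[of k i] es(1)[of k] unfolding sphere_set_iff by simp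
      qed
      then have le: "\<forall>k. (gather r K (es k) (ss k) (xs k) i l - xs k i l)\<^sup>2 \<le> es k" by blast
      have "(\<lambda>k. (gather r K (es k) (ss k) (xs k) i l - xs k i l)\<^sup>2) \<longlonglongrightarrow> 0"
      proof (rule tendsto_sandwich[of "\<lambda>_. 0" _ sequentially es])
        show "\<forall>\<^sub>F k in sequentially. (gather r K (es k) (ss k) (xs k) i l - xs k i l)\<^sup>2 \<le> es k"
          using le by (rule always_eventually)
        show "es \<longlonglongrightarrow> 0" using es(3) unfolding True .
      qed (simp_all add: always_eventually)
      from tendsto_real_sqrt[OF this]
      have "(\<lambda>k. \<bar>gather r K (es k) (ss k) (xs k) i l - xs k i l\<bar>) \<longlonglongrightarrow> 0"
        unfolding real_sqrt_abs real_sqrt_zero .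
      then have "(\<lambda>k. gather r K (es k) (ss k) (xs k) i l - xs k i l) \<longlonglongrightarrow> 0"
        unfolding tendsto_rabs_zero_iff .
      from tendsto_add[OF this lim'[of i l]] show ?thesis by simp
    qed
    then show ?thesis using True by (simp add: tendsto_fun_iff gather_def)
  next
    case False
    then have pos: "0 < \<epsilon>" using \<epsilon> by simp
    then have ev: "eventually (\<lambda>k. 0 < es k) sequentially"
      using order_tendstoD(1)[OF es(3)] by blast
    have kern: "(\<lambda>k. kern K (es k) (xs k) i j) \<longlonglongrightarrow> kern K \<epsilon> x i j" for i j
      unfolding kern_def using pos by (intro tendsto_intros limj es(3)) auto
    have "(\<lambda>k. gather r K (es k) (ss k) (xs k) i l) \<longlonglongrightarrow> gather r K \<epsilon> \<sigma> x i l" for i l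
    proof (cases "i < r")
      case True
      let ?z = "\<lambda>\<epsilon> \<sigma> x l. \<Sum>j<r. ((if j = i then 1 - \<sigma> else 0) + \<sigma> * kern K \<epsilon> x i j) * x j l"
      have z: "(\<lambda>k. ?z (es k) (ss k) (xs k) l) \<longlonglongrightarrow> ?z \<epsilon> \<sigma> x l" for l
      proof -
        have c: "(\<lambda>k. if j = i then 1 - ss k else 0) \<longlonglongrightarrow> (if j = i then 1 - \<sigma> else 0)" for j
          using ss(3) by (auto intro!: tendsto_intros)
        show ?thesis by (intro tendsto_intros c kern lim' ss(3))
      qed
      have "(\<Sum>l\<le>K. (?z \<epsilon> \<sigma> x l)\<^sup>2) > 0"
        by (rule gather_close(3)) (use x \<epsilon> \<sigma> True pos in auto)
      then have "(\<lambda>k. ?z (es k) (ss k) (xs k) l / sqrt (\<Sum>l\<le>K. (?z (es k) (ss k) (xs k) l)\<^sup>2))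
         \<longlonglongrightarrow> ?z \<epsilon> \<sigma> x l / sqrt (\<Sum>l\<le>K. (?z \<epsilon> \<sigma> x l)\<^sup>2)"
        by (intro tendsto_divide tendsto_real_sqrt tendsto_sum tendsto_power z) simp
      then have "(\<lambda>k. radial K (?z (es k) (ss k) (xs k)) l) \<longlonglongrightarrow> gather r K \<epsilon> \<sigma> x i l"
        using True pos by (simp add: gather_def radial_def)
      moreover have "\<forall>\<^sub>F k in sequentially. radial K (?z (es k) (ss k) (xs k)) l = gather r K (es k) (ss k) (xs k) i l"
        using ev by eventually_elim (simp add: gather_def True)
      ultimately show ?thesis by (rule Lim_transform_eventually)
    next
      case False
      then show ?thesis by (simp add: gather_def lim')
    qed
    then show ?thesis by (simp add: tendsto_fun_iff)
  qed
qed

text \<open>A continuous symmetric function that vanishes iff there are fewer than \<open>m\<close> distinct positions. Division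
by the number of all subsets keeps it below each nonzero squared distance when there are exactly \<open>m\<close> of them.\<close>

definition spread :: "nat \<Rightarrow> nat \<Rightarrow> nat \<Rightarrow> (nat \<Rightarrow> nat \<Rightarrow> real) \<Rightarrow> real" where
  "spread r m k x = (\<Sum>I | I \<subseteq> {..<r} \<and> card I = m. \<Prod>i\<in>I. \<Prod>j\<in>I - {i}. min 1 (sqd k (x i) (x j))) / 2 ^ r"

lemma finite_subsets [simp]: "finite {I. I \<subseteq> {..<r::nat} \<and> card I = m}"
  by (rule finite_subset[of _ "Pow {..<r}"]) auto

lemma spread_nonneg: "0 \<le> spread r m k x"
  unfolding spread_def by (intro divide_nonneg_nonneg sum_nonneg prod_nonneg) auto

lemma spread_le:
  assumes b: "0 \<le> b" and "\<And>I. I \<subseteq> {..<r} \<Longrightarrow> card I = m \<Longrightarrow> (\<Prod>i\<in>I. \<Prod>j\<in>I - {i}. min 1 (sqd k (x i) (x j))) \<le> b"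
  shows "spread r m k x \<le> b"
proof -
  have "(\<Sum>I | I \<subseteq> {..<r} \<and> card I = m. \<Prod>i\<in>I. \<Prod>j\<in>I - {i}. min 1 (sqd k (x i) (x j)))
      \<le> (\<Sum>I | I \<subseteq> {..<r} \<and> card I = m. b)"
    using assms(2) by (intro sum_mono) auto
  also have "\<dots> \<le> 2 ^ r * b"
  proof -
    have "card {I. I \<subseteq> {..<r} \<and> card I = m} \<le> card (Pow {..<r})" by (intro card_mono) auto
    then have "real (card {I. I \<subseteq> {..<r} \<and> card I = m}) \<le> 2 ^ r"
      by (simp add: card_Pow flip: of_nat_power of_nat_le_iff)
    then show ?thesis using b by (simp add: mult_right_mono)
  qed
  finally show ?thesis by (simp add: spread_def field_simps)
qed

lemma spread_le_1: "spread r m k x \<le> 1"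
  by (rule spread_le) (auto intro!: prod_le_1 prod_nonneg)

text \<open>The product over \<open>I\<close> is nonzero iff the positions on \<open>I\<close> are
  distinct, and an \<open>I\<close> of size \<open>m\<close> with this property exists iff there are
  at least \<open>m\<close> positions.\<close>

lemma spread_eq_0_iff:
  assumes x: "\<And>i. x i \<in> sphere_set k"
  shows "spread r m k x = 0 \<longleftrightarrow> card (x ` {..<r}) < m"
proof -
  let ?P = "\<lambda>I. \<Prod>i\<in>I. \<Prod>j\<in>I - {i}. min 1 (sqd k (x i) (x j))"
  have P0: "?P I = 0 \<longleftrightarrow> \<not> inj_on x I" if "I \<subseteq> {..<r}" for I
  proof -
    have "finite I" using that finite_subset by blast
    then have "?P I = 0 \<longleftrightarrow> (\<exists>i\<in>I. \<exists>j\<in>I - {i}. min 1 (sqd k (x i) (x j)) = 0)" by simp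
    also have "\<dots> \<longleftrightarrow> (\<exists>i\<in>I. \<exists>j\<in>I - {i}. x i = x j)"
    proof -
      have "min 1 (sqd k (x i) (x j)) = 0 \<longleftrightarrow> x i = x j" for i j
        using sqd_eq_0_iff[OF x x, of i j] by (auto simp: min_def split: if_splits)
      then show ?thesis by simp
    qed
    also have "\<dots> \<longleftrightarrow> \<not> inj_on x I" by (auto simp: inj_on_def)
    finally show ?thesis .
  qed
  have "spread r m k x = 0 \<longleftrightarrow> (\<forall>I. I \<subseteq> {..<r} \<and> card I = m \<longrightarrow> ?P I = 0)"
    unfolding spread_def by (simp add: sum_nonneg_eq_0_iff prod_nonneg)
  also have "\<dots> \<longleftrightarrow> (\<forall>I. I \<subseteq> {..<r} \<and> card I = m \<longrightarrow> \<not> inj_on x I)" using P0 by blast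
  also have "\<dots> \<longleftrightarrow> card (x ` {..<r}) < m"
  proof
    assume *: "\<forall>I. I \<subseteq> {..<r} \<and> card I = m \<longrightarrow> \<not> inj_on x I"
    show "card (x ` {..<r}) < m"
    proof (rule ccontr)
      assume "\<not> card (x ` {..<r}) < m"
      then obtain D where D: "D \<subseteq> x ` {..<r}" "card D = m"
        using obtain_subset_with_card_n by (metis not_less)
      obtain I where I: "I \<subseteq> {..<r}" "inj_on x I" "x ` I = D"
        using subset_image_inj[THEN iffD1, OF D(1)] by blast
      then have "card I = m" using D card_image by metis
      then show False using * I by blast
    qed
  next
    assume c: "card (x ` {..<r}) < m"
    show "\<forall>I. I \<subseteq> {..<r} \<and> card I = m \<longrightarrow> \<not> inj_on x I"
    proof (intro allI impI notI)
      fix I assume I: "I \<subseteq> {..<r} \<and> card I = m" "inj_on x I"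
      then have "m = card (x ` I)" by (simp add: card_image)
      also have "\<dots> \<le> card (x ` {..<r})" using I by (intro card_mono) auto
      finally show False using c by simp
    qed
  qed
  finally show ?thesis .
qed

text \<open>If the product over \<open>I\<close> is nonzero, then \<open>I\<close> meets every
  position, as there are at most \<open>m\<close> of them. So one factor is the term for the
  positions of \<open>i\<close> and \<open>j\<close>, and the other factors are at most 1.\<close>

lemma spread_le_sqd:
  assumes x: "\<And>i. x i \<in> sphere_set k" and c: "card (x ` {..<r}) \<le> m" and ij: "i < r" "j < r" "x i \<noteq> x j"
  shows "spread r m k x \<le> sqd k (x i) (x j)"
proof (rule spread_le)
  fix I assume I: "I \<subseteq> {..<r}" "card I = m"
  let ?f = "\<lambda>a b. min 1 (sqd k (x a) (x b))"
  have fin: "finite I" using I finite_subset by blast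
  show "(\<Prod>a\<in>I. \<Prod>b\<in>I - {a}. ?f a b) \<le> sqd k (x i) (x j)"
  proof (cases "inj_on x I")
    case True
    have "x ` I = x ` {..<r}"
    proof (rule card_subset_eq)
      have "card (x ` I) \<le> card (x ` {..<r})" using I(1) by (intro card_mono) auto
      then show "card (x ` I) = card (x ` {..<r})" using I(2) c True by (simp add: card_image)
    qed (use I(1) in auto)
    then have "x i \<in> x ` I" "x j \<in> x ` I" using ij by auto
    then obtain a b where ab: "a \<in> I" "b \<in> I" "x a = x i" "x b = x j" by (metis imageE)
    then have ba: "b \<in> I - {a}" using ij by auto
    have g: "0 \<le> (\<Prod>b\<in>I - {a}. ?f a b)" "(\<Prod>b\<in>I - {a}. ?f a b) \<le> 1" for a
      by (auto intro!: prod_nonneg prod_le_1)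
    have "(\<Prod>a\<in>I. \<Prod>b\<in>I - {a}. ?f a b) = (\<Prod>b\<in>I - {a}. ?f a b) * (\<Prod>c\<in>I - {a}. \<Prod>b\<in>I - {c}. ?f c b)"
      by (rule prod.remove[OF fin ab(1)])
    also have "\<dots> \<le> (\<Prod>b\<in>I - {a}. ?f a b) * 1"
      using g by (intro mult_left_mono prod_le_1) auto
    also have "(\<Prod>b\<in>I - {a}. ?f a b) = ?f a b * (\<Prod>c\<in>I - {a} - {b}. ?f a c)"
      using fin ba by (intro prod.remove) auto
    also have "\<dots> \<le> ?f a b * 1"
      by (intro mult_left_mono prod_le_1) auto
    finally show ?thesis using ab by simp
  next
    case False
    then obtain a b where ab: "a \<in> I" "b \<in> I" "a \<noteq> b" "x a = x b" by (auto simp: inj_on_def)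
    then have "(\<Prod>b\<in>I - {a}. ?f a b) = 0" using fin by (intro prod_zero bexI[of _ b]) auto
    then have "(\<Prod>a\<in>I. \<Prod>b\<in>I - {a}. ?f a b) = 0" using fin ab(1) by (intro prod_zero) auto
    then show ?thesis by (simp only: sqd_nonneg)
  qed
qed simp

lemma spread_perm:
  assumes p: "bij_betw p {..<r} {..<r}" and x: "\<And>i. i < r \<Longrightarrow> x' i = x (p i)"
  shows "spread r m k x' = spread r m k x"
proof -
  let ?A = "{I. I \<subseteq> {..<r} \<and> card I = m}"
  let ?P = "\<lambda>x I. \<Prod>i\<in>I. \<Prod>j\<in>I - {i}. min 1 (sqd k (x i) (x j))"
  have inj: "inj_on p I" if "I \<subseteq> {..<r}" for I using p that by (auto simp: bij_betw_def inj_on_subset)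
  have b: "bij_betw (image p) ?A ?A"
  proof (rule bij_betwI')
    fix I J assume "I \<in> ?A" "J \<in> ?A"
    then show "(p ` I = p ` J) = (I = J)"
      using inj_on_image_eq_iff[of p "{..<r}" I J] p by (auto simp: bij_betw_def)
  next
    fix I assume "I \<in> ?A"
    then show "p ` I \<in> ?A" using inj[of I] p by (auto simp: card_image bij_betw_def)
  next
    fix J assume J: "J \<in> ?A"
    then have "J \<subseteq> p ` {..<r}" using p by (simp add: bij_betw_def)
    then obtain I where I: "I \<subseteq> {..<r}" "J = p ` I" by (auto simp: subset_image_iff)
    then show "\<exists>I\<in>?A. J = p ` I" using J inj[of I] by (auto simp: card_image)
  qed
  have P: "?P x' I = ?P x (p ` I)" if I: "I \<in> ?A" for I
  proof -
    have Ir: "I \<subseteq> {..<r}" using I by simp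
    have "?P x (p ` I) = (\<Prod>i\<in>I. \<Prod>j\<in>p ` I - {p i}. min 1 (sqd k (x (p i)) (x j)))"
      by (simp add: prod.reindex[OF inj[OF Ir]])
    also have "\<dots> = (\<Prod>i\<in>I. \<Prod>j\<in>I - {i}. min 1 (sqd k (x (p i)) (x (p j))))"
    proof (rule prod.cong[OF refl])
      fix i assume i: "i \<in> I"
      have "p ` I - {p i} = p ` (I - {i})"
        using inj_on_image_set_diff[OF inj[OF Ir], of I "{i}"] i by simp
      then show "(\<Prod>j\<in>p ` I - {p i}. min 1 (sqd k (x (p i)) (x j))) = (\<Prod>j\<in>I - {i}. min 1 (sqd k (x (p i)) (x (p j))))"
        using inj[of "I - {i}"] Ir by (simp add: prod.reindex subset_eq)
    qed
    also have "\<dots> = ?P x' I"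
      using x Ir by (intro prod.cong refl) (auto simp: subset_eq)
    finally show ?thesis ..
  qed
  have "(\<Sum>I\<in>?A. ?P x' I) = (\<Sum>I\<in>?A. ?P x (p ` I))" using P by (rule sum.cong[OF refl])
  also have "\<dots> = (\<Sum>I\<in>?A. ?P x I)" by (rule sum.reindex_bij_betw[OF b])
  finally show ?thesis by (simp add: spread_def)
qed

lemma tendsto_spread:
  assumes "(xs \<longlongrightarrow> x) F"
  shows "((\<lambda>a. spread r m k (xs a)) \<longlongrightarrow> spread r m k x) F"
  unfolding spread_def by (intro tendsto_intros tendsto_component[OF assms]) simp

lemma tendsto_gap:
  assumes "(xs \<longlongrightarrow> x) F" "(es \<longlongrightarrow> \<epsilon>) F" "\<epsilon> \<noteq> 0"
  shows "((\<lambda>a. gap r k (es a) (xs a)) \<longlongrightarrow> gap r k \<epsilon> x) F"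
  unfolding gap_def by (intro tendsto_intros tendsto_component[OF assms(1)] assms(2,3)) simp

text \<open>The cap leaves a total weight of at least \<open>1/2\<close>; it is inactive for \<open>t r \<le> 1/(4n)\<close>, where trimming
annihilates all weights from index \<open>r\<close> on.\<close>

definition trim_amount :: "nat \<Rightarrow> nat \<Rightarrow> (nat \<Rightarrow> real) \<Rightarrow> real" where
  "trim_amount n r t = min (t r) (max 0 (1 / (2 * n) - t r))"

definition trim :: "nat \<Rightarrow> nat \<Rightarrow> real \<Rightarrow> (nat \<Rightarrow> real) \<Rightarrow> nat \<Rightarrow> real" where
  "trim n r \<sigma> t i = max (t i - \<sigma> * trim_amount n r t) 0 / (\<Sum>j<n. max (t j - \<sigma> * trim_amount n r t) 0)"

lemma simplex_iff:
  assumes "n \<ge> 1"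
  shows "t \<in> standard_simplex (n - 1) \<longleftrightarrow> (\<forall>i. 0 \<le> t i) \<and> (\<forall>i\<ge>n. t i = 0) \<and> (\<Sum>i<n. t i) = 1"
proof -
  have e: "{..n - 1} = {..<n}" "\<And>i. i > n - 1 \<longleftrightarrow> i \<ge> n" using assms by auto
  have "t i \<le> 1" if "\<forall>i. 0 \<le> t i" "\<forall>i\<ge>n. t i = 0" "(\<Sum>i<n. t i) = 1" for i
  proof (cases "i < n")
    case True
    then have "t i \<le> (\<Sum>i<n. t i)" using that by (intro member_le_sum) auto
    then show ?thesis using that by simp
  qed (use that in auto)
  then show ?thesis unfolding standard_simplex_def e by auto
qed

lemma trim_amount_bounds:
  assumes "n \<ge> 1" "\<And>i. 0 \<le> t i"
  shows "0 \<le> trim_amount n r t" "n * trim_amount n r t \<le> 1 / 2"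
proof -
  show "0 \<le> trim_amount n r t" using assms by (simp add: trim_amount_def)
  have "trim_amount n r t \<le> 1 / (2 * n)"
    using assms(2)[of r] by (auto simp: trim_amount_def min_def max_def)
  then show "n * trim_amount n r t \<le> 1 / 2" using assms(1) by (simp add: field_simps)
qed

text \<open>At most \<open>n * trim_amount n r t\<close> is lost from the total weight 1, and that
  is at most \<open>1/2\<close>.\<close>

lemma trim_denominator:
  assumes n: "n \<ge> 1" and t: "t \<in> standard_simplex (n - 1)" and \<sigma>: "0 \<le> \<sigma>" "\<sigma> \<le> 1"
  shows "0 < (\<Sum>j<n. max (t j - \<sigma> * trim_amount n r t) 0)"
proof -
  have t0: "\<And>i. 0 \<le> t i" and t1: "(\<Sum>i<n. t i) = 1" using t simplex_iff[OF n] by auto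
  note a = trim_amount_bounds[OF n t0, of r]
  have "\<sigma> * (n * trim_amount n r t) \<le> 1 * (1 / 2)" using a \<sigma> by (intro mult_mono) auto
  then have "0 < 1 - \<sigma> * (n * trim_amount n r t)" by simp
  also have "\<dots> = (\<Sum>j<n. t j - \<sigma> * trim_amount n r t)"
    using t1 by (simp add: sum_subtractf)
  also have "\<dots> \<le> (\<Sum>j<n. max (t j - \<sigma> * trim_amount n r t) 0)" by (intro sum_mono) auto
  finally show ?thesis .
qed

lemma trim_simplex:
  assumes n: "n \<ge> 1" and t: "t \<in> standard_simplex (n - 1)" and \<sigma>: "0 \<le> \<sigma>" "\<sigma> \<le> 1"
  shows "trim n r \<sigma> t \<in> standard_simplex (n - 1)"
proof -
  note d = trim_denominator[OF assms, of r]
  have "0 \<le> \<sigma> * trim_amount n r t"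
    using trim_amount_bounds(1)[OF n, of t r] t simplex_iff[OF n] \<sigma> by auto
  then show ?thesis
    using d t unfolding simplex_iff[OF n] trim_def by (auto simp: sum_divide_distrib[symmetric])
qed

lemma trim_trivial:
  assumes n: "n \<ge> 1" and t: "t \<in> standard_simplex (n - 1)" and "\<sigma> * trim_amount n r t = 0"
  shows "trim n r \<sigma> t = t"
  using assms(3) t unfolding trim_def simplex_iff[OF n] by (auto simp: max_absorb1)

lemma trim_antitone:
  assumes n: "n \<ge> 1" and t: "t \<in> standard_simplex (n - 1)" and \<sigma>: "0 \<le> \<sigma>" "\<sigma> \<le> 1" and "t j \<le> t i"
  shows "trim n r \<sigma> t j \<le> trim n r \<sigma> t i"
  unfolding trim_def using trim_denominator[OF n t \<sigma>, of r] assms(5) by (intro divide_right_mono) auto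

lemma trim_zero:
  assumes n: "n \<ge> 1" and t: "t \<in> standard_simplex (n - 1)" and i: "t i \<le> t r" and r: "4 * n * t r < 1"
  shows "trim n r 1 t i = 0"
proof -
  have "t r < 1 / (4 * n)" using r n by (simp add: field_simps)
  moreover have "1 / (2 * real n) = 2 * (1 / (4 * n))" by simp
  ultimately have "trim_amount n r t = t r"
    unfolding trim_amount_def by (simp add: min_def max_def)
  then show ?thesis using i by (simp add: trim_def)
qed

lemma trim_of_zero:
  assumes "n \<ge> 1" "\<And>i. 0 \<le> t i" "0 \<le> \<sigma>" "t i = 0"
  shows "trim n r \<sigma> t i = 0"
  using trim_amount_bounds(1)[OF assms(1,2), of r] assms(3,4) by (simp add: trim_def)

text \<open>Only the product of \<open>ss k\<close> and the amount has to converge; the clock put in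
  for \<open>ss k\<close> may jump where the amount tends to 0.\<close>

lemma tendsto_trim:
  assumes n: "n \<ge> 1" and t: "t \<in> standard_simplex (n - 1)" and ts: "ts \<longlonglongrightarrow> t"
    and ss: "(\<lambda>k. ss k * trim_amount n r (ts k)) \<longlonglongrightarrow> \<sigma> * trim_amount n r t"
    and \<sigma>: "0 \<le> \<sigma>" "\<sigma> \<le> 1"
  shows "(\<lambda>k. trim n r (ss k) (ts k)) \<longlonglongrightarrow> trim n r \<sigma> t"
  unfolding tendsto_fun_iff trim_def
  using trim_denominator[OF n t \<sigma>, of r]
  by (intro allI tendsto_divide tendsto_sum tendsto_max tendsto_diff tendsto_const tendsto_component[OF ts] ss) simp

lemma tendsto_trim_amount:
  assumes "ts \<longlonglongrightarrow> t"
  shows "(\<lambda>k. trim_amount n r (ts k)) \<longlonglongrightarrow> trim_amount n r t"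
  unfolding trim_amount_def by (intro tendsto_intros tendsto_component[OF assms])

section \<open>Collapsing one stage\<close>

definition unit_clamp :: "real \<Rightarrow> real" where
  "unit_clamp s = max 0 (min 1 s)"

lemma unit_clamp_bounds: "0 \<le> unit_clamp s" "unit_clamp s \<le> 1"
  by (auto simp: unit_clamp_def)

lemma unit_clamp_le_0: "s \<le> 0 \<Longrightarrow> unit_clamp s = 0"
  by (simp add: unit_clamp_def)

lemma unit_clamp_ge_1: "1 \<le> s \<Longrightarrow> unit_clamp s = 1"
  by (simp add: unit_clamp_def)

lemma unit_clamp_id: "0 \<le> s \<Longrightarrow> s \<le> 1 \<Longrightarrow> unit_clamp s = s"
  by (simp add: unit_clamp_def)

lemma tendsto_unit_clamp: "(f \<longlongrightarrow> a) F \<Longrightarrow> ((\<lambda>x. unit_clamp (f x)) \<longlongrightarrow> unit_clamp a) F"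
  unfolding unit_clamp_def by (intro tendsto_intros)

lemma configs_iff:
  assumes "n \<ge> 1"
  shows "c \<in> configs n k \<longleftrightarrow> (\<forall>i. 0 \<le> fst c i) \<and> (\<forall>i\<ge>n. fst c i = 0) \<and> (\<Sum>i<n. fst c i) = 1 \<and> (\<forall>i. snd c i \<in> sphere_set k)"
  unfolding configs_def mem_Times_iff simplex_iff[OF assms] by simp

lemma transfer_cong:
  assumes "\<And>i j. i < r \<Longrightarrow> j < r \<Longrightarrow> R i j \<longleftrightarrow> R' i j"
  shows "transfer r R \<sigma> t = transfer r R' \<sigma> t"
proof
  fix i
  show "transfer r R \<sigma> t i = transfer r R' \<sigma> t i"
  proof (cases "i < r")
    case True
    have 1: "(\<forall>j<i. \<not> R j i) \<longleftrightarrow> (\<forall>j<i. \<not> R' j i)"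
      using assms[OF _ True] True by (meson less_trans)
    have 2: "(\<forall>j. i < j \<and> j < r \<longrightarrow> \<not> R i j) \<longleftrightarrow> (\<forall>j. i < j \<and> j < r \<longrightarrow> \<not> R' i j)"
      using assms[OF True] by blast
    have 3: "cls r R i = cls r R' i"
      unfolding cls_def using assms[OF True] by blast
    show ?thesis unfolding transfer_def 1 2 3 ..
  qed (simp add: transfer_def)
qed

text \<open>Index \<open>r - 1\<close> is the last of its class, so it gives, and it receives only
  if it is alone. Transitivity of \<open>R\<close> is not among the hypotheses because
  \<open>near\<close> may fail to be transitive where \<open>gap\<close> is large.\<close>

lemma transfer_last_le:
  assumes R: "R (r - 1) (r - 1)" "\<And>j. R (r - 1) j \<Longrightarrow> R j (r - 1)" and r: "1 \<le> r"
    and t: "\<And>i. 0 \<le> t i" and \<sigma>: "0 \<le> \<sigma>"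
  shows "transfer r R \<sigma> t (r - 1) \<le> t (r - 1)"
proof -
  have last: "\<forall>j. r - 1 < j \<and> j < r \<longrightarrow> \<not> R (r - 1) j" by auto
  show ?thesis
  proof (cases "\<forall>j<r - 1. \<not> R j (r - 1)")
    case True
    have "cls r R (r - 1) = {r - 1}"
    proof
      show "cls r R (r - 1) \<subseteq> {r - 1}"
      proof
        fix j assume j: "j \<in> cls r R (r - 1)"
        then have "\<not> j < r - 1" using True R(2) by (auto simp: cls_def)
        moreover have "j < r" using j by (simp add: cls_def)
        ultimately show "j \<in> {r - 1}" by simp
      qed
      show "{r - 1} \<subseteq> cls r R (r - 1)" using R(1) r by (simp add: cls_def)
    qed
    then show ?thesis using True last unfolding transfer_def by simp
  next
    case False
    then have "transfer r R \<sigma> t (r - 1) = t (r - 1) - \<sigma> * t (r - 1)"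
      using last r unfolding transfer_def by auto
    then show ?thesis using t[of "r - 1"] \<sigma> by simp
  qed
qed

lemma transfer_close:
  assumes t: "\<And>i. 0 \<le> t i" "\<And>i. t i \<le> 1" and \<sigma>: "0 \<le> \<sigma>"
  shows "\<bar>transfer r R \<sigma> t i - t i\<bar> \<le> \<sigma>"
proof -
  have 1: "0 \<le> \<sigma> * t j" "\<sigma> * t j \<le> \<sigma>" for j
    using t[of j] \<sigma> by (auto simp: mult_left_le)
  show ?thesis unfolding transfer_def
    using 1[of i] 1[of "Max (cls r R i)"] \<sigma> by (auto simp: algebra_simps abs_le_iff)
qed

text \<open>By \<open>m < r\<close>, a formal sum with \<open>r\<close> weights at \<open>m\<close>
  positions has two weights at one position, so \<open>transfer\<close> can remove one. The case of
  \<open>r\<close> positions is covered by \<open>stage_rel_Suc_zero\<close>.\<close>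

locale stage =
  fixes n k r m :: nat
  assumes m: "1 \<le> m" and mr: "m < r" and rn: "r \<le> n"
begin

lemma n1: "n \<ge> 1" using mr rn by simp

text \<open>On sorted configurations this is positive iff the \<open>r\<close> heaviest weights are
  separated from the rest and their indices carry at least \<open>m\<close> positions. It bounds the
  size of the clusters and, when 0, switches off everything but trimming.\<close>

definition scale :: "config \<Rightarrow> real" where
  "scale c = min (spread r m k (snd c)) (fst c (r - 1) - fst c r)"

text \<open>The factor makes the duration reach 1 when \<open>fst c r\<close> is
  \<open>1 / (4 n)\<close>, where the cap in \<open>trim_amount\<close> begins to act. So trimming
  that ends before time 1 is complete.\<close>

definition delay :: "config \<Rightarrow> real" where
  "delay c = 4 * real n * fst c r"

text \<open>The three movements follow one another, with durations \<open>delay\<close>, \<open>gap\<close> and \<open>1\<close>. When one of the first two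
durations is \<open>0\<close>, the division yields \<open>0\<close>, but then the corresponding movement is trivial anyway.\<close>

definition clock1 :: "real \<Rightarrow> config \<Rightarrow> real" where
  "clock1 s c = unit_clamp (s / delay c)"

definition clock2 :: "real \<Rightarrow> config \<Rightarrow> real" where
  "clock2 s c = unit_clamp ((s - delay c) / gap r k (scale c) (snd c))"

text \<open>Without the guard the clock would run at \<open>scale c = 0\<close>, where division
  makes \<open>gap\<close> equal to 0 and \<open>near\<close> is the empty relation.\<close>

definition clock3 :: "real \<Rightarrow> config \<Rightarrow> real" where
  "clock3 s c = (if scale c \<le> 0 then 0 else unit_clamp (s - delay c - gap r k (scale c) (snd c)))"

definition trimmed :: "real \<Rightarrow> config \<Rightarrow> nat \<Rightarrow> real" where
  "trimmed s c = trim n r (clock1 s c) (fst c)"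

definition gathered :: "real \<Rightarrow> config \<Rightarrow> nat \<Rightarrow> nat \<Rightarrow> real" where
  "gathered s c = gather r k (scale c) (clock2 s c) (snd c)"

definition push :: "real \<Rightarrow> config \<Rightarrow> config" where
  "push s c = (transfer r (near k (scale c) (snd c)) (clock3 s c) (trimmed s c), gathered s c)"

definition sorted_configs :: "config set" where
  "sorted_configs = {c \<in> configs n k. antimono (fst c)}"

lemma sorted_configsD:
  assumes "c \<in> sorted_configs"
  shows "c \<in> configs n k" "\<And>i. 0 \<le> fst c i" "\<And>i. n \<le> i \<Longrightarrow> fst c i = 0" "(\<Sum>i<n. fst c i) = 1"
    "\<And>i. snd c i \<in> sphere_set k" "\<And>i j. i \<le> j \<Longrightarrow> fst c j \<le> fst c i" "fst c \<in> standard_simplex (n - 1)"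
  using assms unfolding sorted_configs_def mem_Collect_eq configs_iff[OF n1] simplex_iff[OF n1] by (auto dest: antimonoD)

lemma clock_bounds: "0 \<le> clock1 s c" "clock1 s c \<le> 1" "0 \<le> clock2 s c" "clock2 s c \<le> 1"
  "0 \<le> clock3 s c" "clock3 s c \<le> 1"
  by (auto simp: clock1_def clock2_def clock3_def unit_clamp_bounds)

lemma scale_bounds:
  assumes "c \<in> sorted_configs" shows "0 \<le> scale c" "scale c \<le> 1"
proof -
  show "0 \<le> scale c" using sorted_configsD(6)[OF assms, of "r - 1" r] spread_nonneg[of r m k "snd c"]
    by (simp add: scale_def)
  show "scale c \<le> 1" using spread_le_1[of r m k "snd c"] by (simp add: scale_def min_le_iff_disj)
qed

lemma delay_nonneg: "c \<in> sorted_configs \<Longrightarrow> 0 \<le> delay c"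
  using sorted_configsD(2)[of c r] by (simp add: delay_def)

lemma trimmed_simplex:
  assumes "c \<in> sorted_configs"
  shows "trimmed s c \<in> standard_simplex (n - 1)"
  unfolding trimmed_def by (rule trim_simplex[OF n1 sorted_configsD(7)[OF assms] clock_bounds(1,2)])

lemma trimmed_bounds:
  assumes "c \<in> sorted_configs"
  shows "0 \<le> trimmed s c i" "trimmed s c i \<le> 1" "i \<ge> n \<Longrightarrow> trimmed s c i = 0" "i \<le> j \<Longrightarrow> trimmed s c j \<le> trimmed s c i"
  "(\<Sum>i<n. trimmed s c i) = 1"
proof -
  show "0 \<le> trimmed s c i" "i \<ge> n \<Longrightarrow> trimmed s c i = 0" "(\<Sum>i<n. trimmed s c i) = 1"
    using trimmed_simplex[OF assms, of s] unfolding simplex_iff[OF n1] by simp_all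
  show "trimmed s c i \<le> 1" using trimmed_simplex[OF assms, of s] by (simp add: standard_simplex_def)
  show "trimmed s c j \<le> trimmed s c i" if "i \<le> j"
    unfolding trimmed_def
    by (rule trim_antitone[OF n1 sorted_configsD(7)[OF assms] clock_bounds(1,2) sorted_configsD(6)[OF assms that]])
qed

lemma gathered_sphere:
  assumes "c \<in> sorted_configs"
  shows "gathered s c i \<in> sphere_set k"
  unfolding gathered_def
  by (rule gather_close(1)[OF sorted_configsD(5)[OF assms] scale_bounds[OF assms] clock_bounds(3,4)])

text \<open>If the third clock runs, the times \<open>delay\<close> and \<open>gap\<close> have
  passed. Then gathering is complete, or trivial because \<open>gap\<close> is 0, so the members of
  a cluster share their position.\<close>

lemma clock3_pos:
  assumes c: "c \<in> sorted_configs" and s: "s \<le> 1" and pos: "clock3 s c \<noteq> 0"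
  shows "0 < scale c" "gap r k (scale c) (snd c) < 1" "delay c < 1" "delay c < s"
    "equiv_below r (near k (scale c) (snd c))"
    "\<And>i j. i < r \<Longrightarrow> j < r \<Longrightarrow> near k (scale c) (snd c) i j \<Longrightarrow> gathered s c j = gathered s c i"
proof -
  let ?u1 = "gap r k (scale c) (snd c)"
  show e: "0 < scale c" using pos by (auto simp: clock3_def split: if_splits)
  have g: "0 \<le> ?u1" using e by (intro gap_nonneg) simp
  have lt: "0 < s - delay c - ?u1"
    using pos e unit_clamp_le_0[of "s - delay c - ?u1"] by (auto simp: clock3_def not_le[symmetric])
  then show g1: "?u1 < 1" and "delay c < 1" "delay c < s"
    using s g delay_nonneg[OF c] by linarith+
  show "equiv_below r (near k (scale c) (snd c))" by (rule near_equiv[OF e g1])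
  fix i j assume ij: "i < r" "j < r" and nr: "near k (scale c) (snd c) i j"
  show "gathered s c j = gathered s c i"
  proof (cases "?u1 = 0")
    case True
    have "snd c j = snd c i"
      using gap_zero_near[OF e True ij] nr sqd_eq_0_iff[OF sorted_configsD(5)[OF c] sorted_configsD(5)[OF c], of i j] by simp
    then show ?thesis
      unfolding gathered_def using gather_trivial[OF e True sorted_configsD(5)[OF c] clock_bounds(3,4)] by simp
  next
    case False
    then have "1 \<le> (s - delay c) / ?u1" using g lt by (simp add: field_simps)
    then have "clock2 s c = 1" by (simp add: clock2_def unit_clamp_ge_1)
    then show ?thesis unfolding gathered_def using gather_eq_of_near[OF e g1 ij nr] by simp
  qed
qed

lemma sum_split:
  fixes f :: "nat \<Rightarrow> real"
  shows "(\<Sum>i<n. f i) = (\<Sum>i<r. f i) + (\<Sum>i=r..<n. f i)"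
  using sum.atLeastLessThan_concat[of 0 r n f] rn by (simp add: atLeast0LessThan)

text \<open>Weight is transferred only between indices that already share a position, so the third
  movement leaves the measure alone. This is what survives in the limit when the clusters
  jump.\<close>

lemma push_measure:
  assumes c: "c \<in> sorted_configs" and s: "s \<le> 1"
  shows "wsum n (push s c) (\<lambda>a y. a * \<phi> y) = (\<Sum>i<n. trimmed s c i * \<phi> (gathered s c i))"
proof (cases "clock3 s c = 0")
  case True
  then show ?thesis by (simp add: push_def wsum_def)
next
  case False
  note cl = clock3_pos[OF c s False]
  have "(\<Sum>i<r. fst (push s c) i * \<phi> (gathered s c i)) = (\<Sum>i<r. trimmed s c i * \<phi> (gathered s c i))"
    unfolding push_def fst_conv
    by (rule transfer_linear_sum[OF cl(5)]) (use trimmed_bounds(4)[OF c] cl(6) in auto)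
  moreover have "(\<Sum>i=r..<n. fst (push s c) i * \<phi> (gathered s c i)) = (\<Sum>i=r..<n. trimmed s c i * \<phi> (gathered s c i))"
    by (intro sum.cong) (auto simp: push_def transfer_def)
  ultimately have "(\<Sum>i<n. fst (push s c) i * \<phi> (gathered s c i)) = (\<Sum>i<n. trimmed s c i * \<phi> (gathered s c i))"
    using sum_split[of "\<lambda>i. fst (push s c) i * \<phi> (gathered s c i)"]
      sum_split[of "\<lambda>i. trimmed s c i * \<phi> (gathered s c i)"] by linarith
  then show ?thesis by (simp add: wsum_def push_def)
qed

lemma push_configs:
  assumes c: "c \<in> sorted_configs" and s: "s \<le> 1"
  shows "push s c \<in> configs n k"
  unfolding configs_iff[OF n1]
proof (intro conjI allI impI)
  show "0 \<le> fst (push s c) i" for i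
    unfolding push_def fst_conv by (rule transfer_nonneg[OF trimmed_bounds(1)[OF c] clock_bounds(5,6)])
  show "fst (push s c) i = 0" if "n \<le> i" for i
    using that rn trimmed_bounds(3)[OF c] by (simp add: push_def transfer_def)
  show "(\<Sum>i<n. fst (push s c) i) = 1"
    using push_measure[OF c s, of "\<lambda>_. 1"] trimmed_bounds(5)[OF c] by (simp add: wsum_def)
  show "snd (push s c) i \<in> sphere_set k" for i
    using gathered_sphere[OF c] by (simp add: push_def)
qed

lemma push_0:
  assumes c: "c \<in> sorted_configs"
  shows "push 0 c = c"
proof -
  have e: "0 \<le> scale c" by (rule scale_bounds[OF c])
  have g: "0 \<le> gap r k (scale c) (snd c)" by (rule gap_nonneg[OF e])
  have 1: "clock1 0 c = 0" by (simp add: clock1_def unit_clamp_def)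
  have 2: "clock2 0 c = 0" unfolding clock2_def using g delay_nonneg[OF c]
    by (intro unit_clamp_le_0 divide_nonpos_nonneg) auto
  have 3: "clock3 0 c = 0" unfolding clock3_def using g delay_nonneg[OF c] by (simp add: unit_clamp_le_0)
  have "trim n r 0 (fst c) = fst c" by (rule trim_trivial[OF n1 sorted_configsD(7)[OF c]]) simp
  then show ?thesis
    unfolding push_def trimmed_def gathered_def 1 2 3
    using gather_zero[OF sorted_configsD(5)[OF c]] by simp
qed

section \<open>Formal sums collapsed before or at the current stage\<close>

lemma sorted_support:
  assumes c: "c \<in> sorted_configs"
  shows "card (support n c) \<le> j \<longleftrightarrow> fst c j = 0"
proof
  assume h: "card (support n c) \<le> j"
  show "fst c j = 0"
  proof (rule ccontr)
    assume nz: "fst c j \<noteq> 0"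
    then have "j < n" using sorted_configsD(3)[OF c] not_le by blast
    have "{..j} \<subseteq> support n c"
    proof
      fix i assume "i \<in> {..j}"
      then have "fst c j \<le> fst c i" using sorted_configsD(6)[OF c] by simp
      then have "fst c i \<noteq> 0" using nz sorted_configsD(2)[OF c, of j] by linarith
      then show "i \<in> support n c" using \<open>i \<in> {..j}\<close> \<open>j < n\<close> by (simp add: support_def)
    qed
    then have "card {..j} \<le> card (support n c)" by (intro card_mono) auto
    then show False using h by simp
  qed
next
  assume z: "fst c j = 0"
  have "support n c \<subseteq> {..<j}"
  proof
    fix i assume "i \<in> support n c"
    then have "fst c i \<noteq> 0" by (simp add: support_def)
    moreover have "fst c i = 0" if "j \<le> i"
      using sorted_configsD(6)[OF c that] sorted_configsD(2)[OF c, of i] z by simp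
    ultimately show "i \<in> {..<j}" using not_le by blast
  qed
  then have "card (support n c) \<le> card {..<j}" by (intro card_mono) auto
  then show "card (support n c) \<le> j" by simp
qed

lemma sorted_support_eq:
  assumes c: "c \<in> sorted_configs" and "fst c r = 0" "fst c (r - 1) \<noteq> 0"
  shows "support n c = {..<r}"
proof
  show "support n c \<subseteq> {..<r}"
  proof
    fix i assume i: "i \<in> support n c"
    have "fst c i = 0" if "r \<le> i"
      using sorted_configsD(6)[OF c that] sorted_configsD(2)[OF c, of i] assms by simp
    then show "i \<in> {..<r}" using i by (auto simp: support_def not_le[symmetric])
  qed
  show "{..<r} \<subseteq> support n c"
  proof
    fix i assume i: "i \<in> {..<r}"
    then have "fst c (r - 1) \<le> fst c i" using sorted_configsD(6)[OF c] by simp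
    then have "fst c i \<noteq> 0" using assms(3) sorted_configsD(2)[OF c, of "r - 1"] by linarith
    then show "i \<in> support n c" using i rn by (simp add: support_def)
  qed
qed

text \<open>Here \<open>fst c r\<close> and \<open>scale c\<close> are both 0, so nothing is trimmed
  and no later movement starts. As \<open>push\<close> fixes what has been collapsed before, it
  respects the finer relation.\<close>

lemma push_low:
  assumes c: "c \<in> sorted_configs" and low: "low n r (m - 1) c"
  shows "push s c = c"
proof -
  have r0: "fst c r = 0" using low sorted_support[OF c, of r] by (auto simp: low_def)
  have "scale c = 0"
  proof (cases "fst c (r - 1) = 0")
    case True
    then show ?thesis using r0 spread_nonneg[of r m k "snd c"] by (simp add: scale_def)
  next
    case False
    then have sup: "support n c = {..<r}" using sorted_support_eq[OF c r0] by simp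
    then have "card (snd c ` {..<r}) < m" using low m by (auto simp: low_def)
    then have "spread r m k (snd c) = 0" using spread_eq_0_iff[OF sorted_configsD(5)[OF c]] by simp
    then show ?thesis using r0 sorted_configsD(2)[OF c, of "r - 1"] by (simp add: scale_def)
  qed
  note E = this
  have tr: "trim n r \<sigma> (fst c) = fst c" for \<sigma>
    by (rule trim_trivial[OF n1 sorted_configsD(7)[OF c]]) (simp add: trim_amount_def r0)
  have ga: "gather r k 0 \<sigma> (snd c) = snd c" for \<sigma>
    unfolding fun_eq_iff gather_def by simp
  have c3: "clock3 s c = 0" unfolding clock3_def E by simp
  show ?thesis unfolding push_def trimmed_def gathered_def E c3 tr ga transfer_zero by simp
qed

text \<open>With exactly \<open>m\<close> positions, \<open>spread_le_sqd\<close> keeps distinct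
  ones at squared distance at least \<open>scale c\<close>, so \<open>gap\<close> is 0 and gathering
  is trivial. Only \<open>transfer\<close> acts, on coincident points, and by the pigeonhole
  principle some class loses a weight at time 1.\<close>

lemma push_stage:
  assumes c: "c \<in> sorted_configs" and low: "low n r m c" and nlow: "\<not> low n r (m - 1) c"
    and s: "0 \<le> s" "s \<le> 1"
  shows "same_measure n (push s c) c" "low n r m (push s c)" "low n r (m - 1) (push 1 c)"
proof -
  have r0: "fst c r = 0" using low sorted_support[OF c, of r] by (auto simp: low_def)
  have "\<not> card (support n c) \<le> r - 1" using nlow mr unfolding low_def by linarith
  then have r1: "fst c (r - 1) \<noteq> 0" using sorted_support[OF c] by simp
  have sup: "support n c = {..<r}" by (rule sorted_support_eq[OF c r0 r1])
  have cm: "card (snd c ` {..<r}) = m" using low nlow sup by (auto simp: low_def)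
  have x: "\<And>i. snd c i \<in> sphere_set k" by (rule sorted_configsD(5)[OF c])
  have "spread r m k (snd c) \<noteq> 0" using spread_eq_0_iff[OF x] cm by simp
  then have e: "0 < scale c"
    using spread_nonneg[of r m k "snd c"] r0 r1 sorted_configsD(2)[OF c, of "r - 1"] by (simp add: scale_def)
  have g: "gap r k (scale c) (snd c) = 0"
  proof -
    have "min (sqd k (snd c i) (snd c j)) (max 0 (scale c / 2 - sqd k (snd c i) (snd c j))) = 0" if "i < r" "j < r" for i j
    proof (cases "snd c i = snd c j")
      case True
      then show ?thesis by simp
    next
      case False
      have "scale c \<le> sqd k (snd c i) (snd c j)"
        using spread_le_sqd[OF x _ that False, of m] cm by (simp add: scale_def min_le_iff_disj)
      then show ?thesis using e by simp
    qed
    then show ?thesis unfolding gap_def by simp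
  qed
  have tr: "trim n r \<sigma> (fst c) = fst c" for \<sigma>
    by (rule trim_trivial[OF n1 sorted_configsD(7)[OF c]]) (simp add: trim_amount_def r0)
  have push: "push s c = (transfer r (near k (scale c) (snd c)) s (fst c), snd c)" if "0 \<le> s" "s \<le> 1" for s
    unfolding push_def trimmed_def tr gathered_def
    using gather_trivial[OF e g x clock_bounds(3,4)] e g that by (simp add: clock3_def delay_def r0 unit_clamp_id fun_eq_iff)
  have tg: "trimmed s c i = fst c i" "gathered s c i = snd c i" for i
    unfolding trimmed_def gathered_def tr using gather_trivial[OF e g x clock_bounds(3,4)] by simp_all
  have "wsum n (push s c) (\<lambda>a y. a * \<phi> y) = wsum n c (\<lambda>a y. a * \<phi> y)" for \<phi>
    using push_measure[OF c s(2), of \<phi>] unfolding tg wsum_def[of n c] .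
  then show "same_measure n (push s c) c" by (simp add: same_measure_def)
  have z: "fst c i = 0" if "r \<le> i" for i
    using sorted_configsD(6)[OF c that] sorted_configsD(2)[OF c, of i] r0 by simp
  have sub: "support n (push s c) \<subseteq> {..<r}"
    unfolding push[OF s] using z by (auto simp: support_def transfer_def split: if_splits)
  then have "card (support n (push s c)) \<le> card {..<r}" by (intro card_mono) auto
  moreover have "card (snd (push s c) ` support n (push s c)) \<le> card (snd c ` {..<r})"
    using sub unfolding push[OF s] snd_conv by (intro card_mono) auto
  ultimately show "low n r m (push s c)" using cm by (simp add: low_def)
  have "\<not> inj_on (snd c) {..<r}" using card_image[of "snd c" "{..<r}"] cm mr by auto
  then obtain i j where "i < r" "j < r" "i \<noteq> j" "snd c i = snd c j" by (auto simp: inj_on_def)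
  then obtain i j where ij: "i < j" "j < r" "snd c i = snd c j" by (metis nat_neq_iff)
  have "near k (scale c) (snd c) i j" using ij e by (simp add: near_def)
  then have "card (support n (transfer r (near k (scale c) (snd c)) 1 (fst c), snd c)) < r"
    using near_equiv[OF e, of r k "snd c"] g ij z rn by (intro transfer_support_less) auto
  then show "low n r (m - 1) (push 1 c)" using push[of 1] by (simp add: low_def)
qed

end

text \<open>Limits pass only through continuous test functions; interpolation at the finitely many
  positions gives all the others.\<close>

lemma same_measure_of_continuous:
  assumes "\<And>g. continuous_on UNIV g \<Longrightarrow> wsum n c (\<lambda>a y. a * g y) = wsum n c' (\<lambda>a y. a * g y)"
  shows "same_measure n c c'"
  unfolding same_measure_def
proof
  fix \<phi> :: "(nat \<Rightarrow> real) \<Rightarrow> real"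
  have "finite (snd c ` {..<n} \<union> snd c' ` {..<n})" by simp
  then obtain g where g: "continuous_on UNIV g" "\<And>y. y \<in> snd c ` {..<n} \<union> snd c' ` {..<n} \<Longrightarrow> g y = \<phi> y"
    by (rule finite_continuous_interpolation[where G = \<phi>]) (rule that)
  have "wsum n d (\<lambda>a y. a * \<phi> y) = wsum n d (\<lambda>a y. a * g y)" if "d = c \<or> d = c'" for d
    unfolding wsum_def using that g(2) by (intro sum.cong) auto
  then show "wsum n c (\<lambda>a y. a * \<phi> y) = wsum n c' (\<lambda>a y. a * \<phi> y)"
    using assms[OF g(1)] by simp
qed

section \<open>Symmetry and continuity of the deformation\<close>

context stage
begin

text \<open>Equal weights can be sorted in several ways, so the two configurations differ by a
  permutation \<open>p\<close> that preserves weights. If weights \<open>r - 1\<close> and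
  \<open>r\<close> differ, \<open>p\<close> preserves the first \<open>r\<close> indices, and every
  ingredient of \<open>push\<close> is compatible with permutations of these.\<close>

lemma push_equivariant:
  assumes c: "c \<in> sorted_configs" and c': "c' \<in> sorted_configs" and ss: "same_sum n c c'" and s: "s \<le> 1"
  shows "same_sum n (push s c) (push s c')"
proof -
  obtain p where p: "p permutes {..<n}"
    and pc: "\<forall>i<n. fst c' i = fst c (p i) \<and> (fst c' i \<noteq> 0 \<longrightarrow> snd c' i = snd c (p i))"
    using same_sum_permD[OF ss] by (elim exE conjE) (rule that)
  have tn: "fst c' i = fst c i" if "i < n" for i
  proof (rule antitone_perm_eq[OF p _ _ _ that])
    show "fst c' i = fst c (p i)" if "i < n" for i using pc that by blast
  qed (rule sorted_configsD(6)[OF c] sorted_configsD(6)[OF c'], assumption)+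
  have t: "fst c' = fst c"
  proof
    fix i show "fst c' i = fst c i"
      using tn[of i] sorted_configsD(3)[OF c, of i] sorted_configsD(3)[OF c', of i] by (cases "i < n") auto
  qed
  have tp: "fst c (p i) = fst c i" if "i < n" for i using pc tn that by simp
  have xp: "snd c' i = snd c (p i)" if "i < n" "fst c i \<noteq> 0" for i using pc t that by simp
  have pn: "p i < n \<longleftrightarrow> i < n" for i using permutes_in_image[OF p, of i] by simp
  have trim: "trimmed s c' = trimmed s c"
    by (simp add: trimmed_def clock1_def delay_def t)
  have trp: "trimmed s c (p i) = trimmed s c i" if "i < n" for i
    using tp[OF that] by (simp add: trimmed_def trim_def)
  have trz: "trimmed s c i = 0" if "fst c i = 0" for i
    unfolding trimmed_def by (rule trim_of_zero[where t = "fst c", OF n1 sorted_configsD(2)[OF c] clock_bounds(1) that])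
  show ?thesis
  proof (cases "fst c (r - 1) = fst c r")
    \<comment> \<open>Now \<open>p\<close> may mix indices below and above \<open>r\<close>, but
      \<open>scale\<close> is 0 and only trimming is left, which depends on the weights
      alone.\<close>
    case True
    have E: "scale c = 0" "scale c' = 0"
      using True spread_nonneg[of r m k "snd c"] spread_nonneg[of r m k "snd c'"] t by (simp_all add: scale_def)
    have P: "push s d = (trimmed s d, snd d)" if "scale d = 0" for d
      using that by (simp add: push_def clock3_def gathered_def gather_def[abs_def])
    show ?thesis
    proof (rule same_sum_permI[OF p])
      fix i assume i: "i < n"
      show "fst (push s c') i = fst (push s c) (p i)" using trp[OF i] trim by (simp add: P E)
      assume "fst (push s c') i \<noteq> 0"
      then show "snd (push s c') i = snd (push s c) (p i)" using trz[of i] xp[OF i] trim by (auto simp: P E)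
    qed
  next
    case False
    then have gt: "fst c r < fst c (r - 1)" using sorted_configsD(6)[OF c, of "r - 1" r] by simp
    have big: "i < r \<longleftrightarrow> fst c r < fst c i" for i
    proof
      assume "i < r"
      then have "i \<le> r - 1" by simp
      then show "fst c r < fst c i" using sorted_configsD(6)[OF c, of i "r - 1"] gt by linarith
    next
      assume "fst c r < fst c i"
      then show "i < r" using sorted_configsD(6)[OF c, of r i] by (meson not_le)
    qed
    have pr: "p i < r \<longleftrightarrow> i < r" if "i < n" for i using tp[OF that] by (simp add: big)
    have inj: "inj p" using p by (rule permutes_inj)
    have bij1: "bij_betw p {..<r} {..<r}"
      using pr rn inj by (intro endo_inj_surj[THEN bij_betw_imageI[rotated]]) (auto intro: inj_on_subset)
    have bij2: "bij_betw p {r..<n} {r..<n}"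
      using pr pn inj by (intro endo_inj_surj[THEN bij_betw_imageI[rotated]]) (auto simp: not_less[symmetric] intro: inj_on_subset)
    have xr: "snd c' i = snd c (p i)" if "i < r" for i
    proof -
      have "0 < fst c i" using that sorted_configsD(2)[OF c, of r] by (simp add: big)
      then show ?thesis using xp[of i] that rn by simp
    qed
    have E: "scale c' = scale c"
      using spread_perm[where x' = "snd c'" and x = "snd c" and m = m and k = k, OF bij1 xr] t by (simp add: scale_def)
    have gp: "gap r k (scale c') (snd c') = gap r k (scale c) (snd c)"
      unfolding E by (rule gather_perm(2)[where x' = "snd c'" and x = "snd c", OF bij1 xr])
    have c2: "clock2 s c' = clock2 s c" and c3: "clock3 s c' = clock3 s c"
      unfolding clock2_def clock3_def delay_def t E gp[unfolded E] by simp_all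
    have gr: "gathered s c' i = gathered s c (p i)" if "i < r" for i
      unfolding gathered_def E c2 by (rule gather_perm(1)[where x' = "snd c'" and x = "snd c", OF bij1 xr that])
    have gn: "gathered s c' i = gathered s c (p i)" if "r \<le> i" "i < n" "fst c i \<noteq> 0" for i
      unfolding gathered_def gather_def using pr[OF that(2)] xp[OF that(2,3)] that by simp
    show ?thesis
      unfolding same_sum_def
    proof (intro allI impI)
      fix \<Psi> :: "real \<Rightarrow> (nat \<Rightarrow> real) \<Rightarrow> real" assume z: "\<forall>y. \<Psi> 0 y = 0"
      let ?F = "\<lambda>c i. \<Psi> (fst (push s c) i) (snd (push s c) i)"
      have "(\<Sum>i=r..<n. ?F c' i) = (\<Sum>i=r..<n. ?F c (p i))"
      proof (rule sum.cong[OF refl])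
        fix i assume i: "i \<in> {r..<n}"
        have 1: "fst (push s c') i = trimmed s c i" "fst (push s c) (p i) = trimmed s c i"
          using i pr[of i] trp[of i] by (simp_all add: push_def transfer_def trim)
        show "?F c' i = ?F c (p i)"
        proof (cases "fst c i = 0")
          case True then show ?thesis unfolding 1 using trz[OF True] z by simp
        next
          case False then show ?thesis unfolding 1 using gn[OF _ _ False] i by (simp add: push_def)
        qed
      qed
      also have "\<dots> = (\<Sum>i=r..<n. ?F c i)" by (rule sum.reindex_bij_betw[OF bij2])
      finally have hi: "(\<Sum>i=r..<n. ?F c' i) = (\<Sum>i=r..<n. ?F c i)" .
      have lo: "(\<Sum>i<r. ?F c' i) = (\<Sum>i<r. ?F c i)"
      proof (cases "clock3 s c = 0")
        case True
        have "(\<Sum>i<r. ?F c' i) = (\<Sum>i<r. ?F c (p i))"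
          using trp gr rn by (intro sum.cong refl) (simp add: push_def c3 True trim)
        also have "\<dots> = (\<Sum>i<r. ?F c i)" by (rule sum.reindex_bij_betw[OF bij1])
        finally show ?thesis .
      next
        case False
        note cl = clock3_pos[OF c s False]
        have False': "clock3 s c' \<noteq> 0" using False c3 by simp
        note cl' = clock3_pos[OF c' s False']
        have "(\<Sum>i<r. \<Psi> (transfer r (near k (scale c') (snd c')) (clock3 s c) (trimmed s c) i) (gathered s c' i)) =
          (\<Sum>i<r. \<Psi> (transfer r (near k (scale c) (snd c)) (clock3 s c) (trimmed s c) i) (gathered s c i))"
        proof (rule transfer_reindex_sum[where y = "gathered s c" and y' = "gathered s c'" and t = "trimmed s c" and \<Psi> = \<Psi>, OF cl(5) cl'(5) bij1])
          show "trimmed s c j \<le> trimmed s c i" if "i \<le> j" for i j by (rule trimmed_bounds(4)[OF c that])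
          show "trimmed s c (p i) = trimmed s c i" if "i < r" for i using trp that rn by simp
          show "near k (scale c') (snd c') i j = near k (scale c) (snd c) (p i) (p j)" if "i < r" "j < r" for i j
            unfolding E by (rule gather_perm(3)[where x' = "snd c'" and x = "snd c", OF bij1 xr that])
          show "gathered s c j = gathered s c i" if "i < r" "j < r" "near k (scale c) (snd c) i j" for i j
            by (rule cl(6)[OF that])
          show "gathered s c' i = gathered s c (p i)" if "i < r" for i by (rule gr[OF that])
        qed
        then show ?thesis by (simp add: push_def c3 trim)
      qed
      show "wsum n (push s c) \<Psi> = wsum n (push s c') \<Psi>"
        using hi lo sum_split[of "?F c"] sum_split[of "?F c'"] by (simp add: wsum_def)
    qed
  qed
qed

text \<open>\<open>clock1\<close> may jump where weight \<open>r\<close> vanishes, but there the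
  amount to be trimmed tends to 0 and absorbs the jump.\<close>

lemma trimmed_tendsto:
  assumes cs: "\<And>j. cs j \<in> sorted_configs" and c: "c \<in> sorted_configs" and lim: "cs \<longlonglongrightarrow> c" and ss: "ss \<longlonglongrightarrow> s"
  shows "(\<lambda>j. trimmed (ss j) (cs j)) \<longlonglongrightarrow> trimmed s c"
proof -
  have tl: "(\<lambda>j. fst (cs j)) \<longlonglongrightarrow> fst c" using lim by (rule tendsto_fst)
  have al: "(\<lambda>j. trim_amount n r (fst (cs j))) \<longlonglongrightarrow> trim_amount n r (fst c)" by (rule tendsto_trim_amount[OF tl])
  have "(\<lambda>j. clock1 (ss j) (cs j) * trim_amount n r (fst (cs j))) \<longlonglongrightarrow> clock1 s c * trim_amount n r (fst c)"
  proof (cases "fst c r = 0")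
    case True
    then have a0: "trim_amount n r (fst c) = 0" by (simp add: trim_amount_def)
    show ?thesis
    proof (rule tendsto_sandwich[of "\<lambda>_. 0" _ sequentially "\<lambda>j. trim_amount n r (fst (cs j))"])
      have nn: "0 \<le> trim_amount n r (fst (cs j))" for j
        by (rule trim_amount_bounds(1)[OF n1 sorted_configsD(2)[OF cs]])
      show "\<forall>\<^sub>F j in sequentially. 0 \<le> clock1 (ss j) (cs j) * trim_amount n r (fst (cs j))"
        using nn clock_bounds(1) by (intro always_eventually allI mult_nonneg_nonneg) 
      show "\<forall>\<^sub>F j in sequentially. clock1 (ss j) (cs j) * trim_amount n r (fst (cs j)) \<le> trim_amount n r (fst (cs j))"
        using nn clock_bounds(1,2) by (intro always_eventually allI mult_left_le_one_le)
    qed (use al in \<open>simp_all add: a0\<close>)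
  next
    case False
    then have "delay c \<noteq> 0" using n1 by (simp add: delay_def)
    moreover have "(\<lambda>j. delay (cs j)) \<longlonglongrightarrow> delay c"
      unfolding delay_def by (intro tendsto_intros tendsto_component[OF tl])
    ultimately have "(\<lambda>j. clock1 (ss j) (cs j)) \<longlonglongrightarrow> clock1 s c"
      unfolding clock1_def by (intro tendsto_unit_clamp tendsto_divide ss)
    then show ?thesis using al by (rule tendsto_mult)
  qed
  then show ?thesis
    unfolding trimmed_def by (rule tendsto_trim[OF n1 sorted_configsD(7)[OF c] tl _ clock_bounds(1,2)])
qed

lemma scale_tendsto:
  assumes "cs \<longlonglongrightarrow> c" shows "(\<lambda>j. scale (cs j)) \<longlonglongrightarrow> scale c"
  unfolding scale_def
  by (intro tendsto_min tendsto_diff tendsto_spread tendsto_component[OF tendsto_fst[OF assms]] tendsto_snd[OF assms])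

lemma delay_tendsto:
  assumes "cs \<longlonglongrightarrow> c" shows "(\<lambda>j. delay (cs j)) \<longlonglongrightarrow> delay c"
  unfolding delay_def by (intro tendsto_intros tendsto_component[OF tendsto_fst[OF assms]])

text \<open>Where \<open>gap\<close> tends to 0, \<open>clock2\<close> may have a limit other than
  its value at \<open>c\<close>. This is harmless: with \<open>gap\<close> equal to 0, gathering is
  trivial whatever the clock shows.\<close>

lemma gathered_tendsto:
  assumes cs: "\<And>j. cs j \<in> sorted_configs" and c: "c \<in> sorted_configs" and lim: "cs \<longlonglongrightarrow> c" and ss: "ss \<longlonglongrightarrow> s"
    and cl: "(\<lambda>j. clock2 (ss j) (cs j)) \<longlonglongrightarrow> \<tau>"
  shows "(\<lambda>j. gathered (ss j) (cs j)) \<longlonglongrightarrow> gathered s c"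
proof -
  have xl: "(\<lambda>j. snd (cs j)) \<longlonglongrightarrow> snd c" using lim by (rule tendsto_snd)
  have el: "(\<lambda>j. scale (cs j)) \<longlonglongrightarrow> scale c" by (rule scale_tendsto[OF lim])
  have g: "(\<lambda>j. gathered (ss j) (cs j)) \<longlonglongrightarrow> gather r k (scale c) \<tau> (snd c)"
    unfolding gathered_def
    by (rule gather_tendsto[OF sorted_configsD(5)[OF cs] sorted_configsD(5)[OF c] xl scale_bounds[OF cs] el clock_bounds(3,4) cl])
  have tau: "0 \<le> \<tau>" "\<tau> \<le> 1"
    using LIMSEQ_le_const[OF cl, of 0] LIMSEQ_le_const2[OF cl, of 1] clock_bounds by auto
  have "gather r k (scale c) \<tau> (snd c) = gathered s c"
  proof (cases "scale c = 0")
    case True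
    then show ?thesis by (simp add: gathered_def gather_def[abs_def])
  next
    case False
    then have e: "0 < scale c" using scale_bounds[OF c] by simp
    show ?thesis
    proof (cases "gap r k (scale c) (snd c) = 0")
      case True
      show ?thesis unfolding gathered_def fun_eq_iff
        using gather_trivial[OF e True sorted_configsD(5)[OF c]] tau clock_bounds(3,4) by simp
    next
      case False
      have "(\<lambda>j. gap r k (scale (cs j)) (snd (cs j))) \<longlonglongrightarrow> gap r k (scale c) (snd c)"
        using e by (intro tendsto_gap xl el) simp
      then have "(\<lambda>j. clock2 (ss j) (cs j)) \<longlonglongrightarrow> clock2 s c"
        unfolding clock2_def using False by (intro tendsto_unit_clamp tendsto_divide tendsto_diff ss delay_tendsto lim)
      then have "\<tau> = clock2 s c" using cl LIMSEQ_unique by blast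
      then show ?thesis by (simp add: gathered_def)
    qed
  qed
  then show ?thesis using g by simp
qed

text \<open>\<open>transfer\<close> changes a weight by at most the clock value, so the clusters may
  vary arbitrarily along the sequence as long as that value tends to 0.\<close>

lemma push_tendsto_of_clock3:
  assumes cs: "\<And>j. cs j \<in> sorted_configs" and T: "(\<lambda>j. trimmed (ss j) (cs j)) \<longlonglongrightarrow> T"
    and cl: "(\<lambda>j. clock3 (ss j) (cs j)) \<longlonglongrightarrow> 0"
  shows "(\<lambda>j. fst (push (ss j) (cs j))) \<longlonglongrightarrow> T"
  unfolding tendsto_fun_iff
proof
  fix i
  have "(\<lambda>j. fst (push (ss j) (cs j)) i - trimmed (ss j) (cs j) i) \<longlonglongrightarrow> 0"
  proof (rule tendsto_rabs_zero_cancel, rule tendsto_sandwich[of "\<lambda>_. 0" _ sequentially "\<lambda>j. clock3 (ss j) (cs j)"])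
    show "\<forall>\<^sub>F j in sequentially. \<bar>fst (push (ss j) (cs j)) i - trimmed (ss j) (cs j) i\<bar> \<le> clock3 (ss j) (cs j)"
      unfolding push_def fst_conv
      by (intro always_eventually allI transfer_close trimmed_bounds(1,2)[OF cs] clock_bounds)
  qed (use cl in simp_all)
  from tendsto_add[OF this tendsto_component[OF T, of i]]
  show "(\<lambda>j. fst (push (ss j) (cs j)) i) \<longlonglongrightarrow> T i" by simp
qed

text \<open>By \<open>gap_dichotomy\<close> no pair lies on the threshold of \<open>near\<close>, so
  a strict inequality at the limit decides each pair nearby.\<close>

lemma near_eventually:
  assumes lim: "cs \<longlonglongrightarrow> c" and e: "0 < scale c" and g: "gap r k (scale c) (snd c) < 1"
  shows "\<forall>\<^sub>F j in sequentially. \<forall>a<r. \<forall>b<r. near k (scale (cs j)) (snd (cs j)) a b \<longleftrightarrow> near k (scale c) (snd c) a b"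
proof -
  have "\<forall>\<^sub>F j in sequentially. near k (scale (cs j)) (snd (cs j)) a b \<longleftrightarrow> near k (scale c) (snd c) a b"
    if ab: "a < r" "b < r" for a b
  proof -
    have d: "(\<lambda>j. sqd k (snd (cs j) a) (snd (cs j) b) - scale (cs j) / 4) \<longlonglongrightarrow> sqd k (snd c a) (snd c b) - scale c / 4"
      by (intro tendsto_intros tendsto_component[OF tendsto_snd[OF lim]] scale_tendsto[OF lim]) simp
    show ?thesis
    proof (cases "near k (scale c) (snd c) a b")
      case True
      then have "sqd k (snd c a) (snd c b) - scale c / 4 < 0" by (simp add: near_def)
      from order_tendstoD(2)[OF d this] show ?thesis
        by (rule eventually_mono) (use True in \<open>simp add: near_def\<close>)
    next
      case False
      then have "0 < sqd k (snd c a) (snd c b) - scale c / 4"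
        using gap_dichotomy[OF e g ab] e by (auto simp: near_def)
      from order_tendstoD(1)[OF d this] show ?thesis
        by (rule eventually_mono) (use False in \<open>simp add: near_def\<close>)
    qed
  qed
  then have "\<forall>\<^sub>F j in sequentially. \<forall>b\<in>{..<r}. near k (scale (cs j)) (snd (cs j)) a b \<longleftrightarrow> near k (scale c) (snd c) a b"
    if "a < r" for a
    using that by (intro eventually_ball_finite) auto
  then have "\<forall>\<^sub>F j in sequentially. \<forall>a\<in>{..<r}. \<forall>b\<in>{..<r}. near k (scale (cs j)) (snd (cs j)) a b \<longleftrightarrow> near k (scale c) (snd c) a b"
    by (intro eventually_ball_finite) auto
  then show ?thesis by (rule eventually_mono) auto
qed

text \<open>For positive \<open>scale c\<close> all ingredients converge. For
  \<open>scale c = 0\<close> the clusters have no limit; but either the third clock tends to 0, or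
  trimming is over, and then \<open>w\<close> and \<open>push s c\<close> are both low and have the
  same measure, which suffices for \<open>stage_rel\<close>.\<close>

lemma push_cluster_point:
  assumes cs: "\<And>j. cs j \<in> sorted_configs" and c: "c \<in> sorted_configs" and lim: "cs \<longlonglongrightarrow> c"
    and s01: "\<And>j. ss j \<le> 1" "s \<le> 1" and ss: "ss \<longlonglongrightarrow> s"
    and w: "(\<lambda>j. push (ss j) (cs j)) \<longlonglongrightarrow> w"
    and cl2: "(\<lambda>j. clock2 (ss j) (cs j)) \<longlonglongrightarrow> \<tau>"
  shows "stage_rel n r (m - 1) w (push s c)"
proof -
  let ?T = "trimmed s c" and ?X = "gathered s c"
  have T: "(\<lambda>j. trimmed (ss j) (cs j)) \<longlonglongrightarrow> ?T" by (rule trimmed_tendsto[OF cs c lim ss])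
  have X: "(\<lambda>j. gathered (ss j) (cs j)) \<longlonglongrightarrow> ?X" by (rule gathered_tendsto[OF cs c lim ss cl2])
  have w1: "(\<lambda>j. fst (push (ss j) (cs j))) \<longlonglongrightarrow> fst w" using w by (rule tendsto_fst)
  have w2: "snd w = ?X"
    using LIMSEQ_unique[OF tendsto_snd[OF w]] X by (simp add: push_def)
  have dl: "(\<lambda>j. delay (cs j)) \<longlonglongrightarrow> delay c" by (rule delay_tendsto[OF lim])
  have el: "(\<lambda>j. scale (cs j)) \<longlonglongrightarrow> scale c" by (rule scale_tendsto[OF lim])
  have w_of_0: "w = (?T, ?X)" if "(\<lambda>j. clock3 (ss j) (cs j)) \<longlonglongrightarrow> 0"
    using LIMSEQ_unique[OF w1 push_tendsto_of_clock3[OF cs T that]] w2 by (simp add: prod_eq_iff)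
  show ?thesis
  proof (cases "0 < scale c")
    case True
    have gl: "(\<lambda>j. gap r k (scale (cs j)) (snd (cs j))) \<longlonglongrightarrow> gap r k (scale c) (snd c)"
      using True by (intro tendsto_gap tendsto_snd[OF lim] el) simp
    have "(\<lambda>j. unit_clamp (ss j - delay (cs j) - gap r k (scale (cs j)) (snd (cs j)))) \<longlonglongrightarrow> clock3 s c"
      using True unfolding clock3_def by (simp add: not_le) (intro tendsto_unit_clamp tendsto_diff ss dl gl)
    moreover have "\<forall>\<^sub>F j in sequentially. unit_clamp (ss j - delay (cs j) - gap r k (scale (cs j)) (snd (cs j))) = clock3 (ss j) (cs j)"
      using order_tendstoD(1)[OF el True] by (rule eventually_mono) (simp add: clock3_def)
    ultimately have c3: "(\<lambda>j. clock3 (ss j) (cs j)) \<longlonglongrightarrow> clock3 s c"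
      by (rule Lim_transform_eventually)
    have "w = push s c"
    proof (cases "clock3 s c = 0")
      case True
      then show ?thesis using w_of_0 c3 by (simp add: push_def)
    next
      case False
      note cl = clock3_pos[OF c s01(2) False]
      let ?R = "near k (scale c) (snd c)"
      have ev: "\<forall>\<^sub>F j in sequentially. transfer r ?R (clock3 (ss j) (cs j)) (trimmed (ss j) (cs j)) = fst (push (ss j) (cs j))"
        using near_eventually[OF lim cl(1,2)]
      proof (rule eventually_mono)
        fix j assume "\<forall>a<r. \<forall>b<r. near k (scale (cs j)) (snd (cs j)) a b \<longleftrightarrow> ?R a b"
        then show "transfer r ?R (clock3 (ss j) (cs j)) (trimmed (ss j) (cs j)) = fst (push (ss j) (cs j))"
          unfolding push_def fst_conv by (intro transfer_cong) simp
      qed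
      have "(\<lambda>j. transfer r ?R (clock3 (ss j) (cs j)) (trimmed (ss j) (cs j))) \<longlonglongrightarrow> transfer r ?R (clock3 s c) ?T"
        unfolding tendsto_fun_iff
      proof
        fix i
        have If: "(\<lambda>j. if P then f j else 0) \<longlonglongrightarrow> (if P then a else 0)" if "f \<longlonglongrightarrow> a" for P and f :: "nat \<Rightarrow> real" and a
          using that by simp
        show "(\<lambda>j. transfer r ?R (clock3 (ss j) (cs j)) (trimmed (ss j) (cs j)) i) \<longlonglongrightarrow> transfer r ?R (clock3 s c) ?T i"
        proof (cases "i < r")
          case True
          then show ?thesis
            unfolding transfer_def if_P[OF True]
            by (intro tendsto_add tendsto_mult tendsto_diff If c3 tendsto_component[OF T])
        next
          case False
          then show ?thesis using tendsto_component[OF T, of i] by (simp add: transfer_def)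
        qed
      qed
      from Lim_transform_eventually[OF this ev]
      have "fst w = transfer r ?R (clock3 s c) ?T" using LIMSEQ_unique[OF w1] by blast
      then show ?thesis using w2 by (simp add: push_def prod_eq_iff)
    qed
    then show ?thesis by (simp add: stage_rel_refl)
  next
    case False
    then have E: "scale c = 0" using scale_bounds[OF c] by simp
    have push: "push s c = (?T, ?X)" by (simp add: push_def clock3_def E)
    show ?thesis
    proof (cases "s \<le> delay c")
      \<comment> \<open>At the limit the time for trimming is not yet exceeded, so the third clock
        tends to 0 whatever \<open>gap\<close> does along the sequence.\<close>
      case True
      have "(\<lambda>j. clock3 (ss j) (cs j)) \<longlonglongrightarrow> 0"
      proof (rule tendsto_sandwich[of "\<lambda>_. 0" _ sequentially "\<lambda>j. unit_clamp (ss j - delay (cs j))"])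
        have "clock3 (ss j) (cs j) \<le> unit_clamp (ss j - delay (cs j))" for j
          using gap_nonneg[OF scale_bounds(1)[OF cs[of j]], of r k "snd (cs j)"] by (auto simp: clock3_def unit_clamp_def)
        then show "\<forall>\<^sub>F j in sequentially. clock3 (ss j) (cs j) \<le> unit_clamp (ss j - delay (cs j))"
          by (intro always_eventually allI)
        show "(\<lambda>j. unit_clamp (ss j - delay (cs j))) \<longlonglongrightarrow> 0"
          using tendsto_unit_clamp[OF tendsto_diff[OF ss dl]] unit_clamp_le_0[of "s - delay c"] True by simp
        show "\<forall>\<^sub>F j in sequentially. 0 \<le> clock3 (ss j) (cs j)"
          by (intro always_eventually allI clock_bounds)
      qed simp
      from w_of_0[OF this] show ?thesis by (simp add: push stage_rel_refl)
    next
      case False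
      \<comment> \<open>Trimming is complete here: as \<open>delay c < s \<le> 1\<close>, the cap is
        inactive and the first clock has run out.\<close>
      have T0: "?T i = 0" if "fst c i \<le> fst c r" for i
      proof (cases "fst c r = 0")
        case True
        then have "fst c i = 0" using that sorted_configsD(2)[OF c, of i] by simp
        then show ?thesis unfolding trimmed_def
          by (rule trim_of_zero[where t = "fst c", OF n1 sorted_configsD(2)[OF c] clock_bounds(1)])
      next
        case False': False
        then have d: "0 < delay c" using sorted_configsD(2)[OF c, of r] n1 by (simp add: delay_def)
        then have "clock1 s c = 1" using False by (simp add: clock1_def unit_clamp_ge_1)
        moreover have "4 * real n * fst c r < 1" using False s01(2) by (simp add: delay_def)
        ultimately show ?thesis
          unfolding trimmed_def using trim_zero[OF n1 sorted_configsD(7)[OF c] that] by simp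
      qed
      have Tr: "?T i = 0" if "r \<le> i" for i by (rule T0[OF sorted_configsD(6)[OF c that]])
      have wr: "fst w i = 0" if "r \<le> i" for i
      proof -
        have "(\<lambda>j. fst (push (ss j) (cs j)) i) \<longlonglongrightarrow> ?T i"
          using tendsto_component[OF T, of i] that by (simp add: push_def transfer_def)
        then show ?thesis using LIMSEQ_unique[OF tendsto_component[OF w1, of i]] Tr[OF that] by simp
      qed
      \<comment> \<open>Index \<open>r - 1\<close> never gains from \<open>transfer\<close>, so its
        weight is squeezed to 0.\<close>
      have wlast: "fst w (r - 1) = 0" if "?T (r - 1) = 0"
      proof -
        have "(\<lambda>j. fst (push (ss j) (cs j)) (r - 1)) \<longlonglongrightarrow> 0"
        proof (rule tendsto_sandwich[of "\<lambda>_. 0" _ sequentially "\<lambda>j. trimmed (ss j) (cs j) (r - 1)"])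
          have "0 \<le> fst (push (ss j) (cs j)) (r - 1)" for j
            unfolding push_def fst_conv by (rule transfer_nonneg[OF trimmed_bounds(1)[OF cs] clock_bounds(5,6)])
          then show "\<forall>\<^sub>F j in sequentially. 0 \<le> fst (push (ss j) (cs j)) (r - 1)" by (intro always_eventually allI)
          have "fst (push (ss j) (cs j)) (r - 1) \<le> trimmed (ss j) (cs j) (r - 1)" for j
          proof (cases "0 < scale (cs j)")
            case True
            show ?thesis
              unfolding push_def fst_conv
            proof (rule transfer_last_le[OF _ _ _ trimmed_bounds(1)[OF cs] clock_bounds(5)])
              show "near k (scale (cs j)) (snd (cs j)) (r - 1) (r - 1)" using True by (simp add: near_def)
              show "near k (scale (cs j)) (snd (cs j)) b (r - 1)" if "near k (scale (cs j)) (snd (cs j)) (r - 1) b" for b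
                using that by (simp add: near_def sqd_commute)
              show "1 \<le> r" using mr by simp
            qed
          next
            case False
            then show ?thesis by (simp add: push_def clock3_def)
          qed
          then show "\<forall>\<^sub>F j in sequentially. fst (push (ss j) (cs j)) (r - 1) \<le> trimmed (ss j) (cs j) (r - 1)"
            by (intro always_eventually allI)
          show "(\<lambda>j. trimmed (ss j) (cs j) (r - 1)) \<longlonglongrightarrow> 0" using tendsto_component[OF T, of "r - 1"] that by simp
        qed simp
        then show ?thesis using LIMSEQ_unique[OF tendsto_component[OF w1, of "r - 1"]] by simp
      qed
      have Xc: "?X = snd c" by (simp add: gathered_def E gather_def[abs_def])
      \<comment> \<open>There are two reasons for \<open>scale c = 0\<close>. If weights
        \<open>r - 1\<close> and \<open>r\<close> agree, both have been trimmed away and fewer than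
        \<open>r\<close> weights remain; otherwise there are fewer than \<open>m\<close>
        positions.\<close>
      have low: "low n r (m - 1) d" if d: "\<And>i. r \<le> i \<Longrightarrow> fst d i = 0" "?T (r - 1) = 0 \<Longrightarrow> fst d (r - 1) = 0" "snd d = ?X" for d
      proof (cases "fst c (r - 1) = fst c r")
        case True
        have z: "fst d i = 0" if "r - 1 \<le> i" for i
        proof (cases "i = r - 1")
          case i: True
          have "?T (r - 1) = 0" by (rule T0) (simp only: True order_refl)
          then show ?thesis using d(2) i by simp
        next
          case False
          then have "r \<le> i" using that by linarith
          then show ?thesis by (rule d(1))
        qed
        have "support n d \<subseteq> {..<r - 1}"
        proof
          fix i assume "i \<in> support n d"
          then have "fst d i \<noteq> 0" by (simp add: support_def)
          then show "i \<in> {..<r - 1}" using z[of i] by (auto simp: not_le[symmetric])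
        qed
        then have "card (support n d) \<le> card {..<r - 1}" by (intro card_mono) auto
        then have "card (support n d) < r" using mr by simp
        then show ?thesis by (simp add: low_def)
      next
        case False
        then have "fst c r < fst c (r - 1)" using sorted_configsD(6)[OF c, of "r - 1" r] by simp
        then have "spread r m k (snd c) = 0" using E spread_nonneg[of r m k "snd c"] by (auto simp: scale_def min_def split: if_splits)
        then have cx: "card (snd c ` {..<r}) < m" using spread_eq_0_iff[OF sorted_configsD(5)[OF c]] by simp
        have sub: "support n d \<subseteq> {..<r}"
        proof
          fix i assume "i \<in> support n d"
          then have "fst d i \<noteq> 0" by (simp add: support_def)
          then show "i \<in> {..<r}" using d(1)[of i] by (auto simp: not_le[symmetric])
        qed
        then have "card (support n d) \<le> card {..<r}" by (intro card_mono) auto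
        moreover have "card (snd d ` support n d) \<le> card (snd c ` {..<r})"
          unfolding d(3) Xc using sub by (intro card_mono) auto
        ultimately show ?thesis using cx unfolding low_def card_lessThan by arith
      qed
      have lw: "low n r (m - 1) w" by (rule low[OF wr wlast w2])
      have lp: "low n r (m - 1) (push s c)" by (rule low) (simp_all add: push Tr)
      \<comment> \<open>Along the sequence the measure is that of the trimmed weights at the
        gathered positions, and both of these converge.\<close>
      have "same_measure n w (push s c)"
      proof (rule same_measure_of_continuous)
        fix g :: "(nat \<Rightarrow> real) \<Rightarrow> real" assume g: "continuous_on UNIV g"
        have gt: "(\<lambda>j. g (gathered (ss j) (cs j) i)) \<longlonglongrightarrow> g (?X i)" for i
        proof (rule isCont_tendsto_compose[OF _ tendsto_component[OF X, of i]])
          show "isCont g (?X i)" using g by (simp add: continuous_on_eq_continuous_at)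
        qed
        have "(\<lambda>j. \<Sum>i<n. trimmed (ss j) (cs j) i * g (gathered (ss j) (cs j) i)) \<longlonglongrightarrow> (\<Sum>i<n. ?T i * g (?X i))"
          by (intro tendsto_sum tendsto_mult gt tendsto_component[OF T])
        moreover have "(\<lambda>j. \<Sum>i<n. trimmed (ss j) (cs j) i * g (gathered (ss j) (cs j) i)) \<longlonglongrightarrow> (\<Sum>i<n. fst w i * g (snd w i))"
        proof -
          have "(\<lambda>j. \<Sum>i<n. fst (push (ss j) (cs j)) i * g (gathered (ss j) (cs j) i)) \<longlonglongrightarrow> (\<Sum>i<n. fst w i * g (snd w i))"
            unfolding w2 by (intro tendsto_sum tendsto_mult gt tendsto_component[OF w1])
          moreover have "(\<Sum>i<n. fst (push (ss j) (cs j)) i * g (gathered (ss j) (cs j) i)) =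
            (\<Sum>i<n. trimmed (ss j) (cs j) i * g (gathered (ss j) (cs j) i))" for j
            using push_measure[OF cs[of j] s01(1)[of j], of g] by (simp add: wsum_def push_def)
          ultimately show ?thesis by simp
        qed
        ultimately have "(\<Sum>i<n. ?T i * g (?X i)) = (\<Sum>i<n. fst w i * g (snd w i))" by (rule LIMSEQ_unique)
        then show "wsum n w (\<lambda>a y. a * g y) = wsum n (push s c) (\<lambda>a y. a * g y)"
          unfolding push by (simp add: wsum_def)
      qed
      then show ?thesis using lw lp by (simp add: stage_rel_def)
    qed
  qed
qed

end

section \<open>Compactness of the space of configurations\<close>

lemma compact_sphere_set: "compact (sphere_set k)"
proof -
  have c: "compact (PiE UNIV (\<lambda>_::nat. {-1..1::real}))"
    using compactin_PiE[of "\<lambda>_. euclidean" UNIV "\<lambda>_::nat. {-1..1::real}"]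
    by (simp add: euclidean_product_topology)
  have "closed {x :: nat \<Rightarrow> real. (\<forall>i\<in>{k<..}. x i = 0) \<and> (\<Sum>i\<le>k. (x i)\<^sup>2) = 1}"
    unfolding Collect_conj_eq Ball_Collect[symmetric] Collect_ball_eq
    by (intro closed_Int closed_INT ballI closed_Collect_eq continuous_intros) simp_all
  moreover have "{x :: nat \<Rightarrow> real. (\<forall>i\<in>{k<..}. x i = 0) \<and> (\<Sum>i\<le>k. (x i)\<^sup>2) = 1} = sphere_set k"
    by (auto simp: sphere_set_iff)
  ultimately have cl: "closed (sphere_set k)" by simp
  have sub: "sphere_set k \<subseteq> PiE UNIV (\<lambda>_. {-1..1})"
  proof
    fix x assume x: "x \<in> sphere_set k"
    have "\<bar>x i\<bar> \<le> 1" for i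
    proof (cases "i \<le> k")
      case True
      have "(x i)\<^sup>2 \<le> (\<Sum>i\<le>k. (x i)\<^sup>2)" using True by (intro member_le_sum) auto
      then have "(x i)\<^sup>2 \<le> 1" using x by (simp add: sphere_set_iff)
      then show ?thesis by (simp add: abs_square_le_1)
    next
      case False
      then show ?thesis using x by (simp add: sphere_set_iff)
    qed
    then have "\<forall>i. x i \<in> {-1..1}" by (simp add: abs_le_iff minus_le_iff)
    then show "x \<in> PiE UNIV (\<lambda>_. {-1..1})" by (simp add: PiE_UNIV_domain)
  qed
  show ?thesis using compact_Int_closed[OF c cl] sub by (simp add: Int_absorb1 inf.absorb2)
qed

lemma compact_configs: "compact (configs n k)"
proof -
  have "compactin (powertop_real UNIV) (standard_simplex (n - 1))" by (rule compactin_standard_simplex)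
  then have 1: "compact (standard_simplex (n - 1))" by (simp add: euclidean_product_topology)
  have "compactin (product_topology (\<lambda>_. euclidean) UNIV) (PiE UNIV (\<lambda>_::nat. sphere_set k))"
    unfolding compactin_PiE using compact_sphere_set by simp
  then have "compact (PiE UNIV (\<lambda>_::nat. sphere_set k))" by (simp add: euclidean_product_topology)
  moreover have "PiE UNIV (\<lambda>_::nat. sphere_set k) = {x. \<forall>i. x i \<in> sphere_set k}" by auto
  ultimately have 2: "compact {x::nat \<Rightarrow> nat \<Rightarrow> real. \<forall>i. x i \<in> sphere_set k}" by simp
  show ?thesis unfolding configs_def by (rule compact_Times[OF 1 2])
qed

section \<open>Extension to unsorted configurations\<close>

lemma finite_range_constant_subseq:
  fixes f :: "nat \<Rightarrow> 'a"
  assumes "finite A" "\<And>j. f j \<in> A"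
  shows "\<exists>\<rho> a. strict_mono (\<rho> :: nat \<Rightarrow> nat) \<and> (\<forall>j. f (\<rho> j) = a)"
proof -
  have "infinite (UNIV :: nat set)" by simp
  moreover have "finite (range f)" using assms finite_subset[of "range f" A] by auto
  ultimately obtain j0 where "infinite {j \<in> UNIV. f j = f j0}"
    using pigeonhole_infinite[of UNIV f] by auto
  then have "infinite {j. f j = f j0}" by simp
  then obtain \<rho> :: "nat \<Rightarrow> nat" where "strict_mono \<rho>" "\<And>j. \<rho> j \<in> {j. f j = f j0}"
    using infinite_enumerate by blast
  then show ?thesis by (intro exI[of _ \<rho>] exI[of _ "f j0"]) simp
qed

text \<open>An arbitrary choice that jumps at equal weights; by \<open>push_equivariant\<close> it
  affects the outcome only up to \<open>same_sum\<close>.\<close>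

definition sort_perm :: "nat \<Rightarrow> (nat \<Rightarrow> real) \<Rightarrow> nat \<Rightarrow> nat" where
  "sort_perm n t = (SOME p. p permutes {..<n} \<and> (\<forall>i j. i \<le> j \<longrightarrow> j < n \<longrightarrow> t (p j) \<le> t (p i)))"

definition sort_config :: "nat \<Rightarrow> config \<Rightarrow> config" where
  "sort_config n c = (fst c \<circ> sort_perm n (fst c), snd c \<circ> sort_perm n (fst c))"

lemma sort_perm: "sort_perm n t permutes {..<n}" "i \<le> j \<Longrightarrow> j < n \<Longrightarrow> t (sort_perm n t j) \<le> t (sort_perm n t i)"
proof -
  have "\<exists>p. p permutes {..<n} \<and> (\<forall>i j. i \<le> j \<longrightarrow> j < n \<longrightarrow> t (p j) \<le> t (p i))"
    using antitone_perm_exists[of n t] by metis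
  from someI_ex[OF this] show "sort_perm n t permutes {..<n}"
    "i \<le> j \<Longrightarrow> j < n \<Longrightarrow> t (sort_perm n t j) \<le> t (sort_perm n t i)"
    unfolding sort_perm_def by blast+
qed

lemma same_sum_sort_config: "same_sum n c (sort_config n c)"
  by (rule same_sum_permI[OF sort_perm(1)[of n "fst c"]]) (auto simp: sort_config_def)

context stage
begin

lemma sort_config_sorted:
  assumes "c \<in> configs n k" shows "sort_config n c \<in> sorted_configs"
proof -
  let ?p = "sort_perm n (fst c)"
  note p = sort_perm(1)[of n "fst c"]
  note c = assms[unfolded configs_iff[OF n1]]
  have out: "?p i = i" if "n \<le> i" for i using p that by (simp add: permutes_not_in)
  have "(\<Sum>i<n. fst c (?p i)) = (\<Sum>i<n. fst c i)"
    using sum.permute[OF p, of "fst c"] by (simp add: o_def)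
  then have "sort_config n c \<in> configs n k"
    unfolding configs_iff[OF n1] using c out by (simp add: sort_config_def)
  moreover have "antimono (fst (sort_config n c))"
  proof (rule antimonoI)
    fix i j :: nat assume ij: "i \<le> j"
    show "fst (sort_config n c) j \<le> fst (sort_config n c) i"
    proof (cases "j < n")
      case True
      then show ?thesis using sort_perm(2)[OF ij, of n "fst c"] by (simp add: sort_config_def)
    next
      case False
      then show ?thesis using c out[of j] by (simp add: sort_config_def)
    qed
  qed
  ultimately show ?thesis by (simp add: sorted_configs_def)
qed

definition collapse :: "real \<times> config \<Rightarrow> config" where
  "collapse z = push (fst z) (sort_config n (snd z))"

lemma push_stage_low:
  assumes c: "c \<in> sorted_configs" and low: "low n r m c" and s: "0 \<le> s" "s \<le> 1"
  shows "same_measure n (push s c) c" "low n r m (push s c)" "low n r (m - 1) (push 1 c)"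
proof -
  have "same_measure n (push s c) c \<and> low n r m (push s c) \<and> low n r (m - 1) (push 1 c)"
  proof (cases "low n r (m - 1) c")
    case True
    then show ?thesis using push_low[OF c True] low same_measure_refl by simp
  next
    case False
    then show ?thesis using push_stage[OF c low False s] by simp
  qed
  then show "same_measure n (push s c) c" "low n r m (push s c)" "low n r (m - 1) (push 1 c)" by auto
qed

text \<open>There are finitely many sorting permutations, so a subsequence is sorted by a fixed
  \<open>p\<close>. The limit is sorted by \<open>p\<close> too, though \<open>p\<close> need not be
  the permutation chosen for it; \<open>push_equivariant\<close> makes up for the
  difference.\<close>

lemma collapse_cluster_point:
  assumes zs: "\<forall>j. zs j \<in> {0..1} \<times> configs n k" and z: "z \<in> {0..1} \<times> configs n k" and lim: "zs \<longlonglongrightarrow> z"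
    and w: "(\<lambda>j. collapse (zs j)) \<longlonglongrightarrow> w"
  shows "stage_rel n r (m - 1) w (collapse z)"
proof -
  let ?p = "\<lambda>j. sort_perm n (fst (snd (zs j)))"
  have "\<exists>\<rho> p. strict_mono (\<rho> :: nat \<Rightarrow> nat) \<and> (\<forall>j. ?p (\<rho> j) = p)"
    by (rule finite_range_constant_subseq[of "{p. p permutes {..<n}}"]) (simp_all add: finite_permutations sort_perm(1))
  then obtain p \<rho> where \<rho>: "strict_mono (\<rho> :: nat \<Rightarrow> nat)" and p: "\<And>j. ?p (\<rho> j) = p" by blast
  define c where "c j = sort_config n (snd (zs (\<rho> j)))" for j
  define c0 where "c0 = (fst (snd z) \<circ> p, snd (snd z) \<circ> p)"
  have zc: "snd (zs j) \<in> configs n k" "fst (zs j) \<le> 1" for j using zs by (simp_all add: mem_Times_iff)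
  have z0: "snd z \<in> configs n k" "fst z \<le> 1" using z by (auto simp: mem_Times_iff)
  have lim': "(zs \<circ> \<rho>) \<longlonglongrightarrow> z" using LIMSEQ_subseq_LIMSEQ[OF lim \<rho>] .
  have cl: "c \<longlonglongrightarrow> c0"
  proof -
    have f: "(\<lambda>j. fst (snd (zs (\<rho> j)))) \<longlonglongrightarrow> fst (snd z)" "(\<lambda>j. snd (snd (zs (\<rho> j)))) \<longlonglongrightarrow> snd (snd z)"
      using tendsto_fst[OF tendsto_snd[OF lim']] tendsto_snd[OF tendsto_snd[OF lim']] by (simp_all add: o_def)
    have "(\<lambda>j. fst (snd (zs (\<rho> j))) \<circ> p) \<longlonglongrightarrow> (fst (snd z) \<circ> p)"
      unfolding tendsto_fun_iff[of "\<lambda>j. fst (snd (zs (\<rho> j))) \<circ> p"] o_apply by (intro allI tendsto_component[OF f(1)])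
    moreover have "(\<lambda>j. snd (snd (zs (\<rho> j))) \<circ> p) \<longlonglongrightarrow> (snd (snd z) \<circ> p)"
      unfolding tendsto_fun_iff[of "\<lambda>j. snd (snd (zs (\<rho> j))) \<circ> p"] o_apply by (intro allI tendsto_component[OF f(2)])
    ultimately show ?thesis unfolding c_def c0_def sort_config_def p by (rule tendsto_Pair)
  qed
  have cs: "c j \<in> sorted_configs" for j unfolding c_def by (rule sort_config_sorted[OF zc(1)])
  have pp: "p permutes {..<n}" using sort_perm(1) p by metis
  have ss: "same_sum n (snd z) c0" by (rule same_sum_permI[OF pp]) (auto simp: c0_def)
  have c0: "c0 \<in> sorted_configs"
  proof -
    have out: "p i = i" if "n \<le> i" for i using pp that by (simp add: permutes_not_in)
    have "(\<Sum>i<n. fst (snd z) (p i)) = (\<Sum>i<n. fst (snd z) i)"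
      using sum.permute[OF pp, of "fst (snd z)"] by (simp add: o_def)
    then have "c0 \<in> configs n k"
      using z0(1) out unfolding configs_iff[OF n1] by (simp add: c0_def)
    moreover have "antimono (fst c0)"
    proof (rule antimonoI)
      fix a b :: nat assume "a \<le> b"
      then have "\<forall>j\<ge>0. fst (c j) b \<le> fst (c j) a" using sorted_configsD(6)[OF cs] by simp
      then show "fst c0 b \<le> fst c0 a"
        by (intro LIMSEQ_le[OF tendsto_component[OF tendsto_fst[OF cl], of b] tendsto_component[OF tendsto_fst[OF cl], of a]] exI)
    qed
    ultimately show ?thesis by (simp add: sorted_configs_def)
  qed
  \<comment> \<open>A second subsequence makes \<open>clock2\<close> converge, as
    \<open>push_cluster_point\<close> demands.\<close>
  define \<tau> where "\<tau> j = clock2 (fst (zs (\<rho> j))) (c j)" for j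
  have "\<forall>j. \<tau> j \<in> {0..1}" using clock_bounds(3,4) by (simp add: \<tau>_def)
  then have "\<exists>l\<in>{0..1}. \<exists>\<rho>'. strict_mono \<rho>' \<and> (\<tau> \<circ> \<rho>') \<longlonglongrightarrow> l"
    by (rule compact_Icc[of 0 "1::real", unfolded compact_def, THEN spec, THEN mp])
  then obtain \<tau>0 \<rho>' where \<rho>': "strict_mono \<rho>'" "(\<tau> \<circ> \<rho>') \<longlonglongrightarrow> \<tau>0"
    by (elim bexE exE conjE) (rule that)
  have "stage_rel n r (m - 1) w (push (fst z) c0)"
  proof (rule push_cluster_point[where cs = "c \<circ> \<rho>'" and ss = "\<lambda>j. fst (zs (\<rho> (\<rho>' j)))" and \<tau> = \<tau>0])
    show "(c \<circ> \<rho>') j \<in> sorted_configs" for j by (simp add: cs)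
    show "(c \<circ> \<rho>') \<longlonglongrightarrow> c0" by (rule LIMSEQ_subseq_LIMSEQ[OF cl \<rho>'(1)])
    show "(\<lambda>j. fst (zs (\<rho> (\<rho>' j)))) \<longlonglongrightarrow> fst z"
      using LIMSEQ_subseq_LIMSEQ[OF tendsto_fst[OF lim'] \<rho>'(1)] by (simp add: o_def)
    show "fst (zs (\<rho> (\<rho>' j))) \<le> 1" for j by (rule zc)
    show "(\<lambda>j. clock2 (fst (zs (\<rho> (\<rho>' j)))) ((c \<circ> \<rho>') j)) \<longlonglongrightarrow> \<tau>0"
      using \<rho>'(2) by (simp add: \<tau>_def o_def)
    have "(\<lambda>j. collapse (zs (\<rho> (\<rho>' j)))) \<longlonglongrightarrow> w"
      using LIMSEQ_subseq_LIMSEQ[OF LIMSEQ_subseq_LIMSEQ[OF w \<rho>] \<rho>'(1)] by (simp add: o_def)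
    then show "(\<lambda>j. push (fst (zs (\<rho> (\<rho>' j)))) ((c \<circ> \<rho>') j)) \<longlonglongrightarrow> w"
      by (simp add: collapse_def c_def)
  qed (rule c0 z0(2))+
  moreover have "same_sum n (push (fst z) c0) (collapse z)"
    unfolding collapse_def
    by (rule push_equivariant[OF c0 sort_config_sorted[OF z0(1)] _ z0(2)])
      (rule same_sum_trans[OF same_sum_sym[OF ss] same_sum_sort_config])
  then have "stage_rel n r (m - 1) (push (fst z) c0) (collapse z)"
    unfolding stage_rel_def ..
  ultimately show ?thesis by (rule stage_rel_trans)
qed

lemma quot_stage_rel:
  assumes "c \<in> configs n k" "c' \<in> configs n k"
  shows "quot_class (top_of_set (configs n k)) (stage_rel n a b) c = quot_class (top_of_set (configs n k)) (stage_rel n a b) c'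
    \<longleftrightarrow> stage_rel n a b c c'"
proof (rule quot_class_eq_iff_equiv)
  show "stage_rel n a b x x" for x by (rule stage_rel_refl)
  show "stage_rel n a b y x" if "stage_rel n a b x y" for x y by (rule stage_rel_sym[OF that])
  show "stage_rel n a b x z" if "stage_rel n a b x y" "stage_rel n a b y z" for x y z by (rule stage_rel_trans[OF that])
qed (simp_all add: assms)

lemma collapse_same_sum:
  assumes "c \<in> configs n k" "c' \<in> configs n k" "same_sum n c c'" "s \<le> 1"
  shows "same_sum n (collapse (s, c)) (collapse (s, c'))"
  unfolding collapse_def fst_conv snd_conv
  by (rule push_equivariant[OF sort_config_sorted[OF assms(1)] sort_config_sorted[OF assms(2)] _ assms(4)])
    (rule same_sum_trans[OF same_sum_trans[OF same_sum_sym[OF same_sum_sort_config] assms(3)] same_sum_sort_config])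

lemma collapse_configs: "s \<in> {0..1} \<Longrightarrow> c \<in> configs n k \<Longrightarrow> collapse (s, c) \<in> configs n k"
  unfolding collapse_def fst_conv snd_conv by (rule push_configs[OF sort_config_sorted]) simp_all

lemma low_sort_config: "low n r b (sort_config n c) \<longleftrightarrow> low n r b c"
  by (rule same_sum_low[OF same_sum_sort_config, symmetric])

lemma same_measure_sort_config:
  assumes "same_measure n c c'" shows "same_measure n (sort_config n c) (sort_config n c')"
  by (rule same_measure_trans[OF same_measure_sym[OF same_sum_imp_same_measure[OF same_sum_sort_config]]
    same_measure_trans[OF assms same_sum_imp_same_measure[OF same_sum_sort_config]]])

lemma collapse_0: "c \<in> configs n k \<Longrightarrow> same_sum n (collapse (0, c)) c"
  unfolding collapse_def fst_conv snd_conv push_0[OF sort_config_sorted]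
  by (rule same_sum_sym[OF same_sum_sort_config])

lemma collapse_low:
  assumes "c \<in> configs n k" "low n r (m - 1) c"
  shows "collapse (s, c) = sort_config n c"
  unfolding collapse_def fst_conv snd_conv
  by (rule push_low[OF sort_config_sorted[OF assms(1)]]) (simp only: low_sort_config assms(2))

lemma collapse_stage_low:
  assumes c: "c \<in> configs n k" and low: "low n r m c" and s: "s \<in> {0..1}"
  shows "same_measure n (collapse (s, c)) c" "low n r m (collapse (s, c))" "low n r (m - 1) (collapse (1, c))"
proof -
  have l: "low n r m (sort_config n c)" by (simp only: low_sort_config low)
  have s': "0 \<le> s" "s \<le> 1" using s by simp_all
  note p = push_stage_low[OF sort_config_sorted[OF c] l s']
  show "same_measure n (collapse (s, c)) c"
    unfolding collapse_def fst_conv snd_conv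
    by (rule same_measure_trans[OF p(1) same_measure_sym[OF same_sum_imp_same_measure[OF same_sum_sort_config]]])
  show "low n r m (collapse (s, c))" "low n r (m - 1) (collapse (1, c))"
    unfolding collapse_def fst_conv snd_conv by (rule p(2), rule p(3))
qed

lemma stage_rel_mono:
  assumes "stage_rel n r (m - 1) c c'" shows "stage_rel n r m c c'"
proof -
  have "low n r (m - 1) d \<Longrightarrow> low n r m d" for d unfolding low_def by linarith
  then show ?thesis using assms unfolding stage_rel_def by blast
qed

text \<open>Pairs related only by their measure are low, and there the deformation merely
  sorts.\<close>

lemma collapse_respects_lower:
  assumes c: "c \<in> configs n k" "c' \<in> configs n k" and s: "s \<in> {0..1}" and rel: "stage_rel n r (m - 1) c c'"
  shows "stage_rel n r (m - 1) (collapse (s, c)) (collapse (s, c'))"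
proof (cases "same_sum n c c'")
  case True
  have "s \<le> 1" using s by simp
  from collapse_same_sum[OF c True this] show ?thesis unfolding stage_rel_def ..
next
  case False
  then have h: "same_measure n c c'" "low n r (m - 1) c" "low n r (m - 1) c'"
    using rel unfolding stage_rel_def by blast+
  show ?thesis
    unfolding collapse_low[OF c(1) h(2)] collapse_low[OF c(2) h(3)] stage_rel_def low_sort_config
    using same_measure_sort_config[OF h(1)] h(2,3) by blast
qed

text \<open>Pairs related only by their measure keep it and stay low throughout. At time 1 both are
  low for \<open>m - 1\<close>, which yields the map back to the finer quotient.\<close>

lemma collapse_respects_upper:
  assumes c: "c \<in> configs n k" "c' \<in> configs n k" and s: "s \<in> {0..1}" and rel: "stage_rel n r m c c'"
  shows "stage_rel n r m (collapse (s, c)) (collapse (s, c'))"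
    and "stage_rel n r (m - 1) (collapse (1, c)) (collapse (1, c'))"
proof -
  have "stage_rel n r m (collapse (s, c)) (collapse (s, c')) \<and> stage_rel n r (m - 1) (collapse (1, c)) (collapse (1, c'))"
  proof (cases "same_sum n c c'")
    case True
    have "s \<le> 1" using s by simp
    from collapse_same_sum[OF c True this] collapse_same_sum[OF c True order_refl]
    show ?thesis unfolding stage_rel_def by blast
  next
    case False
    then have h: "same_measure n c c'" "low n r m c" "low n r m c'"
      using rel unfolding stage_rel_def by blast+
    have one: "(1::real) \<in> {0..1}" by simp
    have sm: "same_measure n (collapse (s, c)) (collapse (s, c'))" if "s \<in> {0..1}" for s
      by (rule same_measure_trans[OF collapse_stage_low(1)[OF c(1) h(2) that]
        same_measure_trans[OF h(1) same_measure_sym[OF collapse_stage_low(1)[OF c(2) h(3) that]]]])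
    show ?thesis
      unfolding stage_rel_def
      using sm[OF s] sm[OF one] collapse_stage_low(2,3)[OF c(1) h(2) s] collapse_stage_low(2,3)[OF c(2) h(3) s] by blast
  qed
  then show "stage_rel n r m (collapse (s, c)) (collapse (s, c'))"
    "stage_rel n r (m - 1) (collapse (1, c)) (collapse (1, c'))" by blast+
qed

lemma stage_homotopy_equivalent:
  "quotient_space (top_of_set (configs n k)) (stage_rel n r (m - 1)) homotopy_equivalent_space
   quotient_space (top_of_set (configs n k)) (stage_rel n r m)"
proof (rule homotopy_equivalent_quotients[where W = "configs n k" and e = collapse])
  show "compact (configs n k)" by (rule compact_configs)
next
  show "quotient_map (top_of_set (configs n k)) (quotient_space (top_of_set (configs n k)) (stage_rel n r (m - 1)))
    (quot_class (top_of_set (configs n k)) (stage_rel n r (m - 1)))" by (rule quotient_map_quot_class)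
next
  show "quotient_map (top_of_set (configs n k)) (quotient_space (top_of_set (configs n k)) (stage_rel n r m))
    (quot_class (top_of_set (configs n k)) (stage_rel n r m))" by (rule quotient_map_quot_class)
next
  let ?q = "\<lambda>b. quot_class (top_of_set (configs n k)) (stage_rel n r b)"
  fix w w' assume w: "w \<in> configs n k" "w' \<in> configs n k" "?q (m - 1) w = ?q (m - 1) w'"
  then show "?q m w = ?q m w'" unfolding quot_stage_rel[OF w(1,2)] by (intro stage_rel_mono)
next
  show "collapse (s, w) \<in> configs n k" if "s \<in> {0..1}" "w \<in> configs n k" for s w
    by (rule collapse_configs[OF that])
next
  let ?q = "\<lambda>b. quot_class (top_of_set (configs n k)) (stage_rel n r b)"
  fix w assume w: "w \<in> configs n k"
  have "collapse (0, w) \<in> configs n k" by (rule collapse_configs[OF _ w]) simp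
  then show "?q (m - 1) (collapse (0, w)) = ?q (m - 1) w"
    by (rule quot_stage_rel[OF _ w, THEN iffD2]) (simp only: stage_rel_def collapse_0[OF w] simp_thms)
next
  let ?q = "\<lambda>b. quot_class (top_of_set (configs n k)) (stage_rel n r b)"
  fix zs z w
  assume zs: "\<forall>j. zs j \<in> {0..1} \<times> configs n k" and z: "z \<in> {0..1} \<times> configs n k"
    and lim: "zs \<longlonglongrightarrow> z" "(\<lambda>j. collapse (zs j)) \<longlonglongrightarrow> w" and w: "w \<in> configs n k"
  have "collapse (fst z, snd z) \<in> configs n k"
    by (rule collapse_configs) (use z in \<open>simp_all add: mem_Times_iff\<close>)
  then have cz: "collapse z \<in> configs n k" by simp
  have "stage_rel n r (m - 1) w (collapse z)"
    by (rule collapse_cluster_point[OF zs z lim])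
  then show "?q (m - 1) w = ?q (m - 1) (collapse z)"
    by (rule quot_stage_rel[OF w cz, THEN iffD2])
next
  let ?q = "\<lambda>b. quot_class (top_of_set (configs n k)) (stage_rel n r b)"
  fix s :: real and w w' assume s: "s \<in> {0..1}" and w: "w \<in> configs n k" "w' \<in> configs n k" and e: "?q (m - 1) w = ?q (m - 1) w'"
  have "stage_rel n r (m - 1) (collapse (s, w)) (collapse (s, w'))"
    by (rule collapse_respects_lower[OF w s e[unfolded quot_stage_rel[OF w]]])
  then show "?q (m - 1) (collapse (s, w)) = ?q (m - 1) (collapse (s, w'))"
    by (rule quot_stage_rel[OF collapse_configs[OF s w(1)] collapse_configs[OF s w(2)], THEN iffD2])
next
  let ?q = "\<lambda>b. quot_class (top_of_set (configs n k)) (stage_rel n r b)"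
  fix s :: real and w w' assume s: "s \<in> {0..1}" and w: "w \<in> configs n k" "w' \<in> configs n k" and e: "?q m w = ?q m w'"
  have "stage_rel n r m (collapse (s, w)) (collapse (s, w'))"
    by (rule collapse_respects_upper(1)[OF w s e[unfolded quot_stage_rel[OF w]]])
  then show "?q m (collapse (s, w)) = ?q m (collapse (s, w'))"
    by (rule quot_stage_rel[OF collapse_configs[OF s w(1)] collapse_configs[OF s w(2)], THEN iffD2])
next
  let ?q = "\<lambda>b. quot_class (top_of_set (configs n k)) (stage_rel n r b)"
  fix w w' assume w: "w \<in> configs n k" "w' \<in> configs n k" and e: "?q m w = ?q m w'"
  have one: "(1::real) \<in> {0..1}" by simp
  have "stage_rel n r (m - 1) (collapse (1, w)) (collapse (1, w'))"
    by (rule collapse_respects_upper(2)[OF w one e[unfolded quot_stage_rel[OF w]]])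
  then show "?q (m - 1) (collapse (1, w)) = ?q (m - 1) (collapse (1, w'))"
    by (rule quot_stage_rel[OF collapse_configs[OF one w(1)] collapse_configs[OF one w(2)], THEN iffD2])
qed

end

section \<open>Composition of the stages\<close>

lemma quotient_space_cong:
  assumes "\<And>x y. x \<in> topspace X \<Longrightarrow> y \<in> topspace X \<Longrightarrow> r x y \<longleftrightarrow> r' x y"
  shows "quotient_space X r = quotient_space X r'"
proof -
  have "(\<lambda>a b. a \<in> topspace X \<and> b \<in> topspace X \<and> r a b) = (\<lambda>a b. a \<in> topspace X \<and> b \<in> topspace X \<and> r' a b)"
    using assms by (intro ext) blast
  then have "quot_class X r = quot_class X r'" unfolding quot_class_def[abs_def] by simp
  then show ?thesis unfolding quotient_space_def by simp
qed

text \<open>In row \<open>r\<close> the stages run through \<open>m < r\<close>, and the last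
  relation of a row is the first of the next. The chain leads from \<open>(1, 0)\<close>, which is
  \<open>same_sum\<close>, to \<open>(n + 1, 0)\<close>, which is
  \<open>same_measure\<close>.\<close>

lemma same_sum_same_measure_homotopy_equivalent:
  assumes n: "1 \<le> n"
  shows "quotient_space (top_of_set (configs n k)) (same_sum n) homotopy_equivalent_space
    quotient_space (top_of_set (configs n k)) (same_measure n)"
proof -
  let ?P = "\<lambda>r m. quotient_space (top_of_set (configs n k)) (stage_rel n r m)"
  have nn: "0 \<le> fst c i" if "c \<in> configs n k" for c i using that unfolding configs_iff[OF n] by simp
  have row: "?P r 0 homotopy_equivalent_space ?P r m" if "m < r" "r \<le> n" for r m
    using that
  proof (induction m)
    case 0 then show ?case by (simp add: homotopy_equivalent_space_refl)
  next
    case (Suc m)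
    interpret stage n k r "Suc m" by unfold_locales (use Suc.prems in simp_all)
    have "?P r 0 homotopy_equivalent_space ?P r m" using Suc.prems by (intro Suc.IH) simp_all
    moreover have "?P r m homotopy_equivalent_space ?P r (Suc m)" using stage_homotopy_equivalent by simp
    ultimately show ?case by (rule homotopy_eqv_trans)
  qed
  have step: "?P r (r - 1) = ?P (Suc r) 0" if "1 \<le> r" for r
  proof (rule quotient_space_cong)
    fix c c' assume "c \<in> topspace (top_of_set (configs n k))" "c' \<in> topspace (top_of_set (configs n k))"
    then have "c \<in> configs n k" "c' \<in> configs n k" by simp_all
    then show "stage_rel n r (r - 1) c c' \<longleftrightarrow> stage_rel n (Suc r) 0 c c'"
      by (intro stage_rel_Suc_zero that nn)
  qed
  have "?P 1 0 homotopy_equivalent_space ?P (Suc r) 0" if "1 \<le> r" "r \<le> n" for r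
    using that
  proof (induction r rule: nat_induct_at_least)
    case base
    then show ?case using step[of 1] by (simp add: homotopy_equivalent_space_refl)
  next
    case (Suc r)
    have "?P 1 0 homotopy_equivalent_space ?P (Suc r) 0" using Suc.prems by (intro Suc.IH) simp
    moreover have "?P (Suc r) 0 homotopy_equivalent_space ?P (Suc r) r" using Suc.prems by (intro row) simp_all
    moreover have "?P (Suc r) r = ?P (Suc (Suc r)) 0" using step[of "Suc r"] by simp
    ultimately show ?case by (simp only: homotopy_eqv_trans)
  qed
  from this[OF n order_refl] have main: "?P 1 0 homotopy_equivalent_space ?P (Suc n) 0" .
  have s: "wsum n c (\<lambda>a y. a) = 1" if "c \<in> configs n k" for c
    using that unfolding configs_iff[OF n] wsum_def by simp
  have "?P 1 0 = quotient_space (top_of_set (configs n k)) (same_sum n)"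
  proof (rule quotient_space_cong)
    fix c c' assume "c \<in> topspace (top_of_set (configs n k))" "c' \<in> topspace (top_of_set (configs n k))"
    then have "c \<in> configs n k" "c' \<in> configs n k" by simp_all
    then show "stage_rel n 1 0 c c' \<longleftrightarrow> same_sum n c c'" by (intro stage_rel_first s)
  qed
  moreover have "?P (Suc n) 0 = quotient_space (top_of_set (configs n k)) (same_measure n)"
  proof (rule quotient_space_cong)
    \<comment> \<open>There are at most \<open>n\<close> nonzero weights, so every configuration is
      low at this stage.\<close>
    have "card (support n c) \<le> card {..<n}" for c by (intro card_mono) (auto simp: support_def)
    then have "low n (Suc n) 0 c" for c by (auto simp: low_def less_Suc_eq_le)
    then show "stage_rel n (Suc n) 0 c c' \<longleftrightarrow> same_measure n c c'" for c c'
      unfolding stage_rel_def using same_sum_imp_same_measure by blast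
  qed
  ultimately show ?thesis using main by simp
qed

section \<open>The space of barycenters\<close>

text \<open>Continuous test functions make this a continuous function of \<open>c\<close>, and they suffice to determine a
finitely supported measure.\<close>

definition test_measure :: "nat \<Rightarrow> config \<Rightarrow> ((nat \<Rightarrow> real) \<Rightarrow> real) \<Rightarrow> real" where
  "test_measure m c = (\<lambda>\<phi>. if continuous_on UNIV \<phi> then wsum m c (\<lambda>a y. a * \<phi> y) else 0)"

lemma continuous_map_real_family:
  assumes "\<And>\<phi>. continuous_map X euclideanreal (\<lambda>x. f x \<phi>)"
  shows "continuous_map X (powertop_real UNIV) f"
  using assms by (simp add: continuous_map_componentwise_UNIV)

lemma Hausdorff_powertop_real: "Hausdorff_space (powertop_real UNIV)"
  by (simp add: Hausdorff_space_product_topology Hausdorff_space_euclidean)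

text \<open>Two quotients of compact spaces are compared by giving them complete invariants with the
  same image; the invariants, and not the quotients, provide the Hausdorff property.\<close>

lemma homeomorphic_space_image:
  assumes "compact_space X" and "quotient_map X P q" and "Hausdorff_space T" and "continuous_map X T f"
    and "\<And>x y. \<lbrakk>x \<in> topspace X; y \<in> topspace X\<rbrakk> \<Longrightarrow> q x = q y \<longleftrightarrow> f x = f y"
  shows "P homeomorphic_space subtopology T (f ` topspace X)"
  by (rule quotient_maps_homeomorphic[OF assms(2) quotient_map_onto_image[OF assms(1,3,4)]]) (rule assms(5))

lemma test_measure_eq_iff: "test_measure n c = test_measure n c' \<longleftrightarrow> same_measure n c c'"
proof
  assume e: "test_measure n c = test_measure n c'"
  show "same_measure n c c'"
  proof (rule same_measure_of_continuous)
    fix g :: "(nat \<Rightarrow> real) \<Rightarrow> real" assume "continuous_on UNIV g"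
    then show "wsum n c (\<lambda>a y. a * g y) = wsum n c' (\<lambda>a y. a * g y)"
      using fun_cong[OF e, of g] by (simp add: test_measure_def)
  qed
next
  assume "same_measure n c c'"
  then show "test_measure n c = test_measure n c'"
    unfolding same_measure_def test_measure_def by auto
qed

lemma test_measure_all:
  assumes "test_measure m c = test_measure m' c'"
  shows "wsum m c (\<lambda>a y. a * \<phi> y) = wsum m' c' (\<lambda>a y. a * \<phi> y)"
proof -
  have "finite (snd c ` {..<m} \<union> snd c' ` {..<m'})" by simp
  then obtain g where g: "continuous_on UNIV g" "\<And>y. y \<in> snd c ` {..<m} \<union> snd c' ` {..<m'} \<Longrightarrow> g y = \<phi> y"
    by (rule finite_continuous_interpolation[where G = \<phi>]) (rule that)
  have "wsum m c (\<lambda>a y. a * \<phi> y) = wsum m c (\<lambda>a y. a * g y)"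
    unfolding wsum_def using g(2) by (intro sum.cong) auto
  also have "\<dots> = wsum m' c' (\<lambda>a y. a * g y)"
    using fun_cong[OF assms, of g] g(1) by (simp add: test_measure_def)
  also have "\<dots> = wsum m' c' (\<lambda>a y. a * \<phi> y)"
    unfolding wsum_def using g(2) by (intro sum.cong) auto
  finally show ?thesis .
qed

section \<open>Compactness of the coproduct of unordered tuples\<close>

lemma topspace_weighted_tuples:
  "(t, x) \<in> topspace (weighted_tuples X m) \<longleftrightarrow> t \<in> standard_simplex (m - 1) \<and> x \<in> PiE {..<m} (\<lambda>_. topspace X)"
  by (simp add: weighted_tuples_def)

lemma compact_weighted_tuples:
  assumes "compact_space X" shows "compact_space (weighted_tuples X m)"
proof -
  have "compact_space (subtopology (powertop_real UNIV) (standard_simplex (m - 1)))"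
    using compactin_standard_simplex by (simp add: compact_space_subtopology)
  moreover have "compact_space (product_topology (\<lambda>_. X) {..<m})"
    using assms by (simp add: compact_space_product_topology)
  ultimately show ?thesis unfolding weighted_tuples_def by (simp add: compact_space_prod_topology)
qed

lemma compact_space_quotient_map:
  assumes "quotient_map X Y q" and "compact_space X"
  shows "compact_space Y"
  using image_compactin[OF _ quotient_imp_continuous_map[OF assms(1)], of "topspace X"] assms
    quotient_imp_surjective_map[OF assms(1)] by (simp add: compact_space_def)

lemma compact_space_sum_topology:
  assumes "finite I" and "\<And>i. i \<in> I \<Longrightarrow> compact_space (X i)"
  shows "compact_space (sum_topology X I)"
proof -
  have "compactin (sum_topology X I) (\<Union>i\<in>I. (\<lambda>x. (i, x)) ` topspace (X i))"
  proof (rule compactin_Union)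
    show "finite ((\<lambda>i. (\<lambda>x. (i, x)) ` topspace (X i)) ` I)" using assms(1) by simp
    fix S assume "S \<in> (\<lambda>i. (\<lambda>x. (i, x)) ` topspace (X i)) ` I"
    then obtain i where i: "i \<in> I" "S = (\<lambda>x. (i, x)) ` topspace (X i)" by blast
    have "compactin (X i) (topspace (X i))" using assms(2)[OF i(1)] by (simp add: compact_space_def)
    then show "compactin (sum_topology X I) S"
      unfolding i(2) by (rule image_compactin) (rule continuous_map_component_injection[OF i(1)])
  qed
  moreover have "(\<Union>i\<in>I. (\<lambda>x. (i, x)) ` topspace (X i)) = topspace (sum_topology X I)" by auto
  ultimately show ?thesis by (simp add: compact_space_def)
qed

lemma continuous_map_from_sum_topology:
  assumes "\<And>i. i \<in> I \<Longrightarrow> continuous_map (X i) T (\<lambda>x. f (i, x))"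
  shows "continuous_map (sum_topology X I) T f"
  unfolding continuous_map_def
proof (intro conjI allI impI)
  show "f \<in> topspace (sum_topology X I) \<rightarrow> topspace T"
  proof
    fix z assume "z \<in> topspace (sum_topology X I)"
    then have z: "fst z \<in> I" "snd z \<in> topspace (X (fst z))" by auto
    show "f z \<in> topspace T"
      using funcset_mem[OF continuous_map_funspace[OF assms[OF z(1)]] z(2)] by simp
  qed
  fix U assume U: "openin T U"
  show "openin (sum_topology X I) {z \<in> topspace (sum_topology X I). f z \<in> U}"
    unfolding openin_sum_topology
  proof (intro conjI ballI)
    show "{z \<in> topspace (sum_topology X I). f z \<in> U} \<subseteq> Sigma I (topspace \<circ> X)" by auto
    fix i assume i: "i \<in> I"
    have "{x. (i, x) \<in> {z \<in> topspace (sum_topology X I). f z \<in> U}} = {x \<in> topspace (X i). f (i, x) \<in> U}"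
      using i by auto
    then show "openin (X i) {x. (i, x) \<in> {z \<in> topspace (sum_topology X I). f z \<in> U}}"
      using assms[OF i] U by (simp add: continuous_map_def)
  qed
qed

section \<open>Invariance of the measure under deletion and merging\<close>

lemma sum_omit:
  fixes F :: "nat \<Rightarrow> real"
  assumes "i \<le> m"
  shows "(\<Sum>j<Suc m. F j) = F i + (\<Sum>j<m. omit i F j)"
proof -
  have "(\<Sum>j<m. omit i F j) = (\<Sum>j<i. F j) + (\<Sum>j=i..<m. F (Suc j))"
    using sum.atLeastLessThan_concat[of 0 i m "omit i F"] assms by (simp add: atLeast0LessThan omit_def)
  also have "(\<Sum>j=i..<m. F (Suc j)) = (\<Sum>j=Suc i..<Suc m. F j)"
    by (simp only: sum.shift_bounds_Suc_ivl)
  finally have 1: "(\<Sum>j<m. omit i F j) = (\<Sum>j<i. F j) + (\<Sum>j=Suc i..<Suc m. F j)" .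
  have "(\<Sum>j<Suc m. F j) = (\<Sum>j<Suc i. F j) + (\<Sum>j=Suc i..<Suc m. F j)"
    using sum.atLeastLessThan_concat[of 0 "Suc i" "Suc m" F] assms by (simp add: atLeast0LessThan)
  then show ?thesis using 1 by simp
qed

lemma omit_topspace:
  assumes tx: "(t, x) \<in> topspace (weighted_tuples X (Suc m))" and m: "m \<ge> 1" and i: "i \<le> m"
  shows "t i = 0 \<Longrightarrow> (omit i t, omit i x) \<in> topspace (weighted_tuples X m)"
    and "i = 0 \<Longrightarrow> ((omit 0 t)(0 := t 0 + t 1), omit 0 x) \<in> topspace (weighted_tuples X m)"
proof -
  have t: "\<And>j. 0 \<le> t j" "\<And>j. Suc m \<le> j \<Longrightarrow> t j = 0" "(\<Sum>j<Suc m. t j) = 1"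
    using tx simplex_iff[of "Suc m" t] unfolding topspace_weighted_tuples by auto
  have x: "\<And>j. j < Suc m \<Longrightarrow> x j \<in> topspace X" "\<And>j. Suc m \<le> j \<Longrightarrow> x j = undefined"
    using tx unfolding topspace_weighted_tuples by (auto simp: PiE_iff extensional_def)
  have ox: "omit i x \<in> PiE {..<m} (\<lambda>_. topspace X)" if "i \<le> m" for i
    using x that by (auto simp: PiE_iff extensional_def omit_def)
  show "(omit i t, omit i x) \<in> topspace (weighted_tuples X m)" if ti: "t i = 0"
    unfolding topspace_weighted_tuples simplex_iff[OF m]
    using t sum_omit[OF i, of t] ti ox[OF i] i by (auto simp: omit_def)
  have s: "(\<Sum>j<m. ((omit 0 t)(0 := t 0 + t 1)) j) = 1"
  proof -
    have "(\<Sum>j<m. ((omit 0 t)(0 := t 0 + t 1)) j) = (\<Sum>j<m. omit 0 t j + (if j = 0 then t 0 else 0))"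
      by (intro sum.cong) (auto simp: omit_def)
    also have "\<dots> = (\<Sum>j<m. omit 0 t j) + t 0" using m by (simp add: sum.distrib)
    finally show ?thesis using sum_omit[of 0 m t] t(3) by simp
  qed
  show "((omit 0 t)(0 := t 0 + t 1), omit 0 x) \<in> topspace (weighted_tuples X m)"
    unfolding topspace_weighted_tuples simplex_iff[OF m]
    using t s ox[of 0] m by (auto simp: omit_def)
qed

lemma test_measure_delete:
  assumes "i \<le> m" "t i = 0"
  shows "test_measure m (omit i t, omit i x) = test_measure (Suc m) (t, x)"
proof -
  have "omit i t j * \<phi> (omit i x j) = omit i (\<lambda>j. t j * \<phi> (x j)) j" for \<phi> j by (simp add: omit_def)
  then have "(\<Sum>j<Suc m. t j * \<phi> (x j)) = (\<Sum>j<m. omit i t j * \<phi> (omit i x j))" for \<phi>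
    using sum_omit[OF assms(1), of "\<lambda>j. t j * \<phi> (x j)"] assms(2) by simp
  then show ?thesis by (simp add: test_measure_def wsum_def fun_eq_iff)
qed

lemma test_measure_merge:
  assumes "m \<ge> 1" "x 0 = x 1"
  shows "test_measure m ((omit 0 t)(0 := t 0 + t 1), omit 0 x) = test_measure (Suc m) (t, x)"
proof -
  have "(\<Sum>j<m. ((omit 0 t)(0 := t 0 + t 1)) j * \<phi> (omit 0 x j)) = (\<Sum>j<Suc m. t j * \<phi> (x j))" for \<phi>
  proof -
    have "(\<Sum>j<m. ((omit 0 t)(0 := t 0 + t 1)) j * \<phi> (omit 0 x j)) =
        (\<Sum>j<m. omit 0 (\<lambda>j. t j * \<phi> (x j)) j + (if j = 0 then t 0 * \<phi> (x 0) else 0))"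
      using assms(2) by (intro sum.cong) (auto simp: omit_def algebra_simps)
    also have "\<dots> = (\<Sum>j<m. omit 0 (\<lambda>j. t j * \<phi> (x j)) j) + t 0 * \<phi> (x 0)"
      using assms(1) by (simp add: sum.distrib)
    finally show ?thesis using sum_omit[of 0 m "\<lambda>j. t j * \<phi> (x j)"] by simp
  qed
  then show ?thesis by (simp add: test_measure_def wsum_def fun_eq_iff)
qed

lemma test_measure_perm:
  assumes "perm_pair_rel m z w"
  shows "test_measure m z = test_measure m w"
proof -
  obtain p where p: "p permutes {..<m}" "w = (fst z \<circ> p, snd z \<circ> p)"
    using assms by (auto simp: perm_pair_rel_def)
  show ?thesis
    unfolding test_measure_eq_iff p(2)
    by (intro same_sum_imp_same_measure same_sum_permI[OF p(1)]) auto
qed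

text \<open>Any representative would do, since \<open>test_measure\<close> is constant on
  orbits.\<close>

definition sum_measure :: "nat \<times> config set \<Rightarrow> ((nat \<Rightarrow> real) \<Rightarrow> real) \<Rightarrow> real" where
  "sum_measure z = test_measure (fst z) (SOME c. c \<in> snd z)"

lemma sum_measure_class:
  "sum_measure (m, quot_class (weighted_tuples X m) (perm_pair_rel m) c) = test_measure m c"
proof -
  let ?C = "quot_class (weighted_tuples X m) (perm_pair_rel m) c"
  have "c \<in> ?C" by (simp add: quot_class_def)
  then have "(SOME d. d \<in> ?C) \<in> ?C" by (rule someI)
  then have "test_measure m c = test_measure m (SOME d. d \<in> ?C)"
    unfolding quot_class_def mem_Collect_eq
    by (rule equivclp_invariant) (simp add: test_measure_perm)
  then show ?thesis by (simp add: sum_measure_def)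
qed

lemma sum_measure_formal_sum: "sum_measure (formal_sum X m t x) = test_measure m (t, x)"
  unfolding formal_sum_def by (rule sum_measure_class)

lemma sum_measure_barycenter_rel:
  assumes "barycenter_rel X a b" shows "sum_measure a = sum_measure b"
  using assms
proof cases
  case (delete t x m i)
  then show ?thesis by (simp only: sum_measure_formal_sum test_measure_delete)
next
  case (merge t x m)
  then show ?thesis by (simp only: sum_measure_formal_sum test_measure_merge)
qed

section \<open>Reduced formal sums\<close>

lemma formal_sum_perm:
  assumes "(t, x) \<in> topspace (weighted_tuples X m)" and p: "p permutes {..<m}" and m: "m \<ge> 1"
  shows "(t \<circ> p, x \<circ> p) \<in> topspace (weighted_tuples X m)" "formal_sum X m (t \<circ> p) (x \<circ> p) = formal_sum X m t x"
proof -
  have out: "p j = j" if "m \<le> j" for j using p that by (simp add: permutes_not_in)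
  have lt: "p j < m \<longleftrightarrow> j < m" for j using permutes_in_image[OF p, of j] by simp
  have t: "\<And>j. 0 \<le> t j" "\<And>j. m \<le> j \<Longrightarrow> t j = 0" "(\<Sum>j<m. t j) = 1"
    using assms(1) simplex_iff[OF m, of t] unfolding topspace_weighted_tuples by auto
  have "(\<Sum>j<m. (t \<circ> p) j) = 1" using sum.permute[OF p, of t] t(3) by simp
  then show 1: "(t \<circ> p, x \<circ> p) \<in> topspace (weighted_tuples X m)"
    using assms(1) t out lt unfolding topspace_weighted_tuples simplex_iff[OF m] by (auto simp: PiE_iff extensional_def)
  have "perm_pair_rel m (t, x) (t \<circ> p, x \<circ> p)" using p by (auto simp: perm_pair_rel_def)
  then have "quot_class (weighted_tuples X m) (perm_pair_rel m) (t, x) = quot_class (weighted_tuples X m) (perm_pair_rel m) (t \<circ> p, x \<circ> p)"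
    unfolding quot_class_eq_iff using assms(1) 1 by (intro r_into_equivclp conjI)
  then show "formal_sum X m (t \<circ> p) (x \<circ> p) = formal_sum X m t x" by (simp add: formal_sum_def)
qed

lemma formal_sum_topspace:
  assumes "(t, x) \<in> topspace (weighted_tuples X m)" "m \<in> {1..n}"
  shows "formal_sum X m t x \<in> topspace (sum_topology (sym_weighted_tuples X) {1..n})"
  using assms by (simp add: formal_sum_def sym_weighted_tuples_def)

abbreviation barycenter_class :: "'a topology \<Rightarrow> nat \<Rightarrow> nat \<times> ((nat \<Rightarrow> real) \<times> (nat \<Rightarrow> 'a)) set \<Rightarrow> (nat \<times> ((nat \<Rightarrow> real) \<times> (nat \<Rightarrow> 'a)) set) set" where
  "barycenter_class X n \<equiv> quot_class (sum_topology (sym_weighted_tuples X) {1..n}) (barycenter_rel X)"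

lemma barycenter_class_eqI:
  assumes "barycenter_rel X a b" "a \<in> topspace (sum_topology (sym_weighted_tuples X) {1..n})"
    "b \<in> topspace (sum_topology (sym_weighted_tuples X) {1..n})"
  shows "barycenter_class X n a = barycenter_class X n b"
  unfolding quot_class_eq_iff by (intro r_into_equivclp conjI assms)

text \<open>As long as a weight is 0 or a position repeats, deletion or merging shortens the sum. A
  sum of length 1 is reduced, because its weight is 1.\<close>

lemma formal_sum_reduced:
  assumes "(t, x) \<in> topspace (weighted_tuples X m)" "m \<in> {1..n}"
  shows "\<exists>m' t' x'. m' \<in> {1..n} \<and> (t', x') \<in> topspace (weighted_tuples X m') \<and> inj_on x' {..<m'} \<and> (\<forall>i<m'. t' i \<noteq> 0)
    \<and> barycenter_class X n (formal_sum X m t x) = barycenter_class X n (formal_sum X m' t' x')"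
  using assms
proof (induction m arbitrary: t x)
  case 0 then show ?case by simp
next
  case (Suc m)
  show ?case
  proof (cases "inj_on x {..<Suc m} \<and> (\<forall>i<Suc m. t i \<noteq> 0)")
    case True
    with Suc.prems show ?thesis by blast
  next
    case False
    have m1: "m \<ge> 1"
    proof (rule ccontr)
      assume "\<not> m \<ge> 1"
      then have "m = 0" by simp
      then have "t 0 = 1" using Suc.prems(1) simplex_iff[of 1 t] by (simp add: topspace_weighted_tuples)
      then show False using False \<open>m = 0\<close> by (simp add: inj_on_def)
    qed
    have mn: "m \<in> {1..n}" using m1 Suc.prems(2) by simp
    have "\<exists>t' x'. (t', x') \<in> topspace (weighted_tuples X m) \<and>
      barycenter_class X n (formal_sum X (Suc m) t x) = barycenter_class X n (formal_sum X m t' x')"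
    proof (cases "\<forall>i<Suc m. t i \<noteq> 0")
      case False
      then obtain i where i: "i \<le> m" "t i = 0" by (auto simp: less_Suc_eq_le)
      have o: "(omit i t, omit i x) \<in> topspace (weighted_tuples X m)" by (rule omit_topspace(1)[OF Suc.prems(1) m1 i])
      have "barycenter_class X n (formal_sum X (Suc m) t x) = barycenter_class X n (formal_sum X m (omit i t) (omit i x))"
        by (rule barycenter_class_eqI[OF barycenter_rel.delete[where i = i]])
          (fact Suc.prems m1 i formal_sum_topspace[OF Suc.prems] formal_sum_topspace[OF o mn])+
      with o show ?thesis by blast
    next
      case True
      then have "\<not> inj_on x {..<Suc m}" using False by blast
      then obtain i j where ij: "i < Suc m" "j < Suc m" "i \<noteq> j" "x i = x j" by (auto simp: inj_on_def)
      \<comment> \<open>Merging applies to the entries 0 and 1 only, so the coincident entries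
        \<open>i\<close> and \<open>j\<close> are moved there. The second transposition fixes 0
        because \<open>a j \<noteq> 0\<close>.\<close>
      define a where "a = Transposition.transpose 0 i"
      define b where "b = Transposition.transpose 1 (a j)"
      define p where "p = a \<circ> b"
      have ai: "a permutes {..<Suc m}" unfolding a_def using ij by (intro permutes_swap_id) auto
      have aj: "a j \<in> {..<Suc m}" "a j \<noteq> 0"
        using ij permutes_in_image[OF ai, of j] by (auto simp: a_def Transposition.transpose_def)
      have bi: "b permutes {..<Suc m}" unfolding b_def using aj m1 by (intro permutes_swap_id) auto
      have p: "p permutes {..<Suc m}" unfolding p_def by (rule permutes_compose[OF bi ai])
      have p0: "p 0 = i" using aj by (simp add: p_def b_def a_def Transposition.transpose_def)
      have p1: "p 1 = j"
      proof -
        have "p 1 = a (a j)" by (simp add: p_def b_def)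
        then show ?thesis by (simp add: a_def)
      qed
      note P = formal_sum_perm[OF Suc.prems(1) p, simplified]
      have x01: "(x \<circ> p) 0 = (x \<circ> p) 1" using p0 p1 ij by simp
      let ?t = "(omit 0 (t \<circ> p))(0 := (t \<circ> p) 0 + (t \<circ> p) 1)" and ?x = "omit 0 (x \<circ> p)"
      have o: "(?t, ?x) \<in> topspace (weighted_tuples X m)"
        by (rule omit_topspace(2)[OF P(1) m1 le0 refl])
      have "barycenter_class X n (formal_sum X (Suc m) (t \<circ> p) (x \<circ> p)) = barycenter_class X n (formal_sum X m ?t ?x)"
        by (rule barycenter_class_eqI[OF barycenter_rel.merge])
          (fact P(1) m1 x01 formal_sum_topspace[OF P(1) Suc.prems(2)] formal_sum_topspace[OF o mn])+
      with o show ?thesis unfolding P(2) by blast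
    qed
    then obtain t' x' where tx': "(t', x') \<in> topspace (weighted_tuples X m)"
      "barycenter_class X n (formal_sum X (Suc m) t x) = barycenter_class X n (formal_sum X m t' x')" by blast
    show ?thesis unfolding tx'(2) by (rule Suc.IH[OF tx'(1) mn])
  qed
qed

lemma reduced_positions:
  assumes "inj_on x {..<m}" "\<forall>i<m. t i \<noteq> 0"
  shows "wsum m (t, x) (\<lambda>a z. a * (if z = y then 1 else 0)) \<noteq> 0 \<longleftrightarrow> y \<in> x ` {..<m}"
    and "i < m \<Longrightarrow> wsum m (t, x) (\<lambda>a z. a * (if z = x i then 1 else 0)) = t i"
proof -
  show at: "wsum m (t, x) (\<lambda>a z. a * (if z = x i then 1 else 0)) = t i" if i: "i < m" for i
  proof -
    have "wsum m (t, x) (\<lambda>a z. a * (if z = x i then 1 else 0)) = (\<Sum>j<m. if j = i then t i else 0)"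
      unfolding wsum_def using assms(1) i by (intro sum.cong) (auto simp: inj_on_def)
    then show ?thesis using i by simp
  qed
  show "wsum m (t, x) (\<lambda>a z. a * (if z = y then 1 else 0)) \<noteq> 0 \<longleftrightarrow> y \<in> x ` {..<m}"
  proof
    assume "y \<in> x ` {..<m}"
    then obtain i where "i < m" "y = x i" by auto
    then show "wsum m (t, x) (\<lambda>a z. a * (if z = y then 1 else 0)) \<noteq> 0" using at[of i] assms(2) by simp
  next
    assume h: "wsum m (t, x) (\<lambda>a z. a * (if z = y then 1 else 0)) \<noteq> 0"
    show "y \<in> x ` {..<m}"
    proof (rule ccontr)
      assume "y \<notin> x ` {..<m}"
      then have "wsum m (t, x) (\<lambda>a z. a * (if z = y then 1 else 0)) = 0"
        unfolding wsum_def by (intro sum.neutral) auto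
      with h show False by simp
    qed
  qed
qed

text \<open>In a reduced sum the positions are the atoms of the measure and the weights their
  masses. So both sums have the same length, and matching equal positions gives the permutation
  between them.\<close>

lemma reduced_unique:
  assumes a: "(t, x) \<in> topspace (weighted_tuples X m)" "inj_on x {..<m}" "\<forall>i<m. t i \<noteq> 0" and m: "m \<ge> 1"
    and a': "(t', x') \<in> topspace (weighted_tuples X m')" "inj_on x' {..<m'}" "\<forall>i<m'. t' i \<noteq> 0" and m': "m' \<ge> 1"
    and e: "test_measure m (t, x) = test_measure m' (t', x')"
  shows "formal_sum X m t x = formal_sum X m' t' x'"
proof -
  note all = test_measure_all[OF e]
  have im: "x ` {..<m} = x' ` {..<m'}"
  proof (rule Set.set_eqI)
    show "y \<in> x ` {..<m} \<longleftrightarrow> y \<in> x' ` {..<m'}" for y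
      using reduced_positions(1)[OF a(2,3), of y] reduced_positions(1)[OF a'(2,3), of y]
        all[of "\<lambda>z. if z = y then 1 else 0"] by simp
  qed
  have mm: "m' = m" using card_image[OF a(2)] card_image[OF a'(2)] im by simp
  define p where "p i = (if i < m then inv_into {..<m} x (x' i) else i)" for i
  have px: "p i < m \<and> x (p i) = x' i" if "i < m" for i
  proof -
    have "x' i \<in> x ` {..<m}" using im that mm by blast
    then show ?thesis using that inv_into_into[of "x' i" x "{..<m}"] f_inv_into_f[of "x' i" x "{..<m}"] by (simp add: p_def)
  qed
  have "inj_on p {..<m}"
  proof (rule inj_onI)
    fix i j assume "i \<in> {..<m}" "j \<in> {..<m}" "p i = p j"
    then show "i = j" using px[of i] px[of j] inj_onD[OF a'(2), of i j] mm by simp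
  qed
  then have "p ` {..<m} = {..<m}" using px by (intro endo_inj_surj) auto
  then have p: "p permutes {..<m}"
    using \<open>inj_on p {..<m}\<close> by (intro bij_imp_permutes) (auto simp: bij_betw_def p_def)
  have xp: "x' = x \<circ> p"
  proof
    fix i show "x' i = (x \<circ> p) i"
      using px[of i] a(1) a'(1) mm by (cases "i < m") (auto simp: p_def topspace_weighted_tuples PiE_iff extensional_def)
  qed
  have tp: "t' = t \<circ> p"
  proof
    fix i show "t' i = (t \<circ> p) i"
    proof (cases "i < m")
      case True
      have "t' i = wsum m (t', x') (\<lambda>a z. a * (if z = x' i then 1 else 0))"
        using reduced_positions(2)[OF a'(2,3)] True mm by simp
      also have "\<dots> = wsum m (t, x) (\<lambda>a z. a * (if z = x (p i) then 1 else 0))"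
        using all[of "\<lambda>z. if z = x' i then 1 else 0"] px[OF True] mm by simp
      also have "\<dots> = t (p i)" using reduced_positions(2)[OF a(2,3), of "p i"] px[OF True] by simp
      finally show ?thesis by simp
    next
      case False
      then show ?thesis
        using a(1) a'(1) mm simplex_iff[OF m] by (simp add: p_def topspace_weighted_tuples)
    qed
  qed
  show ?thesis unfolding mm xp tp by (rule formal_sum_perm(2)[OF a(1) p m, symmetric])
qed

text \<open>Deletion and merging preserve the measure; conversely, both points reduce, and reduced
  sums with the same measure are the same formal sum.\<close>

lemma sum_measure_eq_iff:
  assumes z: "z \<in> topspace (sum_topology (sym_weighted_tuples X) {1..n})"
    and z': "z' \<in> topspace (sum_topology (sym_weighted_tuples X) {1..n})"
  shows "barycenter_class X n z = barycenter_class X n z' \<longleftrightarrow> sum_measure z = sum_measure z'"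
proof
  assume "barycenter_class X n z = barycenter_class X n z'"
  then show "sum_measure z = sum_measure z'"
    unfolding quot_class_eq_iff by (rule equivclp_invariant) (auto intro: sum_measure_barycenter_rel)
next
  assume e: "sum_measure z = sum_measure z'"
  have rep: "\<exists>m t x. m \<in> {1..n} \<and> (t, x) \<in> topspace (weighted_tuples X m) \<and> inj_on x {..<m} \<and> (\<forall>i<m. t i \<noteq> 0)
    \<and> barycenter_class X n z = barycenter_class X n (formal_sum X m t x) \<and> sum_measure z = test_measure m (t, x)"
    if "z \<in> topspace (sum_topology (sym_weighted_tuples X) {1..n})" for z
  proof -
    define m where "m = fst z"
    have "m \<in> {1..n}" "snd z \<in> quot_class (weighted_tuples X m) (perm_pair_rel m) ` topspace (weighted_tuples X m)"
      using that by (auto simp: sym_weighted_tuples_def m_def)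
    then obtain c where c: "z = (m, quot_class (weighted_tuples X m) (perm_pair_rel m) c)" "m \<in> {1..n}" "c \<in> topspace (weighted_tuples X m)"
      by (auto simp: m_def prod_eq_iff)
    obtain t x where tx: "c = (t, x)" by (cases c)
    then have z: "z = formal_sum X m t x" using c by (simp add: formal_sum_def)
    obtain m' t' x' where r: "m' \<in> {1..n}" "(t', x') \<in> topspace (weighted_tuples X m')" "inj_on x' {..<m'}" "\<forall>i<m'. t' i \<noteq> 0"
      "barycenter_class X n (formal_sum X m t x) = barycenter_class X n (formal_sum X m' t' x')"
      using formal_sum_reduced[OF c(3)[unfolded tx] c(2)] by blast
    have "sum_measure (formal_sum X m t x) = sum_measure (formal_sum X m' t' x')"
      using r(5) unfolding quot_class_eq_iff by (rule equivclp_invariant) (auto intro: sum_measure_barycenter_rel)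
    then have "test_measure m (t, x) = test_measure m' (t', x')" by (simp only: sum_measure_formal_sum)
    then have "sum_measure z = test_measure m' (t', x')" unfolding z sum_measure_formal_sum .
    moreover have "barycenter_class X n z = barycenter_class X n (formal_sum X m' t' x')" unfolding z by (rule r(5))
    ultimately show ?thesis using r(1-4) by (intro exI[of _ m'] exI[of _ t'] exI[of _ x'] conjI)
  qed
  obtain m t x where r: "m \<in> {1..n}" "(t, x) \<in> topspace (weighted_tuples X m)" "inj_on x {..<m}" "\<forall>i<m. t i \<noteq> 0"
    "barycenter_class X n z = barycenter_class X n (formal_sum X m t x)" "sum_measure z = test_measure m (t, x)"
    using rep[OF z] by blast
  obtain m' t' x' where r': "m' \<in> {1..n}" "(t', x') \<in> topspace (weighted_tuples X m')" "inj_on x' {..<m'}" "\<forall>i<m'. t' i \<noteq> 0"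
    "barycenter_class X n z' = barycenter_class X n (formal_sum X m' t' x')" "sum_measure z' = test_measure m' (t', x')"
    using rep[OF z'] by blast
  have "formal_sum X m t x = formal_sum X m' t' x'"
  proof (rule reduced_unique[OF r(2-4) _ r'(2-4)])
    show "m \<ge> 1" "m' \<ge> 1" using r(1) r'(1) by simp_all
    show "test_measure m (t, x) = test_measure m' (t', x')" by (rule e[unfolded r(6) r'(6)])
  qed
  then show "barycenter_class X n z = barycenter_class X n z'"
    unfolding r(5) r'(5) by (rule arg_cong)
qed

section \<open>Barycenters as a quotient of the space of configurations\<close>

lemma nsphere_top_of_set: "nsphere k = top_of_set (sphere_set k)"
  by (simp add: nsphere euclidean_product_topology)

lemma continuous_map_test_measure_weighted_tuples:
  "continuous_map (weighted_tuples (nsphere k) m) (powertop_real UNIV) (test_measure m)"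
proof (rule continuous_map_real_family)
  fix \<phi> :: "(nat \<Rightarrow> real) \<Rightarrow> real"
  let ?W = "weighted_tuples (nsphere k) m"
  show "continuous_map ?W euclideanreal (\<lambda>c. test_measure m c \<phi>)"
  proof (cases "continuous_on UNIV \<phi>")
    case True
    have f: "continuous_map ?W (subtopology (powertop_real UNIV) (standard_simplex (m - 1))) fst"
      unfolding weighted_tuples_def by (rule continuous_map_fst)
    have s: "continuous_map ?W (product_topology (\<lambda>_. nsphere k) {..<m}) snd"
      unfolding weighted_tuples_def by (rule continuous_map_snd)
    have t: "continuous_map ?W euclideanreal (\<lambda>c. fst c i)" for i
    proof -
      have "continuous_map (subtopology (powertop_real UNIV) (standard_simplex (m - 1))) euclideanreal (\<lambda>t. t i)"
        by (intro continuous_map_from_subtopology continuous_map_product_projection) simp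
      from continuous_map_compose[OF f this] show ?thesis by (simp add: o_def)
    qed
    have x: "continuous_map ?W euclideanreal (\<lambda>c. \<phi> (snd c i))" if "i < m" for i
    proof -
      have "continuous_map (product_topology (\<lambda>_. nsphere k) {..<m}) (nsphere k) (\<lambda>x. x i)"
        by (rule continuous_map_product_projection) (simp add: that)
      moreover have "continuous_map (nsphere k) euclideanreal \<phi>"
        using continuous_on_subset[OF True subset_UNIV] by (subst nsphere_top_of_set) simp
      ultimately have "continuous_map (product_topology (\<lambda>_. nsphere k) {..<m}) euclideanreal (\<phi> \<circ> (\<lambda>x. x i))"
        by (rule continuous_map_compose)
      from continuous_map_compose[OF s this] show ?thesis by (simp add: o_def)
    qed
    have "continuous_map ?W euclideanreal (\<lambda>c. \<Sum>i<m. fst c i * \<phi> (snd c i))"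
      by (intro continuous_map_sum continuous_map_real_mult t x) simp_all
    then show ?thesis using True by (simp add: test_measure_def wsum_def)
  next
    case False
    then show ?thesis by (simp add: test_measure_def)
  qed
qed

lemma continuous_map_test_measure_configs:
  "continuous_map (top_of_set (configs n k)) (powertop_real UNIV) (test_measure n)"
proof (rule continuous_map_real_family)
  fix \<phi> :: "(nat \<Rightarrow> real) \<Rightarrow> real"
  have "continuous_on (configs n k) (\<lambda>c. \<Sum>i<n. fst c i * \<phi> (snd c i))" if "continuous_on UNIV \<phi>"
  proof (intro continuous_on_sum continuous_on_mult)
    show "continuous_on (configs n k) (\<lambda>c. fst c i)" for i
      by (rule continuous_on_product_then_coordinatewise[OF continuous_on_fst[OF continuous_on_id]])
    show "continuous_on (configs n k) (\<lambda>c. \<phi> (snd c i))" for i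
      by (rule continuous_on_compose2[OF that
          continuous_on_product_then_coordinatewise[OF continuous_on_snd[OF continuous_on_id]]]) simp
  qed
  then show "continuous_map (top_of_set (configs n k)) euclideanreal (\<lambda>c. test_measure n c \<phi>)"
    by (simp add: test_measure_def wsum_def)
qed

lemma sum_measure_image:
  assumes n: "1 \<le> n"
  shows "sum_measure ` topspace (sum_topology (sym_weighted_tuples (nsphere k)) {1..n}) = test_measure n ` configs n k"
proof
  let ?S = "sum_topology (sym_weighted_tuples (nsphere k)) {1..n}"
  show "sum_measure ` topspace ?S \<subseteq> test_measure n ` configs n k"
  proof
    fix f assume "f \<in> sum_measure ` topspace ?S"
    then obtain z where z: "z \<in> topspace ?S" "f = sum_measure z" by blast
    define m where "m = fst z"
    have m: "m \<in> {1..n}" "snd z \<in> quot_class (weighted_tuples (nsphere k) m) (perm_pair_rel m) ` topspace (weighted_tuples (nsphere k) m)"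
      using z by (auto simp: sym_weighted_tuples_def m_def)
    then obtain c where c: "z = (m, quot_class (weighted_tuples (nsphere k) m) (perm_pair_rel m) c)"
      "c \<in> topspace (weighted_tuples (nsphere k) m)"
      by (auto simp: m_def prod_eq_iff)
    obtain t x where tx: "c = (t, x)" by (cases c)
    \<comment> \<open>A shorter sum is padded with weights 0, placed at a base point of the
      sphere.\<close>
    define y :: "nat \<Rightarrow> nat \<Rightarrow> real" where "y i = (if i < m then x i else (\<lambda>j. if j = 0 then 1 else 0))" for i
    have t: "t \<in> standard_simplex (m - 1)" and x: "\<And>i. i < m \<Longrightarrow> x i \<in> sphere_set k"
      using c(2) unfolding tx topspace_weighted_tuples by auto
    have "(t, y) \<in> configs n k"
    proof -
      have "m - 1 \<le> n - 1" using m(1) by (intro diff_le_mono) simp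
      from subsetD[OF standard_simplex_mono[OF this] t] have "t \<in> standard_simplex (n - 1)" .
      moreover have "y i \<in> sphere_set k" for i
        unfolding y_def using x[of i] sphere_set_nonempty[of k] by (cases "i < m") simp_all
      ultimately show ?thesis by (simp add: configs_def)
    qed
    moreover have "test_measure n (t, y) = test_measure m (t, x)"
    proof -
      have z: "t i = 0" if "m \<le> i" for i using t simplex_iff[of m t] m(1) that by auto
      have "(\<Sum>i<n. t i * \<phi> (y i)) = (\<Sum>i<m. t i * \<phi> (x i))" for \<phi> :: "(nat \<Rightarrow> real) \<Rightarrow> real"
      proof -
        have "(\<Sum>i<n. t i * \<phi> (y i)) = (\<Sum>i<m. t i * \<phi> (y i))"
          using z m(1) by (intro sum.mono_neutral_right) auto
        also have "\<dots> = (\<Sum>i<m. t i * \<phi> (x i))"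
          by (intro sum.cong) (auto simp: y_def)
        finally show ?thesis .
      qed
      then show ?thesis by (simp add: test_measure_def wsum_def fun_eq_iff)
    qed
    moreover have "f = test_measure m (t, x)" unfolding z(2) c(1) sum_measure_class tx ..
    ultimately show "f \<in> test_measure n ` configs n k"
      by (intro image_eqI[of f "test_measure n" "(t, y)"]) simp_all
  qed
  show "test_measure n ` configs n k \<subseteq> sum_measure ` topspace ?S"
  proof
    fix f assume "f \<in> test_measure n ` configs n k"
    then obtain t x where tx: "(t, x) \<in> configs n k" "f = test_measure n (t, x)" by auto
    let ?x = "restrict x {..<n}"
    have "(t, ?x) \<in> topspace (weighted_tuples (nsphere k) n)"
      using tx(1) by (auto simp: configs_def topspace_weighted_tuples)
    then have "formal_sum (nsphere k) n t ?x \<in> topspace ?S" by (rule formal_sum_topspace) (use n in simp)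
    moreover have "test_measure n (t, ?x) = f"
      unfolding tx(2) test_measure_eq_iff by (simp add: same_measure_def wsum_def)
    ultimately show "f \<in> sum_measure ` topspace ?S"
      by (intro image_eqI[of f sum_measure "formal_sum (nsphere k) n t ?x"]) (simp_all only: sum_measure_formal_sum)
  qed
qed

lemma barycenter_space_homeomorphic:
  assumes n: "1 \<le> n"
  shows "barycenter_space n (nsphere k) homeomorphic_space quotient_space (top_of_set (configs n k)) (same_measure n)"
proof -
  let ?S = "sum_topology (sym_weighted_tuples (nsphere k)) {1..n}"
  let ?T = "powertop_real (UNIV :: ((nat \<Rightarrow> real) \<Rightarrow> real) set)"
  have cs: "compact_space (nsphere k)"
    by (subst nsphere_top_of_set) (rule compact_space_subtopology, simp add: compact_sphere_set)
  have sym: "compact_space (sym_weighted_tuples (nsphere k) m)" for m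
    unfolding sym_weighted_tuples_def
    by (rule compact_space_quotient_map[OF quotient_map_quot_class compact_weighted_tuples[OF cs]])
  have cS: "compact_space ?S" by (rule compact_space_sum_topology) (simp_all add: sym)
  have cont: "continuous_map ?S ?T sum_measure"
  proof (rule continuous_map_from_sum_topology)
    fix m
    show "continuous_map (sym_weighted_tuples (nsphere k) m) ?T (\<lambda>C. sum_measure (m, C))"
      unfolding sym_weighted_tuples_def
    proof (rule continuous_compose_quotient_map[OF quotient_map_quot_class])
      show "continuous_map (weighted_tuples (nsphere k) m) ?T
        ((\<lambda>C. sum_measure (m, C)) \<circ> quot_class (weighted_tuples (nsphere k) m) (perm_pair_rel m))"
        unfolding o_def sum_measure_class by (rule continuous_map_test_measure_weighted_tuples)
    qed
  qed
  have "barycenter_space n (nsphere k) homeomorphic_space subtopology ?T (sum_measure ` topspace ?S)"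
    unfolding barycenter_space_def
    by (rule homeomorphic_space_image[OF cS quotient_map_quot_class Hausdorff_powertop_real cont]) (rule sum_measure_eq_iff)
  moreover have "quotient_space (top_of_set (configs n k)) (same_measure n) homeomorphic_space
      subtopology ?T (test_measure n ` topspace (top_of_set (configs n k)))"
  proof (rule homeomorphic_space_image[OF _ quotient_map_quot_class Hausdorff_powertop_real continuous_map_test_measure_configs])
    show "compact_space (top_of_set (configs n k))" using compact_configs by (simp add: compact_space_subtopology)
    show "quot_class (top_of_set (configs n k)) (same_measure n) c = quot_class (top_of_set (configs n k)) (same_measure n) c'
      \<longleftrightarrow> test_measure n c = test_measure n c'"
      if "c \<in> topspace (top_of_set (configs n k))" "c' \<in> topspace (top_of_set (configs n k))" for c c'
      unfolding test_measure_eq_iff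
    proof (rule quot_class_eq_iff_equiv[OF _ _ _ that])
      show "same_measure n a a" for a by (rule same_measure_refl)
      show "same_measure n b a" if "same_measure n a b" for a b by (rule same_measure_sym[OF that])
      show "same_measure n a d" if "same_measure n a b" "same_measure n b d" for a b d by (rule same_measure_trans[OF that])
    qed
  qed
  ultimately show ?thesis
    unfolding topspace_euclidean_subtopology sum_measure_image[OF n]
    by (rule homeomorphic_space_trans[OF _ homeomorphic_space_sym[THEN iffD1]])
qed

section \<open>The join with the sphere\<close>

text \<open>The unordered tuple of the vectors \<open>v i\<close> with \<open>i < n\<close>, encoded
  as a sum of point masses: a continuous invariant of the orbits of the symmetric group.\<close>

definition msum :: "nat \<Rightarrow> (nat \<Rightarrow> nat \<Rightarrow> real) \<Rightarrow> ((nat \<Rightarrow> real) \<Rightarrow> real) \<Rightarrow> real" where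
  "msum n v = (\<lambda>g. if continuous_on UNIV g then \<Sum>i<n. g (v i) else 0)"

lemma msum_cong: "(\<And>i. i < n \<Longrightarrow> v i = v' i) \<Longrightarrow> msum n v = msum n v'"
proof -
  assume v: "\<And>i. i < n \<Longrightarrow> v i = v' i"
  have "(\<Sum>i<n. g (v i)) = (\<Sum>i<n. g (v' i))" for g :: "_ \<Rightarrow> real"
    using v by (intro sum.cong) auto
  then show ?thesis by (simp add: msum_def fun_eq_iff)
qed

text \<open>Interpolated indicator functions recover the multiplicity of every vector.\<close>

lemma msum_eq_iff:
  "msum n v = msum n v' \<longleftrightarrow> (\<exists>p. p permutes {..<n} \<and> (\<forall>i<n. v' i = v (p i)))"
proof
  assume "\<exists>p. p permutes {..<n} \<and> (\<forall>i<n. v' i = v (p i))"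
  then obtain p where p: "p permutes {..<n}" "\<forall>i<n. v' i = v (p i)" by blast
  have "(\<Sum>i<n. g (v i)) = (\<Sum>i<n. g (v' i))" for g :: "_ \<Rightarrow> real"
    using sum.permute[OF p(1), of "\<lambda>i. g (v i)"] p(2) by simp
  then show "msum n v = msum n v'" by (simp add: msum_def fun_eq_iff)
next
  assume e: "msum n v = msum n v'"
  have "card {i\<in>{..<n}. v' i = y} = card {i\<in>{..<n}. v i = y}" for y
  proof -
    have "finite (insert y (v ` {..<n} \<union> v' ` {..<n}))" by simp
    then obtain g where g: "continuous_on UNIV g"
      "\<And>z. z \<in> insert y (v ` {..<n} \<union> v' ` {..<n}) \<Longrightarrow> g z = (if z = y then 1 else 0 :: real)"
      by (rule finite_continuous_interpolation[where G = "\<lambda>z. if z = y then 1 else 0"]) (rule that)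
    have "(\<Sum>i<n. g (v i)) = (\<Sum>i<n. g (v' i))" using fun_cong[OF e, of g] g(1) by (simp add: msum_def)
    moreover have "(\<Sum>i<n. g (v i)) = (\<Sum>i<n. if v i = y then 1 else 0)" using g(2) by (intro sum.cong) auto
    moreover have "(\<Sum>i<n. g (v' i)) = (\<Sum>i<n. if v' i = y then 1 else 0)" using g(2) by (intro sum.cong) auto
    ultimately show ?thesis by (simp add: sum.If_cases Int_def)
  qed
  then have "image_mset v' (mset_set {..<n}) = image_mset v (mset_set {..<n})"
    by (intro image_mset_eq_of_card) auto
  from image_mset_eq_implies_permutes[OF _ this] obtain p where "p permutes {..<n}" "\<forall>i\<in>{..<n}. v' i = v (p i)"
    by blast
  then show "\<exists>p. p permutes {..<n} \<and> (\<forall>i<n. v' i = v (p i))" by (intro exI[of _ p]) simp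
qed

lemma continuous_map_msum:
  assumes "\<And>i j. i < n \<Longrightarrow> continuous_map X euclideanreal (\<lambda>z. v z i j)"
  shows "continuous_map X (powertop_real UNIV) (\<lambda>z. msum n (v z))"
proof (rule continuous_map_real_family)
  fix g :: "(nat \<Rightarrow> real) \<Rightarrow> real"
  show "continuous_map X euclideanreal (\<lambda>z. msum n (v z) g)"
  proof (cases "continuous_on UNIV g")
    case True
    have "continuous_map X euclideanreal (\<lambda>z. g (v z i))" if "i < n" for i
    proof -
      have "continuous_map X (powertop_real UNIV) (\<lambda>z. v z i)"
        by (rule continuous_map_real_family) (rule assms[OF that])
      then have v: "continuous_map X euclidean (\<lambda>z. v z i)" by (simp add: euclidean_product_topology)
      have "continuous_map euclidean euclideanreal g" using True by simp
      from continuous_map_compose[OF v this] show ?thesis by (simp add: o_def)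
    qed
    then have "continuous_map X euclideanreal (\<lambda>z. \<Sum>i<n. g (v z i))" by (intro continuous_map_sum) auto
    then show ?thesis using True by (simp add: msum_def)
  next
    case False
    then show ?thesis by (simp add: msum_def)
  qed
qed

definition sqn :: "nat \<Rightarrow> (nat \<Rightarrow> real) \<Rightarrow> real" where
  "sqn k v = (\<Sum>j\<le>k. (v j)\<^sup>2)"

definition unit_tuples :: "nat \<Rightarrow> nat \<Rightarrow> (nat \<Rightarrow> nat \<Rightarrow> real) set" where
  "unit_tuples n k = {v. (\<forall>i<n. \<forall>j>k. v i j = 0) \<and> (\<Sum>i<n. sqn k (v i)) = 1}"

definition config_vectors :: "config \<Rightarrow> nat \<Rightarrow> nat \<Rightarrow> real" where
  "config_vectors c i = (\<lambda>j. sqrt (fst c i) * snd c i j)"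

lemma sqn_nonneg [simp]: "0 \<le> sqn k v"
  by (simp add: sqn_def sum_nonneg)

lemma sqn_scale: "sqn k (\<lambda>j. a * v j) = a\<^sup>2 * sqn k v"
  by (simp add: sqn_def power_mult_distrib sum_distrib_left)

lemma sqn_eq_0D: "sqn k v = 0 \<Longrightarrow> j \<le> k \<Longrightarrow> v j = 0"
  by (simp add: sqn_def sum_nonneg_eq_0_iff)

lemma sqn_sphere: "x \<in> sphere_set k \<Longrightarrow> sqn k x = 1"
  by (simp add: sqn_def sphere_set_iff)

lemma config_vectors_sqn:
  assumes "n \<ge> 1" "c \<in> configs n k" shows "sqn k (config_vectors c i) = fst c i"
  using assms sqn_sphere[of "snd c i" k] unfolding config_vectors_def sqn_scale configs_iff[OF assms(1)] by simp

text \<open>The squared norm of a vector is its weight, and the direction of a nonzero vector is its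
  position. The zero vector has forgotten its position, just as \<open>same_sum\<close> does for
  weight 0.\<close>

lemma config_vectors_same_sum:
  assumes n: "n \<ge> 1" and c: "c \<in> configs n k" and c': "c' \<in> configs n k"
  shows "msum n (config_vectors c) = msum n (config_vectors c') \<longleftrightarrow> same_sum n c c'"
proof
  assume "msum n (config_vectors c) = msum n (config_vectors c')"
  then obtain p where p: "p permutes {..<n}" and pv: "\<forall>i<n. config_vectors c' i = config_vectors c (p i)"
    unfolding msum_eq_iff by blast
  have t: "fst c' i = fst c (p i)" if "i < n" for i
    using config_vectors_sqn[OF n c, of "p i"] config_vectors_sqn[OF n c', of i] pv that by simp
  have x: "snd c' i = snd c (p i)" if i: "i < n" "fst c' i \<noteq> 0" for i
  proof
    fix j
    have "config_vectors c' i j = config_vectors c (p i) j" using pv i by simp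
    then show "snd c' i j = snd c (p i) j" using t[OF i(1)] i(2) by (simp add: config_vectors_def)
  qed
  show "same_sum n c c'" by (rule same_sum_permI[OF p t x])
next
  assume "same_sum n c c'"
  from same_sum_permD[OF this] obtain p where p: "p permutes {..<n}"
    and pc: "\<forall>i<n. fst c' i = fst c (p i) \<and> (fst c' i \<noteq> 0 \<longrightarrow> snd c' i = snd c (p i))"
    by (elim exE conjE) (rule that)
  have "config_vectors c' i = config_vectors c (p i)" if "i < n" for i
    using pc that by (cases "fst c' i = 0") (simp_all add: config_vectors_def)
  then show "msum n (config_vectors c) = msum n (config_vectors c')" unfolding msum_eq_iff using p by blast
qed

lemma config_vectors_image:
  assumes n: "n \<ge> 1"
  shows "(\<lambda>c. msum n (config_vectors c)) ` configs n k = msum n ` unit_tuples n k"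
proof
  show "(\<lambda>c. msum n (config_vectors c)) ` configs n k \<subseteq> msum n ` unit_tuples n k"
  proof
    fix f assume "f \<in> (\<lambda>c. msum n (config_vectors c)) ` configs n k"
    then obtain c where c: "c \<in> configs n k" "f = msum n (config_vectors c)" by blast
    have "config_vectors c \<in> unit_tuples n k"
      using c(1) config_vectors_sqn[OF n c(1)] unfolding unit_tuples_def configs_iff[OF n]
      by (simp add: config_vectors_def sphere_set_iff)
    then show "f \<in> msum n ` unit_tuples n k" using c(2) by simp
  qed
  show "msum n ` unit_tuples n k \<subseteq> (\<lambda>c. msum n (config_vectors c)) ` configs n k"
  proof
    fix f assume "f \<in> msum n ` unit_tuples n k"
    then obtain v where v: "v \<in> unit_tuples n k" "f = msum n v" by blast
    define t where "t i = (if i < n then sqn k (v i) else 0)" for i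
    \<comment> \<open>A zero vector has no direction; the base point stands in for it, with weight
      0.\<close>
    define x where "x i = (if i < n \<and> sqn k (v i) \<noteq> 0 then radial k (v i) else (\<lambda>j. if j = 0 then 1 else 0))" for i
    have x: "x i \<in> sphere_set k" for i
    proof (cases "i < n \<and> sqn k (v i) \<noteq> 0")
      case True
      then have "0 < sqn k (v i)" using sqn_nonneg[of k "v i"] by linarith
      then have "radial k (v i) \<in> sphere_set k"
        using True v(1) by (intro radial_in_sphere) (auto simp: unit_tuples_def sqn_def)
      then show ?thesis using True by (simp add: x_def)
    next
      case False
      show ?thesis unfolding x_def if_not_P[OF False] by (rule sphere_set_nonempty)
    qed
    have "(t, x) \<in> configs n k"
      unfolding configs_iff[OF n] using x v(1) by (simp add: t_def unit_tuples_def)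
    moreover have "config_vectors (t, x) i = v i" if i: "i < n" for i
    proof
      fix j show "config_vectors (t, x) i j = v i j"
      proof (cases "sqn k (v i) = 0")
        case True
        then have "v i j = 0" using sqn_eq_0D[OF True, of j] v(1) i by (cases "j \<le> k") (auto simp: unit_tuples_def)
        then show ?thesis using i True by (simp add: config_vectors_def t_def)
      next
        case False
        then show ?thesis using i by (simp add: config_vectors_def t_def x_def radial_def sqn_def)
      qed
    qed
    then have "msum n (config_vectors (t, x)) = f" unfolding v(2) by (rule msum_cong)
    ultimately show "f \<in> (\<lambda>c. msum n (config_vectors c)) ` configs n k" by blast
  qed
qed

lemma same_sum_quotient_homeomorphic:
  assumes n: "n \<ge> 1"
  shows "quotient_space (top_of_set (configs n k)) (same_sum n) homeomorphic_space
    subtopology (powertop_real UNIV) (msum n ` unit_tuples n k)"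
proof -
  have cont: "continuous_map (top_of_set (configs n k)) (powertop_real UNIV) (\<lambda>c. msum n (config_vectors c))"
  proof (rule continuous_map_msum)
    fix i j
    have "continuous_on (configs n k) (\<lambda>c. fst c i)"
      by (rule continuous_on_product_then_coordinatewise[OF continuous_on_fst[OF continuous_on_id]])
    moreover have "continuous_on (configs n k) (\<lambda>c. snd c i j)"
      by (rule continuous_on_product_then_coordinatewise[OF
        continuous_on_product_then_coordinatewise[OF continuous_on_snd[OF continuous_on_id]]])
    ultimately have "continuous_on (configs n k) (\<lambda>c. sqrt (fst c i) * snd c i j)"
      by (intro continuous_on_mult continuous_on_real_sqrt)
    then show "continuous_map (top_of_set (configs n k)) euclideanreal (\<lambda>c. config_vectors c i j)"
      by (simp add: config_vectors_def)
  qed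
  have "quotient_space (top_of_set (configs n k)) (same_sum n) homeomorphic_space
    subtopology (powertop_real UNIV) ((\<lambda>c. msum n (config_vectors c)) ` topspace (top_of_set (configs n k)))"
  proof (rule homeomorphic_space_image[OF _ quotient_map_quot_class Hausdorff_powertop_real cont])
    show "compact_space (top_of_set (configs n k))" using compact_configs by (simp add: compact_space_subtopology)
    fix c c' assume cc: "c \<in> topspace (top_of_set (configs n k))" "c' \<in> topspace (top_of_set (configs n k))"
    then have cc': "c \<in> configs n k" "c' \<in> configs n k" by simp_all
    show "quot_class (top_of_set (configs n k)) (same_sum n) c = quot_class (top_of_set (configs n k)) (same_sum n) c'
      \<longleftrightarrow> msum n (config_vectors c) = msum n (config_vectors c')"
      unfolding config_vectors_same_sum[OF n cc']
    proof (rule quot_class_eq_iff_equiv[OF _ _ _ cc])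
      show "same_sum n a a" for a by (rule same_sum_refl)
      show "same_sum n b a" if "same_sum n a b" for a b by (rule same_sum_sym[OF that])
      show "same_sum n a d" if "same_sum n a b" "same_sum n b d" for a b d by (rule same_sum_trans[OF that])
    qed
  qed
  then show ?thesis unfolding topspace_euclidean_subtopology config_vectors_image[OF n] .
qed

section \<open>Coproducts and compactness of the sum-zero sphere\<close>

lemma continuous_map_from_coprod_topology:
  assumes "continuous_map X T (\<lambda>x. f (Inl x))" and "continuous_map Y T (\<lambda>y. f (Inr y))"
  shows "continuous_map (coprod_topology X Y) T f"
  unfolding continuous_map_def
proof (intro conjI allI impI)
  show "f \<in> topspace (coprod_topology X Y) \<rightarrow> topspace T"
    using continuous_map_funspace[OF assms(1)] continuous_map_funspace[OF assms(2)] by (auto simp: Pi_iff)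
  fix U assume U: "openin T U"
  have "Inl -` {z \<in> topspace (coprod_topology X Y). f z \<in> U} = {x \<in> topspace X. f (Inl x) \<in> U}"
    "Inr -` {z \<in> topspace (coprod_topology X Y). f z \<in> U} = {y \<in> topspace Y. f (Inr y) \<in> U}"
    by auto
  then show "openin (coprod_topology X Y) {z \<in> topspace (coprod_topology X Y). f z \<in> U}"
    unfolding openin_coprod_topology using openin_continuous_map_preimage[OF assms(1) U]
      openin_continuous_map_preimage[OF assms(2) U] by simp
qed

lemma compact_space_coprod_topology:
  assumes "compact_space X" "compact_space Y"
  shows "compact_space (coprod_topology X Y)"
proof -
  have inj: "continuous_map X (coprod_topology X Y) Inl" "continuous_map Y (coprod_topology X Y) Inr"
  proof -
    have "{x \<in> topspace X. Inl x \<in> U} = Inl -` U" if "openin (coprod_topology X Y) U" for U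
      using that openin_subset[of X] unfolding openin_coprod_topology by blast
    then show "continuous_map X (coprod_topology X Y) Inl"
      unfolding continuous_map_def by (auto simp: openin_coprod_topology)
    have "{x \<in> topspace Y. Inr x \<in> U} = Inr -` U" if "openin (coprod_topology X Y) U" for U
      using that openin_subset[of Y] unfolding openin_coprod_topology by blast
    then show "continuous_map Y (coprod_topology X Y) Inr"
      unfolding continuous_map_def by (auto simp: openin_coprod_topology)
  qed
  have "compactin (coprod_topology X Y) (Inl ` topspace X \<union> Inr ` topspace Y)"
    using assms by (intro compactin_Un image_compactin[OF _ inj(1)] image_compactin[OF _ inj(2)]) (simp_all add: compact_space_def)
  moreover have "Inl ` topspace X \<union> Inr ` topspace Y = topspace (coprod_topology X Y)" by auto
  ultimately show ?thesis by (simp add: compact_space_def)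
qed

lemma continuous_map_Euclidean_tuple_component:
  assumes "i < n"
  shows "continuous_map (product_topology (\<lambda>_. Euclidean_space m) {..<n}) euclideanreal (\<lambda>w. w i j)"
proof -
  have 1: "continuous_map (product_topology (\<lambda>_. Euclidean_space m) {..<n}) (Euclidean_space m) (\<lambda>w. w i)"
    by (rule continuous_map_product_projection) (simp add: assms)
  have 2: "continuous_map (Euclidean_space m) euclideanreal (\<lambda>x. x j)"
    unfolding Euclidean_space_def by (intro continuous_map_from_subtopology continuous_map_product_projection) simp
  show ?thesis using continuous_map_compose[OF 1 2] by (simp add: o_def)
qed

lemma topspace_sum_zero_sphere:
  "w \<in> topspace (sum_zero_sphere n k) \<longleftrightarrow> (\<forall>i<n. \<forall>j>k. w i j = 0) \<and> (\<forall>i\<ge>n. w i = undefined)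
    \<and> (\<forall>j\<le>k. (\<Sum>i<n. w i j) = 0) \<and> (\<Sum>i<n. sqn k (w i)) = 1"
  unfolding sum_zero_sphere_def sqn_def
  by (auto simp: topspace_Euclidean_space PiE_iff extensional_def Suc_le_eq)

text \<open>The defining equations are closed, and the unit norm confines the tuples to a product of
  cubes.\<close>

lemma compact_sum_zero_sphere: "compact_space (sum_zero_sphere n k)"
proof -
  let ?P = "product_topology (\<lambda>_. Euclidean_space (Suc k)) {..<n}"
  let ?A = "{v. (\<forall>j\<le>k. (\<Sum>i<n. v i j) = 0) \<and> (\<Sum>i<n. \<Sum>j\<le>k. (v i j)\<^sup>2) = 1}"
  let ?B = "{x :: nat \<Rightarrow> real. (\<forall>j. x j \<in> {-1..1}) \<and> (\<forall>j\<ge>Suc k. x j = 0)}"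
  have "compact (PiE UNIV (\<lambda>j. if j \<le> k then {-1..1} else {0::real}))"
    using compactin_PiE[of "\<lambda>_. euclidean" UNIV "\<lambda>j. if j \<le> k then {-1..1} else {0::real}"]
    by (simp add: euclidean_product_topology)
  moreover have "PiE UNIV (\<lambda>j. if j \<le> k then {-1..1} else {0::real}) = ?B"
  proof (rule Set.set_eqI)
    fix x :: "nat \<Rightarrow> real"
    have "x j \<in> (if j \<le> k then {-1..1} else {0}) \<longleftrightarrow> x j \<in> {-1..1} \<and> (j \<ge> Suc k \<longrightarrow> x j = 0)" for j
      by (cases "j \<le> k") auto
    then show "x \<in> PiE UNIV (\<lambda>j. if j \<le> k then {-1..1} else {0::real}) \<longleftrightarrow> x \<in> ?B"
      unfolding PiE_UNIV_domain Pi_iff mem_Collect_eq by blast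
  qed
  ultimately have "compact ?B" by simp
  then have "compactin (Euclidean_space (Suc k)) ?B"
    unfolding Euclidean_space_def by (auto simp: compactin_subtopology euclidean_product_topology)
  then have "compactin ?P (PiE {..<n} (\<lambda>_. ?B))" by (simp add: compactin_PiE)
  moreover have "closedin ?P (topspace ?P \<inter> ?A)"
  proof -
    have c: "continuous_map ?P euclideanreal (\<lambda>w. w i j)" if "i < n" for i j
      by (rule continuous_map_Euclidean_tuple_component[OF that])
    have 1: "closedin ?P {w \<in> topspace ?P. (\<Sum>i<n. w i j) \<in> {0}}" for j
    proof (rule closedin_continuous_map_preimage[of _ euclideanreal])
      show "continuous_map ?P euclideanreal (\<lambda>w. \<Sum>i<n. w i j)" by (intro continuous_map_sum c) simp_all
    qed (simp flip: closed_closedin)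
    have 2: "closedin ?P {w \<in> topspace ?P. (\<Sum>i<n. \<Sum>j\<le>k. (w i j)\<^sup>2) \<in> {1}}"
    proof (rule closedin_continuous_map_preimage[of _ euclideanreal])
      show "continuous_map ?P euclideanreal (\<lambda>w. \<Sum>i<n. \<Sum>j\<le>k. (w i j)\<^sup>2)"
        by (intro continuous_map_sum continuous_map_real_pow c) simp_all
    qed (simp flip: closed_closedin)
    have "topspace ?P \<inter> ?A = {w \<in> topspace ?P. (\<Sum>i<n. \<Sum>j\<le>k. (w i j)\<^sup>2) \<in> {1}} \<inter>
      (\<Inter>j\<in>{..k}. {w \<in> topspace ?P. (\<Sum>i<n. w i j) \<in> {0}})"
      by auto
    moreover have "closedin ?P (\<Inter>j\<in>{..k}. {w \<in> topspace ?P. (\<Sum>i<n. w i j) \<in> {0}})"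
      using 1 by (intro closedin_INT) auto
    ultimately show ?thesis using 2 by (simp only: closedin_Int)
  qed
  ultimately have "compactin ?P ((topspace ?P \<inter> ?A) \<inter> PiE {..<n} (\<lambda>_. ?B))" by (rule closed_Int_compactin[rotated])
  moreover have "topspace ?P \<inter> ?A \<subseteq> PiE {..<n} (\<lambda>_. ?B)"
  proof
    fix w assume w: "w \<in> topspace ?P \<inter> ?A"
    have "\<bar>w i j\<bar> \<le> 1" if i: "i < n" for i j
    proof (cases "j \<le> k")
      case True
      have "(w i j)\<^sup>2 \<le> (\<Sum>j\<le>k. (w i j)\<^sup>2)" using True by (intro member_le_sum) auto
      also have "\<dots> \<le> (\<Sum>i<n. \<Sum>j\<le>k. (w i j)\<^sup>2)"
        using i by (intro member_le_sum[of i "{..<n}" "\<lambda>i. \<Sum>j\<le>k. (w i j)\<^sup>2"]) (auto intro: sum_nonneg)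
      finally have "(w i j)\<^sup>2 \<le> 1" using w by simp
      then show ?thesis by (simp add: abs_square_le_1)
    next
      case False
      then show ?thesis using w i by (auto simp: topspace_Euclidean_space PiE_iff)
    qed
    then show "w \<in> PiE {..<n} (\<lambda>_. ?B)"
      using w by (auto simp: topspace_Euclidean_space PiE_iff abs_le_iff minus_le_iff)
  qed
  ultimately have "compactin ?P (topspace ?P \<inter> ?A)" by (simp add: Int_absorb2)
  then have "compact_space (subtopology ?P (topspace ?P \<inter> ?A))" by (rule compact_space_subtopology)
  then show ?thesis unfolding sum_zero_sphere_def by (simp only: subtopology_restrict)
qed

text \<open>The diagonal of \<open>(\<real>\<^bsup>k+1\<^esup>)\<^bsup>n\<^esup>\<close> and the tuples with sum zero are orthogonal complements, so the unit
sphere is the join of their unit spheres; permutations act on the second factor only.\<close>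

definition join_vectors :: "nat \<Rightarrow> (nat \<Rightarrow> real) \<Rightarrow> (nat \<Rightarrow> nat \<Rightarrow> real) \<Rightarrow> real \<Rightarrow> nat \<Rightarrow> nat \<Rightarrow> real" where
  "join_vectors n a w \<tau> i = (\<lambda>j. sqrt (1 - \<tau>) / sqrt n * a j + sqrt \<tau> * w i j)"

text \<open>Each end of the join forgets one coordinate: its coefficient is 0 there, so the zero
  vector or tuple inserted for it has no effect.\<close>

definition join_sum :: "nat \<Rightarrow> (nat \<Rightarrow> real) + (((nat \<Rightarrow> real) \<times> (nat \<Rightarrow> nat \<Rightarrow> real) set) \<times> real) + (nat \<Rightarrow> nat \<Rightarrow> real) set
    \<Rightarrow> ((nat \<Rightarrow> real) \<Rightarrow> real) \<Rightarrow> real" where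
  "join_sum n z = (case z of Inl a \<Rightarrow> msum n (join_vectors n a (\<lambda>_ _. 0) 0)
     | Inr (Inl y) \<Rightarrow> msum n (join_vectors n (fst (fst y)) (SOME w. w \<in> snd (fst y)) (snd y))
     | Inr (Inr C) \<Rightarrow> msum n (join_vectors n (\<lambda>_. 0) (SOME w. w \<in> C) 1))"

abbreviation Q_class :: "nat \<Rightarrow> nat \<Rightarrow> (nat \<Rightarrow> nat \<Rightarrow> real) \<Rightarrow> (nat \<Rightarrow> nat \<Rightarrow> real) set" where
  "Q_class n k \<equiv> quot_class (sum_zero_sphere n k) (perm_rel n)"

lemma msum_join_vectors_perm:
  assumes "perm_rel n v w" shows "msum n (join_vectors n a v \<tau>) = msum n (join_vectors n a w \<tau>)"
  using assms unfolding perm_rel_def msum_eq_iff by (auto simp: join_vectors_def)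

lemma msum_join_vectors_some:
  "msum n (join_vectors n a (SOME v. v \<in> Q_class n k w) \<tau>) = msum n (join_vectors n a w \<tau>)"
proof -
  have "w \<in> Q_class n k w" by (simp add: quot_class_def)
  then have "(SOME v. v \<in> Q_class n k w) \<in> Q_class n k w"
    by (rule someI[where P = "\<lambda>v. v \<in> Q_class n k w" and x = w])
  then have "msum n (join_vectors n a w \<tau>) = msum n (join_vectors n a (SOME v. v \<in> Q_class n k w) \<tau>)"
    unfolding quot_class_def mem_Collect_eq
    by (rule equivclp_invariant[where f = "\<lambda>v. msum n (join_vectors n a v \<tau>)"]) (simp add: msum_join_vectors_perm)
  then show ?thesis ..
qed

lemma join_vectors_0: "join_vectors n a w 0 = join_vectors n a w' 0"
  by (simp add: join_vectors_def fun_eq_iff)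

lemma join_vectors_1: "join_vectors n a w 1 = join_vectors n a' w 1"
  by (simp add: join_vectors_def fun_eq_iff)

lemma join_sum_simps:
  "join_sum n (Inl a) = msum n (join_vectors n a w 0)"
  "join_sum n (Inr (Inl ((a, Q_class n k w), \<tau>))) = msum n (join_vectors n a w \<tau>)"
  "join_sum n (Inr (Inr (Q_class n k w))) = msum n (join_vectors n a w 1)"
proof -
  show "join_sum n (Inl a) = msum n (join_vectors n a w 0)"
    unfolding join_sum_def sum.case by (rule arg_cong[OF join_vectors_0])
  show "join_sum n (Inr (Inl ((a, Q_class n k w), \<tau>))) = msum n (join_vectors n a w \<tau>)"
    unfolding join_sum_def sum.case fst_conv snd_conv by (rule msum_join_vectors_some)
  show "join_sum n (Inr (Inr (Q_class n k w))) = msum n (join_vectors n a w 1)"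
    unfolding join_sum_def sum.case msum_join_vectors_some by (rule arg_cong[OF join_vectors_1])
qed

lemma join_sum_rel: "join_rel z z' \<Longrightarrow> join_sum n z = join_sum n z'"
proof (induction rule: join_rel.induct)
  case (1 x y)
  show ?case unfolding join_sum_def sum.case fst_conv snd_conv by (rule arg_cong[OF join_vectors_0])
next
  case (2 x y)
  show ?case unfolding join_sum_def sum.case fst_conv snd_conv by (rule arg_cong[OF join_vectors_1])
qed

text \<open>Summing over the indices removes \<open>w\<close> and is insensitive to permutations, so
  it recovers the diagonal component from the unordered tuple.\<close>

lemma sum_join_vectors:
  assumes "n \<ge> 1" and "(\<Sum>i<n. w i j) = 0"
  shows "(\<Sum>i<n. join_vectors n a w \<tau> i j) = sqrt n * (sqrt (1 - \<tau>) * a j)"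
proof -
  have "(\<Sum>i<n. join_vectors n a w \<tau> i j) = n * (sqrt (1 - \<tau>) / sqrt n * a j) + sqrt \<tau> * (\<Sum>i<n. w i j)"
    by (simp add: join_vectors_def sum.distrib sum_distrib_left)
  also have "n * (sqrt (1 - \<tau>) / sqrt n * a j) = n / sqrt n * (sqrt (1 - \<tau>) * a j)" by simp
  finally show ?thesis using assms by (simp add: real_div_sqrt)
qed

text \<open>By \<open>sum_join_vectors\<close> the multiples \<open>sqrt (1 - \<tau>)\<close> of
  \<open>a\<close> are recovered; the norm gives \<open>\<tau>\<close>, and then \<open>a\<close>
  follows unless the factor is 0. The diagonal part is common to all entries, so subtracting it
  leaves \<open>w\<close> up to order.\<close>

lemma join_vectors_determined:
  assumes n: "n \<ge> 1" and a: "a \<in> sphere_set k" "a' \<in> sphere_set k"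
    and w: "\<And>j. (\<Sum>i<n. w i j) = 0" "\<And>j. (\<Sum>i<n. w' i j) = 0"
    and \<tau>: "\<tau> \<in> {0..1}" "\<tau>' \<in> {0..1}"
    and e: "msum n (join_vectors n a w \<tau>) = msum n (join_vectors n a' w' \<tau>')"
  shows "\<tau>' = \<tau>" and "\<tau> < 1 \<Longrightarrow> a' = a"
    and "0 < \<tau> \<Longrightarrow> \<exists>p. p permutes {..<n} \<and> (\<forall>i<n. w' i = w (p i))"
proof -
  obtain p where p: "p permutes {..<n}" and pv: "\<forall>i<n. join_vectors n a' w' \<tau>' i = join_vectors n a w \<tau> (p i)"
    using e unfolding msum_eq_iff by (elim exE conjE) (rule that)
  have s: "sqrt (1 - \<tau>') * a' j = sqrt (1 - \<tau>) * a j" for j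
  proof -
    have "(\<Sum>i<n. join_vectors n a' w' \<tau>' i j) = (\<Sum>i<n. join_vectors n a w \<tau> (p i) j)"
      using pv by (intro sum.cong) auto
    also have "\<dots> = (\<Sum>i<n. join_vectors n a w \<tau> i j)"
      using sum.permute[OF p, of "\<lambda>i. join_vectors n a w \<tau> i j"] by (simp add: o_def)
    finally show ?thesis using n by (simp add: sum_join_vectors[OF n w(1)] sum_join_vectors[OF n w(2)])
  qed
  have "sqn k (\<lambda>j. sqrt (1 - \<tau>') * a' j) = sqn k (\<lambda>j. sqrt (1 - \<tau>) * a j)" by (simp only: s)
  then have "1 - \<tau>' = 1 - \<tau>"
    unfolding sqn_scale sqn_sphere[OF a(1)] sqn_sphere[OF a(2)] using \<tau> by simp
  then show t: "\<tau>' = \<tau>" by simp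
  show "a' = a" if "\<tau> < 1"
  proof
    fix j show "a' j = a j" using s[of j] that unfolding t by simp
  qed
  show "\<exists>p. p permutes {..<n} \<and> (\<forall>i<n. w' i = w (p i))" if "0 < \<tau>"
  proof (intro exI[of _ p] conjI allI impI p ext)
    fix i j assume i: "i < n"
    have "join_vectors n a' w' \<tau>' i j = join_vectors n a w \<tau> (p i) j" using pv i by simp
    moreover have "sqrt (1 - \<tau>) / sqrt n * a' j = sqrt (1 - \<tau>) / sqrt n * a j"
      using s[of j] unfolding t by simp
    ultimately have "sqrt \<tau> * w' i j = sqrt \<tau> * w (p i) j" unfolding join_vectors_def t by linarith
    then show "w' i j = w (p i) j" using that by simp
  qed
qed

text \<open>The cross terms vanish because \<open>w\<close> sums to 0, and the two components have
  squared norms \<open>1 - \<tau>\<close> and \<open>\<tau>\<close>. The alternative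
  \<open>\<tau> = 0\<close> lets the zero tuple replace a unit tuple \<open>w\<close>, which does
  not exist for \<open>n = 1\<close>.\<close>

lemma join_vectors_unit:
  assumes n: "n \<ge> 1" and a: "a \<in> sphere_set k" and w: "\<And>j. (\<Sum>i<n. w i j) = 0" "\<And>i j. i < n \<Longrightarrow> j > k \<Longrightarrow> w i j = 0"
    and wn: "\<tau> = 0 \<or> (\<Sum>i<n. sqn k (w i)) = 1" and \<tau>: "\<tau> \<in> {0..1}"
  shows "join_vectors n a w \<tau> \<in> unit_tuples n k"
proof -
  let ?A = "sqrt (1 - \<tau>) / sqrt n" and ?B = "sqrt \<tau>"
  have A: "n * ?A\<^sup>2 = 1 - \<tau>" using n \<tau> by (simp add: power_divide)
  have "sqn k (join_vectors n a w \<tau> i) = ?A\<^sup>2 * sqn k a + (\<Sum>j\<le>k. 2 * ?A * ?B * a j * w i j) + ?B\<^sup>2 * sqn k (w i)" for i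
    unfolding sqn_def join_vectors_def sum_distrib_left sum.distrib[symmetric]
    by (intro sum.cong refl) (simp only: power2_sum power_mult_distrib mult.assoc mult.left_commute mult.commute add.commute add.left_commute)
  then have "(\<Sum>i<n. sqn k (join_vectors n a w \<tau> i)) =
      n * (?A\<^sup>2 * sqn k a) + (\<Sum>i<n. \<Sum>j\<le>k. 2 * ?A * ?B * a j * w i j) + ?B\<^sup>2 * (\<Sum>i<n. sqn k (w i))"
    by (simp add: sum.distrib sum_distrib_left)
  also have "(\<Sum>i<n. \<Sum>j\<le>k. 2 * ?A * ?B * a j * w i j) = (\<Sum>j\<le>k. 2 * ?A * ?B * a j * (\<Sum>i<n. w i j))"
    unfolding sum_distrib_left by (rule sum.swap)
  also have "\<dots> = 0" by (simp add: w(1))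
  also have "?B\<^sup>2 * (\<Sum>i<n. sqn k (w i)) = \<tau>" using wn \<tau> by auto
  also have "n * (?A\<^sup>2 * sqn k a) = 1 - \<tau>" using A sqn_sphere[OF a] by simp
  finally have "(\<Sum>i<n. sqn k (join_vectors n a w \<tau> i)) = 1" by simp
  moreover have "join_vectors n a w \<tau> i j = 0" if "i < n" "j > k" for i j
    using w(2)[OF that] a that by (simp add: join_vectors_def sphere_set_iff)
  ultimately show ?thesis by (simp add: unit_tuples_def)
qed

abbreviation pre_join :: "nat \<Rightarrow> nat \<Rightarrow> ((nat \<Rightarrow> real) + (((nat \<Rightarrow> real) \<times> (nat \<Rightarrow> nat \<Rightarrow> real) set) \<times> real) + (nat \<Rightarrow> nat \<Rightarrow> real) set) topology" where
  "pre_join n k \<equiv> coprod_topology (nsphere k)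
     (coprod_topology (prod_topology (prod_topology (nsphere k) (Q_space n k)) (top_of_set {0..1})) (Q_space n k))"

text \<open>A normal form: on the two ends the glued copies are used in place of the cylinder, so
  equal points of the join get literally equal representatives.\<close>

definition join_point :: "nat \<Rightarrow> nat \<Rightarrow> (nat \<Rightarrow> real) \<Rightarrow> (nat \<Rightarrow> nat \<Rightarrow> real) \<Rightarrow> real
    \<Rightarrow> (nat \<Rightarrow> real) + (((nat \<Rightarrow> real) \<times> (nat \<Rightarrow> nat \<Rightarrow> real) set) \<times> real) + (nat \<Rightarrow> nat \<Rightarrow> real) set" where
  "join_point n k a w \<tau> = (if \<tau> = 0 then Inl a else if \<tau> = 1 then Inr (Inr (Q_class n k w))
     else Inr (Inl ((a, Q_class n k w), \<tau>)))"

text \<open>The exception \<open>w = 0\<close> provides coordinates for the end \<open>Inl\<close>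
  even if the sum-zero sphere is empty.\<close>

definition join_coords :: "nat \<Rightarrow> nat \<Rightarrow> (nat \<Rightarrow> real) \<Rightarrow> (nat \<Rightarrow> nat \<Rightarrow> real) \<Rightarrow> real \<Rightarrow> bool" where
  "join_coords n k a w \<tau> \<longleftrightarrow> a \<in> sphere_set k \<and> \<tau> \<in> {0..1} \<and>
     (w \<in> topspace (sum_zero_sphere n k) \<or> (\<tau> = 0 \<and> w = (\<lambda>_ _. 0)))"

lemma join_coordsD:
  assumes "join_coords n k a w \<tau>"
  shows "a \<in> sphere_set k" "\<tau> \<in> {0..1}" "(\<Sum>i<n. w i j) = 0" "i < n \<Longrightarrow> j > k \<Longrightarrow> w i j = 0"
    "\<tau> = 0 \<or> (\<Sum>i<n. sqn k (w i)) = 1" "\<tau> \<noteq> 0 \<Longrightarrow> w \<in> topspace (sum_zero_sphere n k)"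
proof -
  show "(\<Sum>i<n. w i j) = 0"
    using assms unfolding join_coords_def topspace_sum_zero_sphere by (cases "j \<le> k") auto
qed (use assms in \<open>auto simp: join_coords_def topspace_sum_zero_sphere\<close>)

lemma join_sum_join_point: "join_sum n (join_point n k a w \<tau>) = msum n (join_vectors n a w \<tau>)"
  unfolding join_point_def using join_sum_simps(1)[of n a w] join_sum_simps(2)[of n a k w \<tau>] join_sum_simps(3)[of n k w a] by simp

lemma join_point_topspace:
  assumes "join_coords n k a w \<tau>" shows "join_point n k a w \<tau> \<in> topspace (pre_join n k)"
  using join_coordsD(1,2,6)[OF assms] by (auto simp: join_point_def Q_space_def)

lemma pre_join_coords:
  assumes z: "z \<in> topspace (pre_join n k)"
  shows "\<exists>a w \<tau>. join_coords n k a w \<tau> \<and>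
    quot_class (pre_join n k) join_rel z = quot_class (pre_join n k) join_rel (join_point n k a w \<tau>)"
proof -
  \<comment> \<open>The end \<open>\<tau> = 1\<close> forgets the coordinate in the sphere, so any
    base point serves there.\<close>
  let ?b = "(\<lambda>j. if j = 0 then 1 else 0) :: nat \<Rightarrow> real"
  have eqI: "quot_class (pre_join n k) join_rel u = quot_class (pre_join n k) join_rel v"
    if "join_rel u v" "u \<in> topspace (pre_join n k)" "v \<in> topspace (pre_join n k)" for u v
    unfolding quot_class_eq_iff by (intro r_into_equivclp conjI that)
  consider (l) a where "z = Inl a" "a \<in> sphere_set k"
    | (m) a C \<tau> where "z = Inr (Inl ((a, C), \<tau>))" "a \<in> sphere_set k" "C \<in> topspace (Q_space n k)" "\<tau> \<in> {0..1}"
    | (r) C where "z = Inr (Inr C)" "C \<in> topspace (Q_space n k)"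
    using z by fastforce
  then show ?thesis
  proof cases
    case l
    then have "join_coords n k a (\<lambda>_ _. 0) 0" by (simp add: join_coords_def)
    moreover have "z = join_point n k a (\<lambda>_ _. 0) 0" using l by (simp add: join_point_def)
    ultimately show ?thesis by blast
  next
    case m
    obtain w where w: "w \<in> topspace (sum_zero_sphere n k)" "C = Q_class n k w"
      using m(3) by (auto simp: Q_space_def)
    have c: "join_coords n k a w \<tau>" using m w by (simp add: join_coords_def)
    have "quot_class (pre_join n k) join_rel z = quot_class (pre_join n k) join_rel (join_point n k a w \<tau>)"
    proof (cases "\<tau> = 0 \<or> \<tau> = 1")
      case True
      then have "join_rel z (join_point n k a w \<tau>)"
        using join_rel.intros(1)[of a C] join_rel.intros(2)[of a C] m(1) w(2) by (auto simp: join_point_def)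
      then show ?thesis by (rule eqI[OF _ z join_point_topspace[OF c]])
    next
      case False
      then show ?thesis using m(1) w(2) by (simp add: join_point_def)
    qed
    with c show ?thesis by blast
  next
    case r
    obtain w where w: "w \<in> topspace (sum_zero_sphere n k)" "C = Q_class n k w"
      using r(2) by (auto simp: Q_space_def)
    have "join_coords n k ?b w 1" using w(1) sphere_set_nonempty[of k] by (simp add: join_coords_def)
    moreover have "z = join_point n k ?b w 1" using r(1) w(2) by (simp add: join_point_def)
    ultimately show ?thesis by blast
  qed
qed

lemma join_sum_respects:
  assumes "quot_class (pre_join n k) join_rel z = quot_class (pre_join n k) join_rel z'"
  shows "join_sum n z = join_sum n z'"
  using assms unfolding quot_class_eq_iff
  by (rule equivclp_invariant) (elim conjE, rule join_sum_rel)

lemma join_point_determined: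
  assumes n: "n \<ge> 1" and c: "join_coords n k a w \<tau>" and c': "join_coords n k a' w' \<tau>'"
    and e: "msum n (join_vectors n a w \<tau>) = msum n (join_vectors n a' w' \<tau>')"
  shows "join_point n k a' w' \<tau>' = join_point n k a w \<tau>"
proof -
  note d = join_vectors_determined[OF n join_coordsD(1)[OF c] join_coordsD(1)[OF c'] join_coordsD(3)[OF c] join_coordsD(3)[OF c']
      join_coordsD(2)[OF c] join_coordsD(2)[OF c'] e]
  have q: "Q_class n k w' = Q_class n k w" if "\<tau> \<noteq> 0"
  proof -
    have "0 < \<tau>" using that join_coordsD(2)[OF c] by simp
    then obtain p where p: "p permutes {..<n}" and pw: "\<forall>i<n. w' i = w (p i)"
      using d(3) by (elim exE conjE meta_impE) (assumption, rule that)
    have ws: "w \<in> topspace (sum_zero_sphere n k)" "w' \<in> topspace (sum_zero_sphere n k)"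
      using join_coordsD(6)[OF c] join_coordsD(6)[OF c'] that d(1) by simp_all
    have "w' = w \<circ> p"
    proof
      fix i show "w' i = (w \<circ> p) i"
      proof (cases "i < n")
        case True then show ?thesis using pw by simp
      next
        case False
        then have "p i = i" using p by (simp add: permutes_not_in)
        then show ?thesis using ws False by (simp add: topspace_sum_zero_sphere)
      qed
    qed
    then have "perm_rel n w w'" using p by (auto simp: perm_rel_def)
    then have "Q_class n k w = Q_class n k w'"
      unfolding quot_class_eq_iff by (intro r_into_equivclp conjI ws)
    then show ?thesis ..
  qed
  have "a' = a" if "\<tau> \<noteq> 1" using d(2) that join_coordsD(2)[OF c] by simp
  then show ?thesis using q unfolding join_point_def d(1) by simp
qed

lemma join_sum_eq_iff:
  assumes n: "n \<ge> 1" and z: "z \<in> topspace (pre_join n k)" "z' \<in> topspace (pre_join n k)"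
  shows "quot_class (pre_join n k) join_rel z = quot_class (pre_join n k) join_rel z' \<longleftrightarrow> join_sum n z = join_sum n z'"
proof
  assume "quot_class (pre_join n k) join_rel z = quot_class (pre_join n k) join_rel z'"
  then show "join_sum n z = join_sum n z'" by (rule join_sum_respects)
next
  assume e: "join_sum n z = join_sum n z'"
  obtain a w \<tau> where c: "join_coords n k a w \<tau>" and z1: "quot_class (pre_join n k) join_rel z = quot_class (pre_join n k) join_rel (join_point n k a w \<tau>)"
    using pre_join_coords[OF z(1)] by (elim exE conjE) (rule that)
  obtain a' w' \<tau>' where c': "join_coords n k a' w' \<tau>'" and z2: "quot_class (pre_join n k) join_rel z' = quot_class (pre_join n k) join_rel (join_point n k a' w' \<tau>')"
    using pre_join_coords[OF z(2)] by (elim exE conjE) (rule that)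
  have "msum n (join_vectors n a w \<tau>) = msum n (join_vectors n a' w' \<tau>')"
    using join_sum_respects[OF z1] join_sum_respects[OF z2] e by (simp add: join_sum_join_point)
  from join_point_determined[OF n c c' this]
  show "quot_class (pre_join n k) join_rel z = quot_class (pre_join n k) join_rel z'" unfolding z1 z2 by (simp only:)
qed

text \<open>The tuple splits into its mean \<open>b\<close>, repeated \<open>n\<close> times, and
  the deviations \<open>u\<close>. These parts are orthogonal, so with \<open>\<tau>\<close> the
  squared norm of the deviations, the mean contributes \<open>1 - \<tau>\<close>.\<close>

lemma unit_tuple_join_vectors:
  assumes n: "n \<ge> 1" and v: "v \<in> unit_tuples n k"
  shows "\<exists>a w \<tau>. join_coords n k a w \<tau> \<and> msum n (join_vectors n a w \<tau>) = msum n v"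
proof -
  define b where "b j = (\<Sum>i<n. v i j) / n" for j
  define u where "u i j = v i j - b j" for i j
  define \<tau> where "\<tau> = (\<Sum>i<n. sqn k (u i))"
  have v0: "v i j = 0" if "i < n" "j > k" for i j using v that by (simp add: unit_tuples_def)
  have b0: "b j = 0" if "j > k" for j using v0 that by (simp add: b_def)
  have u0: "u i j = 0" if "i < n" "j > k" for i j using v0[OF that] b0[OF that(2)] by (simp add: u_def)
  have us: "(\<Sum>i<n. u i j) = 0" for j using n by (simp add: u_def b_def sum_subtractf)
  have "sqn k (v i) = sqn k b + (\<Sum>j\<le>k. 2 * b j * u i j) + sqn k (u i)" for i
    unfolding sqn_def sum.distrib[symmetric] u_def
    by (intro sum.cong refl) (simp add: power2_eq_square algebra_simps)
  then have "(\<Sum>i<n. sqn k (v i)) = n * sqn k b + (\<Sum>i<n. \<Sum>j\<le>k. 2 * b j * u i j) + \<tau>"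
    by (simp add: sum.distrib \<tau>_def)
  also have "(\<Sum>i<n. \<Sum>j\<le>k. 2 * b j * u i j) = (\<Sum>j\<le>k. 2 * b j * (\<Sum>i<n. u i j))"
    unfolding sum_distrib_left by (rule sum.swap)
  also have "\<dots> = 0" by (simp add: us)
  finally have norm: "n * sqn k b = 1 - \<tau>" using v by (simp add: unit_tuples_def)
  have \<tau>: "\<tau> \<in> {0..1}"
  proof -
    have "0 \<le> n * sqn k b" by simp
    moreover have "0 \<le> \<tau>" unfolding \<tau>_def by (intro sum_nonneg) simp
    ultimately show ?thesis using norm by simp
  qed
  \<comment> \<open>A vanishing component has no direction and is replaced by the base point or the
    zero tuple. Beyond \<open>n\<close> the normalized tuple is \<open>undefined\<close>, as
    membership in a product over \<open>{..<n}\<close> demands.\<close>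
  define a where "a = (if \<tau> = 1 then (\<lambda>j. if j = 0 then 1 else 0) else radial k b)"
  define w :: "nat \<Rightarrow> nat \<Rightarrow> real" where "w = (if \<tau> = 0 then (\<lambda>_ _. 0) else (\<lambda>i. if i < n then (\<lambda>j. u i j / sqrt \<tau>) else undefined))"
  have a: "a \<in> sphere_set k"
  proof (cases "\<tau> = 1")
    case True then show ?thesis using sphere_set_nonempty[of k] by (simp add: a_def)
  next
    case False
    then have "0 < real n * sqn k b" using norm \<tau> by simp
    then have "0 < sqn k b" using n by (simp add: zero_less_mult_iff)
    then have "radial k b \<in> sphere_set k" using b0 by (intro radial_in_sphere) (simp_all add: sqn_def)
    then show ?thesis using False by (simp add: a_def)
  qed
  have ab: "sqrt (1 - \<tau>) / sqrt n * a j = b j" for j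
  proof (cases "\<tau> = 1")
    case True
    then have "sqn k b = 0" using norm n by simp
    then have "b j = 0" using sqn_eq_0D[of k b j] b0[of j] by (cases "j \<le> k") auto
    then show ?thesis using True by simp
  next
    case False
    have "sqn k b = (1 - \<tau>) / n" using norm n by (simp add: field_simps)
    then have "sqrt (1 - \<tau>) / sqrt n = sqrt (sqn k b)" by (simp add: real_sqrt_divide)
    moreover have "sqn k b \<noteq> 0" using norm False by auto
    ultimately show ?thesis using False by (simp add: a_def radial_def sqn_def)
  qed
  have uw: "sqrt \<tau> * w i j = u i j" if i: "i < n" for i j
  proof (cases "\<tau> = 0")
    case True
    then have "\<forall>i\<in>{..<n}. sqn k (u i) = 0" unfolding \<tau>_def by (subst (asm) sum_nonneg_eq_0_iff) auto
    then have "u i j = 0" using sqn_eq_0D[of k "u i" j] u0[OF i, of j] i by (cases "j \<le> k") auto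
    then show ?thesis using True by (simp add: w_def)
  next
    case False
    then show ?thesis using i by (simp add: w_def)
  qed
  have "w \<in> topspace (sum_zero_sphere n k)" if "\<tau> \<noteq> 0"
  proof -
    have pos: "0 < \<tau>" using that \<tau> by simp
    have wi: "w i = (\<lambda>j. (1 / sqrt \<tau>) * u i j)" if "i < n" for i using that pos by (simp add: w_def)
    have "(\<Sum>i<n. w i j) = (1 / sqrt \<tau>) * (\<Sum>i<n. u i j)" for j
      using wi by (simp add: sum_distrib_left)
    moreover have "(\<Sum>i<n. sqn k (w i)) = (1 / sqrt \<tau>)\<^sup>2 * \<tau>"
    proof -
      have "sqn k (w i) = (1 / sqrt \<tau>)\<^sup>2 * sqn k (u i)" if "i < n" for i
        unfolding wi[OF that] by (rule sqn_scale)
      then have "(\<Sum>i<n. sqn k (w i)) = (1 / sqrt \<tau>)\<^sup>2 * (\<Sum>i<n. sqn k (u i))"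
        by (simp add: sum_distrib_left)
      also have "(\<Sum>i<n. sqn k (u i)) = \<tau>" by (rule \<tau>_def[symmetric])
      finally show ?thesis .
    qed
    ultimately show ?thesis
      unfolding topspace_sum_zero_sphere using us wi u0 pos by (auto simp: w_def power_divide)
  qed
  then have c: "join_coords n k a w \<tau>" using a \<tau> by (auto simp: join_coords_def w_def)
  have "join_vectors n a w \<tau> i = v i" if "i < n" for i
    using ab uw[OF that] by (simp add: join_vectors_def u_def fun_eq_iff)
  then have "msum n (join_vectors n a w \<tau>) = msum n v" by (rule msum_cong)
  with c show ?thesis by blast
qed

lemma join_sum_image:
  assumes n: "n \<ge> 1"
  shows "join_sum n ` topspace (pre_join n k) = msum n ` unit_tuples n k"
proof
  show "join_sum n ` topspace (pre_join n k) \<subseteq> msum n ` unit_tuples n k"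
  proof
    fix f assume "f \<in> join_sum n ` topspace (pre_join n k)"
    then obtain z where z: "z \<in> topspace (pre_join n k)" "f = join_sum n z" by (elim imageE) (rule that)
    obtain a w \<tau> where c: "join_coords n k a w \<tau>" and z1: "quot_class (pre_join n k) join_rel z = quot_class (pre_join n k) join_rel (join_point n k a w \<tau>)"
      using pre_join_coords[OF z(1)] by (elim exE conjE) (rule that)
    have "f = msum n (join_vectors n a w \<tau>)"
      unfolding z(2) join_sum_respects[OF z1] by (rule join_sum_join_point)
    moreover have "join_vectors n a w \<tau> \<in> unit_tuples n k"
      by (rule join_vectors_unit[OF n join_coordsD(1)[OF c] join_coordsD(3)[OF c] join_coordsD(4)[OF c] join_coordsD(5)[OF c] join_coordsD(2)[OF c]])
    ultimately show "f \<in> msum n ` unit_tuples n k" by (rule image_eqI)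
  qed
  show "msum n ` unit_tuples n k \<subseteq> join_sum n ` topspace (pre_join n k)"
  proof
    fix f assume "f \<in> msum n ` unit_tuples n k"
    then obtain v where v: "v \<in> unit_tuples n k" "f = msum n v" by (elim imageE) (rule that)
    obtain a w \<tau> where c: "join_coords n k a w \<tau>" and e: "msum n (join_vectors n a w \<tau>) = msum n v"
      using unit_tuple_join_vectors[OF n v(1)] by (elim exE conjE) (rule that)
    have "f = join_sum n (join_point n k a w \<tau>)" unfolding v(2) e[symmetric] join_sum_join_point ..
    then show "f \<in> join_sum n ` topspace (pre_join n k)" by (rule image_eqI) (rule join_point_topspace[OF c])
  qed
qed

section \<open>Continuity of the map on the join\<close>

lemma continuous_map_join_vectors_component:
  assumes a: "continuous_map Z (nsphere k) a" and w: "continuous_map Z (sum_zero_sphere n k) w"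
    and t: "continuous_map Z euclideanreal t" and i: "i < n"
  shows "continuous_map Z euclideanreal (\<lambda>z. join_vectors n (a z) (w z) (t z) i j)"
proof -
  have sq: "continuous_map euclideanreal euclideanreal sqrt"
    by (simp add: continuous_on_real_sqrt continuous_on_id)
  have a': "continuous_map Z euclideanreal (\<lambda>z. a z j)"
    using continuous_map_compose[OF a continuous_map_nsphere_projection] by (simp add: o_def)
  have w': "continuous_map Z euclideanreal (\<lambda>z. w z i j)"
  proof -
    have "continuous_map (sum_zero_sphere n k) euclideanreal (\<lambda>w. w i j)"
      unfolding sum_zero_sphere_def
      by (rule continuous_map_from_subtopology[OF continuous_map_Euclidean_tuple_component[OF i]])
    from continuous_map_compose[OF w this] show ?thesis by (simp add: o_def)
  qed
  have s: "continuous_map Z euclideanreal (\<lambda>z. sqrt (t z))"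
    using continuous_map_compose[OF t sq] by (simp add: o_def)
  have t1: "continuous_map Z euclideanreal (\<lambda>z. 1 - t z)"
    by (intro continuous_map_diff t) simp
  have s': "continuous_map Z euclideanreal (\<lambda>z. sqrt (1 - t z))"
    using continuous_map_compose[OF t1 sq] by (simp add: o_def)
  have "continuous_map Z euclideanreal (\<lambda>z. (1 / sqrt n) * (sqrt (1 - t z) * a z j) + sqrt (t z) * w z i j)"
    by (intro continuous_map_add continuous_map_real_mult s s' a' w') simp
  then show ?thesis by (simp add: join_vectors_def)
qed

text \<open>On the cylinder the map is continuous before orbits are taken, and the orbit map remains
  a quotient map after multiplication with the locally compact Hausdorff spaces
  \<open>nsphere k\<close> and \<open>[0,1]\<close>.\<close>

lemma continuous_map_join_sum:
  "continuous_map (pre_join n k) (powertop_real UNIV) (join_sum n)"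
proof (intro continuous_map_from_coprod_topology)
  let ?S = "nsphere k" and ?Y = "sum_zero_sphere n k" and ?I = "top_of_set {0..1::real}"
  show "continuous_map ?S (powertop_real UNIV) (\<lambda>a. join_sum n (Inl a))"
  proof -
    have "continuous_map ?S euclideanreal (\<lambda>a. join_vectors n a (\<lambda>_ _. 0) 0 i j)" for i j
    proof -
      have "continuous_map ?S euclideanreal (\<lambda>a. (1 / sqrt n) * a j)"
        by (intro continuous_map_real_mult continuous_map_nsphere_projection) simp
      then show ?thesis by (simp add: join_vectors_def)
    qed
    then show ?thesis unfolding join_sum_simps(1)[of n _ "\<lambda>_ _. 0"] by (intro continuous_map_msum)
  qed
  have S: "locally_compact_space ?S" "Hausdorff_space ?S \<or> regular_space ?S"
  proof -
    have "compact_space (top_of_set (sphere_set k))"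
      by (rule compact_space_subtopology) (simp add: compact_sphere_set)
    then have "compact_space ?S" by (subst nsphere_top_of_set)
    moreover have H: "Hausdorff_space ?S" by (subst nsphere_top_of_set) (simp add: Hausdorff_space_subtopology)
    ultimately show "locally_compact_space ?S" by (intro compact_imp_locally_compact_space)
    show "Hausdorff_space ?S \<or> regular_space ?S" using H ..
  qed
  have I: "locally_compact_space ?I" "Hausdorff_space ?I \<or> regular_space ?I"
    by (auto intro!: compact_imp_locally_compact_space Hausdorff_space_subtopology compact_space_subtopology)
  have Q: "quotient_map ?Y (Q_space n k) (Q_class n k)"
    unfolding Q_space_def by (rule quotient_map_quot_class)
  note Q2 = quotient_map_prod_left[OF I quotient_map_prod_right[OF S Q]]
  show "continuous_map (prod_topology (prod_topology ?S (Q_space n k)) ?I) (powertop_real UNIV) (\<lambda>y. join_sum n (Inr (Inl y)))"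
  proof (rule continuous_compose_quotient_map[OF Q2])
    let ?Z = "prod_topology (prod_topology ?S ?Y) ?I"
    have "continuous_map ?Z (powertop_real UNIV) (\<lambda>z. msum n (join_vectors n (fst (fst z)) (snd (fst z)) (snd z)))"
    proof (intro continuous_map_msum continuous_map_join_vectors_component)
      show "continuous_map ?Z ?S (\<lambda>z. fst (fst z))"
        using continuous_map_compose[OF continuous_map_fst continuous_map_fst] by (simp add: o_def)
      show "continuous_map ?Z ?Y (\<lambda>z. snd (fst z))"
        using continuous_map_compose[OF continuous_map_fst continuous_map_snd] by (simp add: o_def)
      have "continuous_map ?Z ?I snd" by (rule continuous_map_snd)
      then show "continuous_map ?Z euclideanreal snd" by (rule continuous_map_into_fulltopology)
    qed
    moreover have "(\<lambda>y. join_sum n (Inr (Inl y))) \<circ> (\<lambda>(x, y). ((case x of (x, y) \<Rightarrow> (x, Q_class n k y)), y)) =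
      (\<lambda>z. msum n (join_vectors n (fst (fst z)) (snd (fst z)) (snd z)))"
      by (rule ext) (simp add: split_beta join_sum_simps(2))
    ultimately show "continuous_map ?Z (powertop_real UNIV)
      ((\<lambda>y. join_sum n (Inr (Inl y))) \<circ> (\<lambda>(x, y). ((case x of (x, y) \<Rightarrow> (x, Q_class n k y)), y)))" by simp
  qed
  show "continuous_map (Q_space n k) (powertop_real UNIV) (\<lambda>C. join_sum n (Inr (Inr C)))"
  proof (rule continuous_compose_quotient_map[OF Q])
    let ?b = "(\<lambda>j. if j = 0 then 1 else 0) :: nat \<Rightarrow> real"
    have "continuous_map ?Y (powertop_real UNIV) (\<lambda>w. msum n (join_vectors n ?b w 1))"
      by (intro continuous_map_msum continuous_map_join_vectors_component[where k = k]) (simp_all add: sphere_set_nonempty)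
    moreover have "(\<lambda>C. join_sum n (Inr (Inr C))) \<circ> Q_class n k = (\<lambda>w. msum n (join_vectors n ?b w 1))"
      by (rule ext) (simp add: join_sum_simps(3)[of n k _ ?b])
    ultimately show "continuous_map ?Y (powertop_real UNIV) ((\<lambda>C. join_sum n (Inr (Inr C))) \<circ> Q_class n k)" by simp
  qed
qed

lemma iterated_suspension_homeomorphic:
  assumes n: "n \<ge> 1"
  shows "iterated_suspension k (Q_space n k) homeomorphic_space
    subtopology (powertop_real UNIV) (msum n ` unit_tuples n k)"
proof -
  have S: "compact_space (nsphere k)"
    by (subst nsphere_top_of_set) (rule compact_space_subtopology, simp add: compact_sphere_set)
  have Q: "compact_space (Q_space n k)"
    unfolding Q_space_def by (rule compact_space_quotient_map[OF quotient_map_quot_class compact_sum_zero_sphere])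
  have I: "compact_space (top_of_set {0..1::real})" by (rule compact_space_subtopology) simp
  have K: "compact_space (pre_join n k)"
    by (intro compact_space_coprod_topology S Q) (simp add: compact_space_prod_topology S Q I)
  have "iterated_suspension k (Q_space n k) homeomorphic_space
    subtopology (powertop_real UNIV) (join_sum n ` topspace (pre_join n k))"
    unfolding iterated_suspension_def join_space_def
    by (rule homeomorphic_space_image[OF K quotient_map_quot_class Hausdorff_powertop_real continuous_map_join_sum])
      (rule join_sum_eq_iff[OF n])
  then show ?thesis unfolding join_sum_image[OF n] .
qed

theorem theorem1p5:
  fixes n k :: nat
  assumes "n \<ge> 1" and "k \<ge> 1"
  shows "barycenter_space n (nsphere k) homotopy_equivalent_space
         iterated_suspension k (Q_space n k)"
proof -
  let ?C = "top_of_set (configs n k)"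
  have "barycenter_space n (nsphere k) homotopy_equivalent_space quotient_space ?C (same_measure n)"
    by (rule homeomorphic_imp_homotopy_equivalent_space[OF barycenter_space_homeomorphic[OF assms(1)]])
  also have "quotient_space ?C (same_measure n) homotopy_equivalent_space quotient_space ?C (same_sum n)"
    by (rule homotopy_equivalent_space_sym[THEN iffD1, OF same_sum_same_measure_homotopy_equivalent[OF assms(1)]])
  also have "quotient_space ?C (same_sum n) homotopy_equivalent_space iterated_suspension k (Q_space n k)"
    by (rule homeomorphic_imp_homotopy_equivalent_space, rule homeomorphic_space_trans[OF same_sum_quotient_homeomorphic[OF assms(1)]],
      rule homeomorphic_space_sym[THEN iffD1, OF iterated_suspension_homeomorphic[OF assms(1)]])
  finally show ?thesis .
qed

end
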